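(* Let $\theta\in\mathbb{R}$ with $\theta\neq 1$, $\xi\in[0,1]$ and $\Omega\in\{\mathbb{R},\mathbb{R}_{<0}\}$, and assume that $(\theta,\xi,\Omega)$ belongs to one of the parameter regimes (i)-(v) below, which also specify a constant $\lambda>0$ and a function $h:\mathbb{R}\to\mathbb{R}$. (i) $0<\theta<1$, $\xi\in[0,1)$, $\Omega=\mathbb{R}$, $\lambda=(1-\xi)(1-\theta)$ and $$h(x)=\begin{cases} e^{\frac{\theta}{\theta-1}x}, & x>0,\\ e^{\frac{\theta x}{1-\theta}}\sum_{m=0}^\infty\frac{\left(-\frac{\theta x}{1-\theta}\right)^m}{m!}\left(\frac{-\xi}{\lambda}(1-\theta);\theta\right)_m, & x\le 0.\end{cases}$$ (ii) $\theta>1$, $\xi\in(0,1]$, $\Omega=\mathbb{R}_{<0}$, $\lambda=\left(1-\frac1\theta\right)\xi$ and $$h(x)=\begin{cases} 0, & x>0,\\ e_\theta\left(\frac{1-\xi}{\lambda}\right)\sum_{j=0}^\infty\frac{\left(\frac{-\xi}{\lambda}\right)^j}{[j]_\theta!}e^{\frac{\theta(1-\theta^j)}{1-\theta}x}, & x\le 0.\end{cases}$$ (iii) $\theta<0$, $\xi\in(0,1)$, $\Omega=\mathbb{R}$, $\lambda=\frac{\sqrt{\xi(1-\xi)}}{\arctan_{-\theta}\left(\sqrt{\frac{\xi}{1-\xi}}\right)}$ and $$h(x)=\begin{cases}\cos_{-\theta}\left(\arctan_{-\theta}\left(\sqrt{\tfrac{\xi}{1-\xi}}\right),-x\right), & x>0,\\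 \frac{\sqrt{1-\xi}}{\sqrt{\xi}}\,\sin_{-\theta}\left(\arctan_{-\theta}\left(\sqrt{\tfrac{\xi}{1-\xi}}\right),x\right), & x\le 0.\end{cases}$$ (iv) $\theta<0$, $\xi=0$, $\Omega=\mathbb{R}$, $\lambda=1$ and $h(x)=1$ for $x\ge 0$, $h(x)=e^{-\theta x}$ for $x<0$. (v) $\theta=0$, $\xi\in[0,1)$, $\Omega=\mathbb{R}$, $\lambda=1-\xi$ and $h\equiv 1$. Then $\lambda$ and $h$ satisfy $$\lambda h(x)=\int_{\{t>\theta x\}}h(t)\phi_\xi(t)\,\mathrm{d}t\qquad\text{for all }x\in\mathbb{R},$$ and for every $y\in\Omega$ the limiting process $M'$ of the conditioned chain exists and is a time-homogeneous Markov chain on $\Omega$ with reduced transition kernel $$p'(x_1,\mathrm{d}x_2)=\mathbf{1}_{\{x_2>\theta x_1\}}\frac{h(x_2)}{h(x_1)}\frac1\lambda\phi_\xi(x_2)\,\mathrm{d}x_2,\qquad x_1,x_2\in\Omega.$$ That is, there is a time-homogeneous Markov chain $(Y_k)_{k\ge 0}$ on $\Omega$ with $Y_0=y$ and transition kernel $p'$ such that, with $M'_k:=(Y_k,Y_{k-1})$ for $k\ge 1$, for every $m\ge 1$ and every Borel set $B\subseteq(\mathbb{R}^2)^m$, $$\lim_{n\to\infty}\mathbb{P}_y\big((M_k)_{1\le k\le m}\in B\mid\Omega_n\big)=\mathbb{P}_y\big((M'_k)_{1\le k\le m}\in B\big).$$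
   Context: For $\xi\in[0,1]$ let $\phi_\xi(x)=\xi e^{x}$ for $x<0$ and $\phi_\xi(x)=(1-\xi)e^{-x}$ for $x>0$ (a probability density on $\mathbb{R}$; the value at $0$ is irrelevant). Let $(X_i)_{i\ge 0}$ be i.i.d. with density $\phi_\xi$, let $M_i=(X_{i+1},X_i)$ for $i\ge 1$, let $S=\{(x_2,x_1)\in\mathbb{R}^2: x_2>\theta x_1\}$ and $\Omega_n=\bigcap_{i=1}^n\{M_i\in S\}=\{X_2>\theta X_1,\dots,X_{n+1}>\theta X_n\}$. $\mathbb{P}_y$ is the law under which $X_1=y$ is deterministic (and $X_2,X_3,\dots$ are i.i.d. with density $\phi_\xi$). $q$-notation. $(a;q)_n=\prod_{k=0}^{n-1}(1-aq^k)$. For $q>0$, $q\ne1$: $[k]_q=\frac{1-q^k}{1-q}$, $[n]_q!=\prod_{k=1}^n[k]_q$, and $[n]_1!=n!$. Define $e_q(z)=\sum_{n\ge0}\frac{z^n}{[n]_q!}$, $\cos_q(z)=\sum_{n\ge0}\frac{(-1)^nz^{2n}}{[2n]_q!}$, $\sin_q(z)=\sum_{n\ge0}\frac{(-1)^nz^{2n+1}}{[2n+1]_q!}$. For $q\ge1$ these are entire. For $0<q<1$ the series converge for $|z|<1/(1-q)$, and the same symbols denote the meromorphic continuations to $\mathbb{C}$, given by $e_q(z)=\prod_{n\ge0}\frac{1}{1-z(1-q)q^n}$, $\cos_q(z)=\frac{e_q(iz)+e_q(-iz)}{2}$, $\sin_q(z)=\frac{e_q(iz)-e_q(-iz)}{2i}$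 (holomorphic on the real line for $\cos_q,\sin_q$). Two-variable functions. For $0<q<1$ and $y\in\mathbb{R}$, or $q>1$ and $y\le0$: $\sin_q(z,y)=\sum_{j\ge0}\frac{(-1)^jz^{2j+1}}{[2j+1]_q!}e^{q\frac{1-q^{2j+1}}{1-q}y}$, $\cos_q(z,y)=\sum_{j\ge0}\frac{(-1)^jz^{2j}}{[2j]_q!}e^{q\frac{1-q^{2j}}{1-q}y}$, and $\sin_1(z,y)=\sin(ze^y)$, $\cos_1(z,y)=\cos(ze^y)$. For $0<q<1$ the symbols again denote the meromorphic continuations in $z$, given by $\sin_q(z,y)=e^{\frac{qy}{1-q}}\sum_{m\ge0}\frac{(-\frac{qy}{1-q})^m}{m!}\sin_q(q^mz)$ and the same formula with $\cos$ in place of $\sin$. For $q>0$, $z_c(q)$ is the smallest positive real zero of $\cos_q$; the function $\tan_q=\sin_q/\cos_q:[0,z_c(q))\to[0,\infty)$ is a strictly increasing bijection, and $\arctan_q:[0,\infty)\to[0,z_c(q))$ denotes its inverse. *)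

theory Defs
  imports "HOL-Probability.Probability"
begin

definition qpochhammer :: "real \<Rightarrow> real \<Rightarrow> nat \<Rightarrow> real" where
  "qpochhammer a q n = (\<Prod>k<n. 1 - a * q ^ k)"

definition qnumber :: "real \<Rightarrow> nat \<Rightarrow> real" where
  "qnumber q k = (1 - q ^ k) / (1 - q)"

definition qfact :: "real \<Rightarrow> nat \<Rightarrow> real" where
  "qfact q n = (if q = 1 then fact n else (\<Prod>k=1..n. qnumber q k))"

text \<open>
  For \<open>q \<ge> 1\<close> these are the entire functions given by the power series. For \<open>0 < q < 1\<close> they are
  the meromorphic continuations of the power series, given by the infinite product. Lemma
  \<open>e_q_eq_series\<close> below shows that the product agrees with the series on the disc of convergence.
  The product is \<open>0\<close> at its poles; these lie on the positive real axis, so that \<open>cos_q\<close> and \<open>sin_q\<close>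
  have poles on the imaginary axis only.
\<close>

definition e_q :: "real \<Rightarrow> 'a :: {real_normed_field, banach} \<Rightarrow> 'a" where
  "e_q q z =
     (if q \<ge> 1 then (\<Sum>n. z ^ n / of_real (qfact q n))
      else (\<Prod>n. 1 / (1 - z * of_real (1 - q) * of_real q ^ n)))"

definition cos_q :: "real \<Rightarrow> complex \<Rightarrow> complex" where
  "cos_q q z =
     (if q \<ge> 1 then (\<Sum>n. (-1) ^ n * z ^ (2 * n) / of_real (qfact q (2 * n)))
      else (e_q q (\<i> * z) + e_q q (- (\<i> * z))) / 2)"

definition sin_q :: "real \<Rightarrow> complex \<Rightarrow> complex" where
  "sin_q q z =
     (if q \<ge> 1 then (\<Sum>n. (-1) ^ n * z ^ (2 * n + 1) / of_real (qfact q (2 * n + 1)))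
      else (e_q q (\<i> * z) - e_q q (- (\<i> * z))) / (2 * \<i>))"

text \<open>
  The two-variable functions. For \<open>q > 1\<close> they are only meaningful for \<open>y \<le> 0\<close>, where the series
  converges; for \<open>0 < q < 1\<close> the formula is that of the meromorphic continuation in \<open>z\<close>.
\<close>

definition sin_q2 :: "real \<Rightarrow> complex \<Rightarrow> real \<Rightarrow> complex" where
  "sin_q2 q z y =
     (if q > 1 then
        (\<Sum>j. (-1) ^ j * z ^ (2 * j + 1) / of_real (qfact q (2 * j + 1))
             * of_real (exp (q * ((1 - q ^ (2 * j + 1)) / (1 - q)) * y)))
      else if q = 1 then sin (z * of_real (exp y))
      else of_real (exp (q * y / (1 - q)))
           * (\<Sum>m. of_real ((- (q * y / (1 - q))) ^ m / fact m) * sin_q q (of_real (q ^ m) * z)))"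

definition cos_q2 :: "real \<Rightarrow> complex \<Rightarrow> real \<Rightarrow> complex" where
  "cos_q2 q z y =
     (if q > 1 then
        (\<Sum>j. (-1) ^ j * z ^ (2 * j) / of_real (qfact q (2 * j))
             * of_real (exp (q * ((1 - q ^ (2 * j)) / (1 - q)) * y)))
      else if q = 1 then cos (z * of_real (exp y))
      else of_real (exp (q * y / (1 - q)))
           * (\<Sum>m. of_real ((- (q * y / (1 - q))) ^ m / fact m) * cos_q q (of_real (q ^ m) * z)))"

text \<open>All of these functions are real on the real axis, so taking real parts below loses nothing.\<close>

definition z_c :: "real \<Rightarrow> real" where
  "z_c q = (LEAST x. 0 < x \<and> cos_q q (of_real x) = 0)"

definition tan_q :: "real \<Rightarrow> real \<Rightarrow> real" where
  "tan_q q x = Re (sin_q q (of_real x) / cos_q q (of_real x))"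

definition arctan_q :: "real \<Rightarrow> real \<Rightarrow> real" where
  "arctan_q q = the_inv_into {0..<z_c q} (tan_q q)"

lemma e_q_eq_series:
  fixes z :: "'a :: {real_normed_field, banach}"
  assumes q: "0 < q" "q < 1" and z: "norm z < 1 / (1 - q)"
  shows "(\<lambda>n. z ^ n / of_real (qfact q n)) sums e_q q z"
proof -
  define c where "c n = 1 / (of_real (qfact q n) :: 'a)" for n
  have qn: "qnumber q (Suc n) > 0" for n
    using q by (simp add: qnumber_def power_less_one_iff del: power_Suc)
  have qf_Suc: "qfact q (Suc n) = qfact q n * qnumber q (Suc n)" for n
    using q by (simp add: qfact_def)
  have qf0: "qfact q 0 = 1"
    using q by (simp add: qfact_def)
  have qf_pos: "qfact q n > 0" for n
    by (induction n) (use qn in \<open>auto simp: qf0 qf_Suc\<close>)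
  have c_Suc: "c (Suc n) * of_real (1 - q ^ Suc n) = of_real (1 - q) * c n" for n
  proof -
    have "1 - q ^ Suc n = (1 - q) * qnumber q (Suc n)"
      using q by (simp add: qnumber_def)
    thus ?thesis
      using qn[of n] qf_pos[of n] by (simp add: c_def qf_Suc del: power_Suc)
  qed
  have summ: "summable (\<lambda>n. c n * w ^ n)" if w: "norm w < 1 / (1 - q)" for w
  proof -
    obtain r where r: "norm w * (1 - q) < r" "r < 1"
      using w q dense[of "norm w * (1 - q)" 1] by (auto simp: field_simps)
    have "(\<lambda>n. norm w * (1 - q) / (1 - q ^ Suc n)) \<longlonglongrightarrow> norm w * (1 - q) / (1 - 0)"
      by (intro tendsto_intros LIMSEQ_Suc LIMSEQ_realpow_zero) (use q in auto)
    hence "eventually (\<lambda>n. norm w * (1 - q) / (1 - q ^ Suc n) < r) sequentially"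
      using r by (intro order_tendstoD) auto
    then obtain N where N: "\<And>n. n \<ge> N \<Longrightarrow> norm w * (1 - q) / (1 - q ^ Suc n) < r"
      by (auto simp: eventually_at_top_linorder)
    show ?thesis
    proof (rule summable_ratio_test[of r N])
      fix n assume n: "n \<ge> N"
      have nz: "1 - q ^ Suc n > 0"
        using q by (simp add: power_less_one_iff del: power_Suc)
      have "c (Suc n) = of_real ((1 - q) / (1 - q ^ Suc n)) * c n"
        using c_Suc[of n] nz by (simp add: field_simps del: power_Suc of_real_diff)
      hence "norm (c (Suc n) * w ^ Suc n)
          = (norm w * (1 - q) / (1 - q ^ Suc n)) * norm (c n * w ^ n)"
        using nz q by (simp add: norm_mult norm_power norm_divide del: of_real_divide of_real_diff)
      also have "\<dots> \<le> r * norm (c n * w ^ n)"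
        using N[OF n] by (intro mult_right_mono) auto
      finally show "norm (c (Suc n) * w ^ Suc n) \<le> r * norm (c n * w ^ n)" .
    qed (use r in auto)
  qed
  define f where "f w = (\<Sum>n. c n * w ^ n)" for w :: 'a
  have feq: "f w * (1 - w * of_real (1 - q)) = f (of_real q * w)" if w: "norm w < 1 / (1 - q)" for w
  proof -
    have w': "norm (of_real q * w) < 1 / (1 - q)"
      using w q mult_left_le_one_le[of "norm w" q] by (simp add: norm_mult)
    have "(\<lambda>n. c n * w ^ n - c n * (of_real q * w) ^ n) sums (f w - f (of_real q * w))"
      unfolding f_def using summ[OF w] summ[OF w'] by (intro sums_diff summable_sums)
    hence "(\<lambda>n. c (Suc n) * w ^ Suc n - c (Suc n) * (of_real q * w) ^ Suc n)
             sums (f w - f (of_real q * w))"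
      by (subst sums_Suc_iff) simp
    moreover have "c (Suc n) * w ^ Suc n - c (Suc n) * (of_real q * w) ^ Suc n
        = w * of_real (1 - q) * (c n * w ^ n)" for n
    proof -
      have "c (Suc n) * w ^ Suc n - c (Suc n) * (of_real q * w) ^ Suc n
          = (c (Suc n) * of_real (1 - q ^ Suc n)) * w ^ Suc n"
        by (simp add: power_mult_distrib algebra_simps)
      thus ?thesis by (subst (asm) c_Suc) (simp add: mult_ac)
    qed
    moreover have "(\<lambda>n. w * of_real (1 - q) * (c n * w ^ n)) sums (w * of_real (1 - q) * f w)"
      unfolding f_def using summ[OF w] by (intro sums_mult summable_sums)
    ultimately have "f w - f (of_real q * w) = w * of_real (1 - q) * f w"
      by (simp add: sums_iff)
    thus ?thesis by (simp add: algebra_simps)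
  qed
  have qle: "norm (of_real (q ^ n) * z) < 1 / (1 - q)" for n
  proof -
    have "norm (of_real (q ^ n) * z) = q ^ n * norm z"
      using q by (simp add: norm_mult norm_power)
    also have "\<dots> \<le> 1 * norm z"
      using q by (intro mult_right_mono power_le_one) auto
    finally show ?thesis using z by simp
  qed
  have nz: "1 - z * of_real (1 - q) * of_real q ^ n \<noteq> 0" for n
  proof
    assume "1 - z * of_real (1 - q) * of_real q ^ n = 0"
    hence "norm (1 :: 'a) = norm (z * of_real (1 - q) * of_real q ^ n)"
      by (simp only: right_minus_eq)
    also have "\<dots> = norm (of_real (q ^ n) * z) * (1 - q)"
      using q by (simp add: norm_mult norm_power mult_ac del: of_real_diff)
    finally have "1 = norm (of_real (q ^ n) * z) * (1 - q)" by simp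
    thus False using qle[of n] q by (simp only: pos_less_divide_eq[of "1 - q"] diff_gt_0_iff_gt)
  qed
  have prod_eq: "f z * (\<Prod>i<n. 1 - z * of_real (1 - q) * of_real q ^ i) = f (of_real (q ^ n) * z)" for n
  proof (induction n)
    case (Suc n)
    have "f z * (\<Prod>i<Suc n. 1 - z * of_real (1 - q) * of_real q ^ i)
        = f (of_real (q ^ n) * z) * (1 - of_real (q ^ n) * z * of_real (1 - q))"
      unfolding Suc.IH[symmetric] by (simp add: mult_ac)
    also have "\<dots> = f (of_real q * (of_real (q ^ n) * z))"
      by (rule feq[OF qle])
    finally show ?case by (simp add: mult_ac)
  qed auto
  have f0: "f 0 = 1"
    unfolding f_def using powser_sums_zero[of c] by (simp add: sums_iff c_def qf0)
  have "isCont f 0"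
  proof -
    have "norm (0 :: 'a) < norm (of_real (1 / (2 * (1 - q))) :: 'a)" using q
      by (simp del: of_real_divide)
    moreover have "norm (of_real (1 / (2 * (1 - q))) :: 'a) < 1 / (1 - q)"
      using q by (simp add: norm_divide field_simps del: of_real_divide)
    ultimately show ?thesis
      unfolding f_def using isCont_powser[OF summ] by blast
  qed
  moreover have "(\<lambda>n. of_real (q ^ n) * z) \<longlonglongrightarrow> of_real 0 * z"
    by (intro tendsto_intros LIMSEQ_realpow_zero) (use q in auto)
  ultimately have lim: "(\<lambda>n. f (of_real (q ^ n) * z)) \<longlonglongrightarrow> 1"
    using isCont_tendsto_compose[of 0 f] by (simp add: f0)
  have fz: "f z \<noteq> 0"
  proof
    assume "f z = 0"
    hence "(\<lambda>n. f (of_real (q ^ n) * z)) = (\<lambda>_. 0)" unfolding prod_eq[symmetric] by simp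
    thus False using lim by (simp add: LIMSEQ_const_iff)
  qed
  have "(\<lambda>n. \<Prod>i\<le>n. 1 / (1 - z * of_real (1 - q) * of_real q ^ i)) \<longlonglongrightarrow> f z"
  proof -
    have "(\<lambda>n. f z / f (of_real (q ^ Suc n) * z)) \<longlonglongrightarrow> f z / 1"
      by (intro tendsto_divide tendsto_const LIMSEQ_Suc[OF lim]) auto
    moreover have "f z / f (of_real (q ^ Suc n) * z)
        = (\<Prod>i\<le>n. 1 / (1 - z * of_real (1 - q) * of_real q ^ i))" for n
    proof -
      have "(\<Prod>i<Suc n. 1 - z * of_real (1 - q) * of_real q ^ i) \<noteq> 0"
        using nz by simp
      thus ?thesis using fz
        by (subst prod_eq[symmetric]) (simp add: prod_dividef lessThan_Suc_atMost del: prod.lessThan_Suc)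
    qed
    ultimately show ?thesis by simp
  qed
  hence "(\<lambda>n. 1 / (1 - z * of_real (1 - q) * of_real q ^ n)) has_prod f z"
    using fz by (simp add: has_prod_def raw_has_prod_def)
  hence "e_q q z = f z"
    using q has_prod_unique by (fastforce simp: e_q_def)
  thus ?thesis
    using summable_sums[OF summ[OF z]] by (simp add: f_def c_def)
qed

definition phi :: "real \<Rightarrow> real \<Rightarrow> real" where
  "phi \<xi> x = (if x < 0 then \<xi> * exp x else (1 - \<xi>) * exp (- x))"

definition h_i :: "real \<Rightarrow> real \<Rightarrow> real \<Rightarrow> real \<Rightarrow> real" where
  "h_i \<theta> \<xi> lam x =
     (if x > 0 then exp (\<theta> / (\<theta> - 1) * x)
      else exp (\<theta> * x / (1 - \<theta>))
           * (\<Sum>m. (- (\<theta> * x / (1 - \<theta>))) ^ m / fact m * qpochhammer (- \<xi> / lam * (1 - \<theta>)) \<theta> m))"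

definition h_ii :: "real \<Rightarrow> real \<Rightarrow> real \<Rightarrow> real \<Rightarrow> real" where
  "h_ii \<theta> \<xi> lam x =
     (if x > 0 then 0
      else e_q \<theta> ((1 - \<xi>) / lam)
           * (\<Sum>j. (- \<xi> / lam) ^ j / qfact \<theta> j * exp (\<theta> * (1 - \<theta> ^ j) / (1 - \<theta>) * x)))"

definition h_iii :: "real \<Rightarrow> real \<Rightarrow> real \<Rightarrow> real" where
  "h_iii \<theta> \<xi> x =
     (if x > 0 then Re (cos_q2 (- \<theta>) (of_real (arctan_q (- \<theta>) (sqrt (\<xi> / (1 - \<xi>))))) (- x))
      else sqrt (1 - \<xi>) / sqrt \<xi>
           * Re (sin_q2 (- \<theta>) (of_real (arctan_q (- \<theta>) (sqrt (\<xi> / (1 - \<xi>))))) x))"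

definition h_iv :: "real \<Rightarrow> real \<Rightarrow> real" where
  "h_iv \<theta> x = (if x \<ge> 0 then 1 else exp (- \<theta> * x))"

definition regime :: "real \<Rightarrow> real \<Rightarrow> real set \<Rightarrow> real \<Rightarrow> (real \<Rightarrow> real) \<Rightarrow> bool" where
  "regime \<theta> \<xi> \<Omega> lam h \<longleftrightarrow>
     (0 < \<theta> \<and> \<theta> < 1 \<and> \<xi> \<in> {0..<1} \<and> \<Omega> = UNIV \<and>
        lam = (1 - \<xi>) * (1 - \<theta>) \<and> h = h_i \<theta> \<xi> lam) \<or>
     (\<theta> > 1 \<and> \<xi> \<in> {0<..1} \<and> \<Omega> = {..<0} \<and>
        lam = (1 - 1 / \<theta>) * \<xi> \<and> h = h_ii \<theta> \<xi> lam) \<or>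
     (\<theta> < 0 \<and> \<xi> \<in> {0<..<1} \<and> \<Omega> = UNIV \<and>
        lam = sqrt (\<xi> * (1 - \<xi>)) / arctan_q (- \<theta>) (sqrt (\<xi> / (1 - \<xi>))) \<and> h = h_iii \<theta> \<xi>) \<or>
     (\<theta> < 0 \<and> \<xi> = 0 \<and> \<Omega> = UNIV \<and> lam = 1 \<and> h = h_iv \<theta>) \<or>
     (\<theta> = 0 \<and> \<xi> \<in> {0..<1} \<and> \<Omega> = UNIV \<and> lam = 1 - \<xi> \<and> h = (\<lambda>_. 1))"

text \<open>
  The law \<open>P\<^sub>y\<close> on the path space: the coordinates \<open>X\<^sub>i(\<omega>) = \<omega> i\<close> are independent, \<open>X\<^sub>1 = y\<close>, and
  all other \<open>X\<^sub>i\<close> have density \<open>phi \<xi>\<close>.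
\<close>

definition P_y :: "real \<Rightarrow> real \<Rightarrow> (nat \<Rightarrow> real) measure" where
  "P_y \<xi> y = (\<Pi>\<^sub>M i\<in>UNIV. if i = 1 then return borel y else density lborel (\<lambda>x. ennreal (phi \<xi> x)))"

definition M_chain :: "nat \<Rightarrow> (nat \<Rightarrow> real) \<Rightarrow> real \<times> real" where
  "M_chain i \<omega> = (\<omega> (i + 1), \<omega> i)"

definition S_set :: "real \<Rightarrow> (real \<times> real) set" where
  "S_set \<theta> = {(x2, x1). x2 > \<theta> * x1}"

definition survives :: "real \<Rightarrow> nat \<Rightarrow> (nat \<Rightarrow> real) \<Rightarrow> bool" where
  "survives \<theta> n \<omega> \<longleftrightarrow> (\<forall>i\<in>{1..n}. M_chain i \<omega> \<in> S_set \<theta>)"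

definition kernel' :: "real \<Rightarrow> real \<Rightarrow> real set \<Rightarrow> real \<Rightarrow> (real \<Rightarrow> real) \<Rightarrow> real \<Rightarrow> real measure" where
  "kernel' \<theta> \<xi> \<Omega> lam h x1 =
     density (restrict_space lborel \<Omega>)
       (\<lambda>x2. ennreal (indicator {\<theta> * x1<..} x2 * (h x2 / h x1) * (1 / lam) * phi \<xi> x2))"

definition natural_filtration :: "'w measure \<Rightarrow> 's measure \<Rightarrow> (nat \<Rightarrow> 'w \<Rightarrow> 's) \<Rightarrow> nat \<Rightarrow> 'w measure" where
  "natural_filtration N E Y n =
     vimage_algebra (space N) (\<lambda>\<omega>. \<lambda>k\<in>{..n}. Y k \<omega>) (\<Pi>\<^sub>M k\<in>{..n}. E)"

text \<open>
  Time-homogeneous Markov chain on the measurable space \<open>E\<close> with transition kernel \<open>K\<close> and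
  deterministic initial value \<open>y\<close>. That \<open>K\<close> is measurable into \<open>prob_algebra E\<close> says that it is
  a stochastic kernel on \<open>E\<close>.
\<close>

definition markov_chain ::
    "'w measure \<Rightarrow> 's measure \<Rightarrow> ('s \<Rightarrow> 's measure) \<Rightarrow> 's \<Rightarrow> (nat \<Rightarrow> 'w \<Rightarrow> 's) \<Rightarrow> bool" where
  "markov_chain N E K y Y \<longleftrightarrow>
     prob_space N \<and>
     K \<in> E \<rightarrow>\<^sub>M prob_algebra E \<and>
     (\<forall>k. Y k \<in> N \<rightarrow>\<^sub>M E) \<and>
     (AE \<omega> in N. Y 0 \<omega> = y) \<and>
     (\<forall>n. \<forall>A\<in>sets E. AE \<omega> in N.
        real_cond_exp N (natural_filtration N E Y n) (\<lambda>\<omega>'. indicator A (Y (Suc n) \<omega>')) \<omega>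
          = measure (K (Y n \<omega>)) A)"

end

theory Submission
  imports Defs
begin

text \<open>
  The survival probabilities \<open>P\<^sub>x(\<Omega>\<^sub>n)\<close> are the iterates \<open>T\<^sup>n 1\<close> of the positive operator
  \<open>T f x = \<integral>\<^bsub>{t > \<theta> x}\<^esub> f \<phi>\<close>. Once \<open>lam\<^sup>-\<^sup>n T\<^sup>n 1 \<rightarrow> c h\<close> pointwise and boundedly with \<open>c > 0\<close> and
  \<open>T h = lam h\<close>, the Markov property and dominated convergence turn the conditional laws into the
  \<open>h\<close>-transform of the path law, which is the Markov chain with kernel \<open>p'\<close>.

  The asymptotics of \<open>T\<^sup>n 1\<close> has a different reason in each regime. For \<open>\<theta> > 0\<close> it is explicit on the
  positive half line. In regime (i) the operator on the negative half line is of Volterra type, hence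
  a contraction in a suitable weighted norm; in regime (ii) \<open>T\<^sup>n 1\<close> is a finite sum of exponentials
  whose coefficients are a convolution, as \<open>\<Sum>\<^sub>n T\<^sup>n 1 (-\<infinity>) z\<^sup>n = e\<^sub>\<theta>((1 - \<xi>) z) / e\<^sub>\<theta>(- \<xi> z)\<close>. In regime (iii)
  the \<open>h\<close>-transformed chain satisfies a Doeblin condition after two steps.
\<close>

section \<open>Survival probabilities\<close>

text \<open>The eigenvalue arises differently each time. For 0 < \<theta> < 1, survivors started at
  x \<ge> 0 never leave the positive half line, and survival from 0 has probability (1 - \<xi>)^n /
  [n]!, which is of order lam^n; the Volterra part on the other half line is quasi-nilpotent and
  cannot change this rate. For \<theta> > 1, the denominator e_\<theta>(- \<xi> z) is the product of
  the factors 1 - lam p^n z with p = 1 / \<theta>, so its first zero is 1 / lam, while the numerator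
  is entire. For \<theta> < 0 the two half lines are coupled: differentiating the eigenvalue
  equation gives a delay equation for a pair (C, S), and continuity at 0 demands tan_q z = sqrt
  (\<xi> / (1 - \<xi>)). The solution below z_c is taken because h has to be positive. This sign is
  the main obstacle, since the alternating series do not show it. It is derived from the argument of
  cos_q + i sin_q, which stays in [0, pi / 2) on [0, z_c). In regime (ii) positivity comes instead
  from the limit of h at - infinity: a zero of h would force further zeros running off to -
  infinity.\<close>

definition step_op :: "real \<Rightarrow> real \<Rightarrow> (real \<Rightarrow> real) \<Rightarrow> real \<Rightarrow> real" where
  "step_op \<theta> \<xi> f x = (LINT t:{\<theta> * x<..}|lborel. f t * phi \<xi> t)"

primrec survival :: "real \<Rightarrow> real \<Rightarrow> nat \<Rightarrow> real \<Rightarrow> real" where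
  "survival \<theta> \<xi> 0 = (\<lambda>_. 1)"
| "survival \<theta> \<xi> (Suc n) = step_op \<theta> \<xi> (survival \<theta> \<xi> n)"

lemma phi_measurable [measurable]: "phi \<xi> \<in> borel_measurable borel"
  unfolding phi_def by measurable

lemma phi_nonneg: "\<xi> \<in> {0..1} \<Longrightarrow> phi \<xi> x \<ge> 0"
  by (auto simp: phi_def)

lemma exp_pos_bochner:
  fixes a c :: real assumes "a > 0"
  shows "has_bochner_integral lborel (\<lambda>t. indicator {c<..} t * exp (- (a * t))) (exp (- (a * c)) / a)"
proof -
  have "has_bochner_integral lborel (\<lambda>t. indicator {c..} t * exp (- (a * t))) (exp (- (a * c)) / a)"
  proof (rule has_bochner_integral_nn_integral)
    have "integral\<^sup>N lborel (\<lambda>t. ennreal (exp (- (a * t))) * indicator {c..} t)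
        = ennreal (0 - (- exp (- (a * c)) / a))"
    proof (rule nn_integral_FTC_atLeast[where F = "\<lambda>t. - exp (- (a * t)) / a"])
      have "((\<lambda>t. exp (- (a * t))) \<longlongrightarrow> 0) at_top"
        using assms by (auto intro!: filterlim_compose[OF exp_at_bot] filterlim_tendsto_pos_mult_at_top[OF tendsto_const] filterlim_ident simp: filterlim_uminus_at_bot)
      thus "((\<lambda>t. - exp (- (a * t)) / a) \<longlongrightarrow> 0) at_top"
        using tendsto_divide[OF tendsto_minus tendsto_const, of _ 0 at_top a] assms by fastforce
    qed (use assms in \<open>auto intro!: derivative_eq_intros\<close>)
    thus "(\<integral>\<^sup>+ x. ennreal (indicator {c..} x * exp (- (a * x))) \<partial>lborel) = ennreal (exp (- (a * c)) / a)"
      by (simp add: ennreal_mult'' ennreal_indicator mult.commute)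
  qed (use assms in auto)
  moreover have "AE t in lborel. indicator {c..} t * exp (- (a * t)) = indicator {c<..} t * exp (- (a * t))"
    using AE_lborel_singleton[of c] by eventually_elim (auto split: split_indicator)
  ultimately show ?thesis by (subst has_bochner_integral_cong_AE[symmetric]) auto
qed

lemma exp_neg_bochner:
  fixes a c :: real assumes "a > 0"
  shows "has_bochner_integral lborel (\<lambda>t. indicator {..<c} t * exp (a * t)) (exp (a * c) / a)"
proof -
  have "has_bochner_integral lborel (\<lambda>t. indicator {-c<..} (0 + (-1) *\<^sub>R t) * exp (- (a * (0 + (-1) *\<^sub>R t))))
     ((exp (- (a * (- c))) / a) /\<^sub>R \<bar>-1\<bar>)"
    using exp_pos_bochner[OF assms, of "-c"]
    by (subst (asm) lborel_has_bochner_integral_real_affine_iff[where c = "-1" and t = 0]) auto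
  moreover have "indicator {-c<..} (0 + (-1) *\<^sub>R t) * exp (- (a * (0 + (-1) *\<^sub>R t))) = indicator {..<c} t * exp (a * t)" for t
    by (auto split: split_indicator)
  ultimately show ?thesis by simp
qed

lemma has_bochner_integral_phi: "has_bochner_integral lborel (phi \<xi>) 1"
proof -
  have "has_bochner_integral lborel (\<lambda>t. \<xi> * (indicator {..<0} t * exp (1 * t)) + (1 - \<xi>) * (indicator {0<..} t * exp (- (1 * t))))
     (\<xi> * (exp (1 * 0) / 1) + (1 - \<xi>) * (exp (- (1 * 0)) / 1))"
    by (intro has_bochner_integral_add has_bochner_integral_mult_right exp_neg_bochner exp_pos_bochner) auto
  moreover have "AE t in lborel. \<xi> * (indicator {..<0} t * exp (1 * t)) + (1 - \<xi>) * (indicator {0<..} t * exp (- (1 * t))) = phi \<xi> t"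
    using AE_lborel_singleton[of 0] by eventually_elim (auto simp: phi_def split: split_indicator)
  ultimately show ?thesis by (subst has_bochner_integral_cong_AE[symmetric]) auto
qed

lemma integrable_phi: "integrable lborel (phi \<xi>)"
  using has_bochner_integral_phi by (auto simp: has_bochner_integral_iff)

lemma integrable_bounded_phi:
  assumes [measurable]: "f \<in> borel_measurable borel" and b: "\<And>x. \<bar>f x\<bar> \<le> K"
    and [measurable]: "A \<in> sets borel"
  shows "set_integrable lborel A (\<lambda>t. f t * phi \<xi> t)"
  unfolding set_integrable_def
proof (rule Bochner_Integration.integrable_bound[OF integrable_mult_right[OF integrable_phi, of K]])
  show "AE x in lborel. norm (indicat_real A x *\<^sub>R (f x * phi \<xi> x)) \<le> norm (K * phi \<xi> x)"
    using b by (intro AE_I2) (auto simp: abs_mult indicator_def intro!: mult_right_mono order.trans[OF b])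
qed auto

lemma step_op_measurable [measurable]:
  assumes [measurable]: "f \<in> borel_measurable borel"
  shows "step_op \<theta> \<xi> f \<in> borel_measurable borel"
proof -
  \<comment> \<open>The domain of integration moves with x; as a condition on the pair (x, t) it
    leaves the integrand jointly measurable.\<close>
  have "(\<lambda>x. \<integral>t. (if t > \<theta> * x then 1 else 0) *\<^sub>R (f t * phi \<xi> t) \<partial>lborel) \<in> borel_measurable borel"
    by measurable
  thus ?thesis unfolding step_op_def set_lebesgue_integral_def
    by (rule back_subst[of "\<lambda>f. f \<in> _"])
       (auto intro!: ext Bochner_Integration.integral_cong simp: indicator_def)
qed

lemma step_op_mono:
  assumes "\<xi> \<in> {0..1}" "f \<in> borel_measurable borel" "g \<in> borel_measurable borel"
    and "\<And>x. \<bar>f x\<bar> \<le> K" "\<And>x. \<bar>g x\<bar> \<le> K'" "\<And>x. f x \<le> g x"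
  shows "step_op \<theta> \<xi> f x \<le> step_op \<theta> \<xi> g x"
  unfolding step_op_def
  using assms by (intro set_integral_mono integrable_bounded_phi mult_right_mono phi_nonneg) auto

lemma step_op_cmult: "step_op \<theta> \<xi> (\<lambda>t. c * f t) x = c * step_op \<theta> \<xi> f x"
  unfolding step_op_def by (simp add: mult.assoc set_integral_mult_right)

lemma step_op_diff:
  assumes "f \<in> borel_measurable borel" "g \<in> borel_measurable borel"
    and "\<And>x. \<bar>f x\<bar> \<le> K" "\<And>x. \<bar>g x\<bar> \<le> K'"
  shows "step_op \<theta> \<xi> (\<lambda>t. f t - g t) x = step_op \<theta> \<xi> f x - step_op \<theta> \<xi> g x"
  unfolding step_op_def left_diff_distrib
  using assms by (intro set_integral_diff integrable_bounded_phi) auto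

lemma step_op_bounds:
  assumes "\<xi> \<in> {0..1}" "f \<in> borel_measurable borel" "\<And>x. 0 \<le> f x" "\<And>x. f x \<le> K"
  shows "0 \<le> step_op \<theta> \<xi> f x" "step_op \<theta> \<xi> f x \<le> K"
proof -
  have K: "K \<ge> 0" using assms(3,4)[of 0] by simp
  show "0 \<le> step_op \<theta> \<xi> f x"
    unfolding step_op_def set_lebesgue_integral_def
    using assms by (intro integral_nonneg_AE AE_I2) (auto simp: phi_nonneg)
  have "step_op \<theta> \<xi> f x \<le> (\<integral>t. K * phi \<xi> t \<partial>lborel)"
    unfolding step_op_def set_lebesgue_integral_def
    using assms integrable_bounded_phi[of f K "{\<theta>*x<..}" \<xi>] K
    by (intro integral_mono integrable_mult_right integrable_phi)
       (auto simp: set_integrable_def indicator_def phi_nonneg intro!: mult_right_mono)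
  thus "step_op \<theta> \<xi> f x \<le> K" using has_bochner_integral_phi[of \<xi>] by (simp add: has_bochner_integral_iff)
qed

lemma survival_measurable [measurable]: "survival \<theta> \<xi> n \<in> borel_measurable borel"
  by (induction n) auto

lemma survival_bounds:
  assumes "\<xi> \<in> {0..1}"
  shows "0 \<le> survival \<theta> \<xi> n x" "survival \<theta> \<xi> n x \<le> 1"
proof -
  have "\<forall>x. 0 \<le> survival \<theta> \<xi> n x \<and> survival \<theta> \<xi> n x \<le> 1"
    by (induction n) (auto intro!: step_op_bounds[OF assms])
  thus "0 \<le> survival \<theta> \<xi> n x" "survival \<theta> \<xi> n x \<le> 1" by auto
qed

lemma ennreal_step_op:
  assumes "\<xi> \<in> {0..1}" and [measurable]: "f \<in> borel_measurable borel" and "\<And>x. 0 \<le> f x" "\<And>x. f x \<le> K"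
  shows "ennreal (step_op \<theta> \<xi> f x) = (\<integral>\<^sup>+t. ennreal (f t * phi \<xi> t) * indicator {\<theta> * x<..} t \<partial>lborel)"
proof -
  have "(\<integral>\<^sup>+t. ennreal (indicator {\<theta> * x<..} t *\<^sub>R (f t * phi \<xi> t)) \<partial>lborel) = ennreal (step_op \<theta> \<xi> f x)"
    unfolding step_op_def set_lebesgue_integral_def
    using integrable_bounded_phi[of f K "{\<theta>*x<..}" \<xi>] assms
    by (intro nn_integral_eq_integral) (auto simp: phi_nonneg set_integrable_def)
  moreover have "ennreal (indicator {\<theta> * x<..} t *\<^sub>R (f t * phi \<xi> t)) = ennreal (f t * phi \<xi> t) * indicator {\<theta> * x<..} t" for t
    by (auto split: split_indicator)
  ultimately show ?thesis by simp
qed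

text \<open>Lets a bounded pointwise limit of lam^-n T^n 1 inherit the recursion T (T^n 1) = T^(n+1)
  1 and thus become an eigenfunction.\<close>

lemma step_op_tendsto:
  assumes "\<And>n. f n \<in> borel_measurable borel" "\<And>n x. \<bar>f n x\<bar> \<le> K" "\<And>x. (\<lambda>n. f n x) \<longlonglongrightarrow> g x"
    "g \<in> borel_measurable borel"
  shows "(\<lambda>n. step_op \<theta> \<xi> (f n) x) \<longlonglongrightarrow> step_op \<theta> \<xi> g x"
  unfolding step_op_def set_lebesgue_integral_def
proof (rule integral_dominated_convergence[where w = "\<lambda>t. K * \<bar>phi \<xi> t\<bar>"])
  have "0 \<le> K" using assms(2)[of 0 0] by linarith
  thus "AE x' in lborel. norm (indicat_real {\<theta> * x<..} x' *\<^sub>R (f i x' * phi \<xi> x')) \<le> K * \<bar>phi \<xi> x'\<bar>" for i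
    using assms(2) by (intro AE_I2) (auto simp: indicator_def abs_mult intro!: mult_right_mono)
  show "integrable lborel (\<lambda>t. K * \<bar>phi \<xi> t\<bar>)"
    by (intro integrable_mult_right integrable_abs integrable_phi)
  show "AE xa in lborel. (\<lambda>i. indicat_real {\<theta> * x<..} xa *\<^sub>R (f i xa * phi \<xi> xa)) \<longlonglongrightarrow> indicat_real {\<theta> * x<..} xa *\<^sub>R (g xa * phi \<xi> xa)"
    by (intro AE_I2 tendsto_intros assms)
qed (use assms in auto)

section \<open>The path law and its \<open>h\<close>-transform\<close>

text \<open>Indices are shifted by one against \<open>P_y\<close>: the starting point sits at index
  0. The variable X_0 is dropped, as no pair M_k with k \<ge> 1 involves it.\<close>

definition state_law :: "real \<Rightarrow> real \<Rightarrow> nat \<Rightarrow> real measure" where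
  "state_law \<xi> y i = (if i = 0 then return borel y else density lborel (\<lambda>x. ennreal (phi \<xi> x)))"

definition path_law :: "real \<Rightarrow> real \<Rightarrow> nat \<Rightarrow> (nat \<Rightarrow> real) measure" where
  "path_law \<xi> y n = PiM {0..<n} (state_law \<xi> y)"

lemma sets_state_law [simp, measurable_cong]: "sets (state_law \<xi> y i) = sets borel"
  by (simp add: state_law_def)

lemma space_state_law [simp]: "space (state_law \<xi> y i) = UNIV"
  by (simp add: state_law_def)

lemma prob_space_density_phi: "\<xi> \<in> {0..1} \<Longrightarrow> prob_space (density lborel (\<lambda>x. ennreal (phi \<xi> x)))"
  using has_bochner_integral_phi[of \<xi>]
  by (intro prob_spaceI)
     (simp add: emeasure_density nn_integral_eq_integral integrable_phi phi_nonneg has_bochner_integral_iff)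

lemma prob_space_state_law: "\<xi> \<in> {0..1} \<Longrightarrow> prob_space (state_law \<xi> y i)"
  by (auto simp: state_law_def prob_space_density_phi prob_space_return)

lemma sets_path_law [measurable_cong, simp]: "sets (path_law \<xi> y n) = sets (PiM {0..<n} (\<lambda>_. borel))"
  unfolding path_law_def by (intro sets_PiM_cong) auto

lemma space_path_law [simp]: "space (path_law \<xi> y n) = space (PiM {0..<n} (\<lambda>_. borel :: real measure))"
  by (rule sets_eq_imp_space_eq) simp

lemma prob_space_path_law: "\<xi> \<in> {0..1} \<Longrightarrow> prob_space (path_law \<xi> y n)"
  unfolding path_law_def by (intro prob_space_PiM prob_space_state_law)

lemma nn_integral_path_law_Suc:
  assumes \<xi>: "\<xi> \<in> {0..1}" and [measurable]: "g \<in> borel_measurable (PiM {0..<Suc n} (\<lambda>_. borel))"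
  shows "(\<integral>\<^sup>+x. g x \<partial>path_law \<xi> y (Suc n)) = (\<integral>\<^sup>+x. \<integral>\<^sup>+t. g (x(n := t)) \<partial>state_law \<xi> y n \<partial>path_law \<xi> y n)"
proof -
  interpret product_sigma_finite "state_law \<xi> y"
    by (intro product_sigma_finite.intro prob_space_imp_sigma_finite prob_space_state_law[OF \<xi>])
  have [measurable]: "g \<in> borel_measurable (PiM {0..<Suc n} (state_law \<xi> y))"
    using assms(2) by (simp add: measurable_cong_sets[OF sets_PiM_cong[of _ _ "state_law \<xi> y" "\<lambda>_. borel"]])
  have "{0..<Suc n} = insert n {0..<n}" by auto
  with product_nn_integral_insert[of "{0..<n}" n g] show ?thesis
    unfolding path_law_def by (simp del: insert_iff) (use \<open>g \<in> borel_measurable (PiM {0..<Suc n} (state_law \<xi> y))\<close> in simp)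
qed

text \<open>The last coordinate has positive index here, so it is governed by the density and never
  by the point mass.\<close>

lemma nn_integral_path_law_Suc_Suc:
  assumes \<xi>: "\<xi> \<in> {0..1}" and [measurable]: "g \<in> borel_measurable (PiM {0..<Suc (Suc n)} (\<lambda>_. borel))"
  shows "(\<integral>\<^sup>+x. g x \<partial>path_law \<xi> y (Suc (Suc n))) =
    (\<integral>\<^sup>+x. \<integral>\<^sup>+t. g (x(Suc n := t)) * ennreal (phi \<xi> t) \<partial>lborel \<partial>path_law \<xi> y (Suc n))"
  unfolding nn_integral_path_law_Suc[OF assms]
proof (intro nn_integral_cong)
  fix x assume "x \<in> space (path_law \<xi> y (Suc n))"
  hence "x \<in> space (PiM {0..<Suc n} (\<lambda>_. borel :: real measure))" by simp
  hence [measurable]: "(\<lambda>t. g (x(Suc n := t))) \<in> borel_measurable borel"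
    by (intro measurable_compose[OF measurable_fun_upd[where J = "{0..<Suc n}"] assms(2)]) auto
  show "(\<integral>\<^sup>+t. g (x(Suc n := t)) \<partial>state_law \<xi> y (Suc n)) = (\<integral>\<^sup>+t. g (x(Suc n := t)) * ennreal (phi \<xi> t) \<partial>lborel)"
    by (simp add: state_law_def nn_integral_density mult.commute)
qed

text \<open>In \<open>path_law\<close> and \<open>alive\<close> the coordinate \<open>x i\<close> stands for \<open>X\<^sub>i\<^sub>+\<^sub>1\<close>, so that \<open>x 0 = y\<close>.\<close>

definition alive :: "real \<Rightarrow> nat \<Rightarrow> (nat \<Rightarrow> real) \<Rightarrow> bool" where
  "alive \<theta> n x \<longleftrightarrow> (\<forall>i<n. \<theta> * x i < x (Suc i))"

lemma alive_measurable [measurable]: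
  assumes "n \<le> m" shows "Measurable.pred (PiM {0..<Suc m} (\<lambda>_. borel)) (alive \<theta> n)"
proof -
  have x: "(\<lambda>x. x i) \<in> borel_measurable (PiM {0..<Suc m} (\<lambda>_. borel :: real measure))" if "i \<le> m" for i
    using that by (intro measurable_component_singleton) auto
  have "Measurable.pred (PiM {0..<Suc m} (\<lambda>_. borel)) (\<lambda>x. \<theta> * x i < x (Suc i))" if "i \<in> {..<n}" for i
    using that assms by (intro borel_measurable_pred_less borel_measurable_times x borel_measurable_const) auto
  thus ?thesis unfolding alive_def Ball_def[symmetric] lessThan_iff[symmetric]
    by (intro pred_intros_finite) auto
qed

text \<open>The Markov property for the killed path. The induction on j varies m and g: the
  induction hypothesis is applied at time m + 1 to g seen as a function of one more coordinate, and
  integrating out that coordinate turns T^j 1 into T^(j+1) 1 evaluated at x m. The restriction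
  expresses that g only looks at the first m + 1 coordinates.\<close>

lemma nn_integral_survival:
  assumes \<xi>: "\<xi> \<in> {0..1}" and g[measurable]: "g \<in> borel_measurable (PiM {0..<Suc m} (\<lambda>_. borel))"
  shows "(\<integral>\<^sup>+x. g x * indicator {x. alive \<theta> m x} x * ennreal (survival \<theta> \<xi> j (x m)) \<partial>path_law \<xi> y (Suc m))
    = (\<integral>\<^sup>+x. g (restrict x {0..<Suc m}) * indicator {x. alive \<theta> (m + j) x} x \<partial>path_law \<xi> y (Suc (m + j)))"
  using g
proof (induction j arbitrary: m g)
  case (0 m g)
  have "restrict x {0..<Suc m} = x" if "x \<in> space (path_law \<xi> y (Suc m))" for x
    using that by (auto simp: space_PiM PiE_def extensional_restrict)
  thus ?case
    by (auto intro!: nn_integral_cong simp del: restrict_apply space_path_law)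
next
  case (Suc j m g)
  note [measurable] = Suc.prems
  let ?r = "\<lambda>x. restrict x {0..<Suc m}"
  have gr[measurable]: "(\<lambda>x. g (?r x)) \<in> borel_measurable (PiM {0..<Suc (Suc m)} (\<lambda>_. borel))"
    by (rule measurable_compose[OF measurable_restrict_subset Suc.prems]) auto
  have [measurable]: "(\<lambda>x. x (Suc m)) \<in> borel_measurable (PiM {0..<Suc (Suc m)} (\<lambda>_. borel :: real measure))"
    by (intro measurable_component_singleton) auto
  have rr: "g (?r (restrict x {0..<Suc (Suc m)})) = g (?r x)" for x
    by (auto intro!: ext arg_cong[of _ _ g])
  have "(\<integral>\<^sup>+x. g (?r x) * indicator {x. alive \<theta> (m + Suc j) x} x \<partial>path_law \<xi> y (Suc (m + Suc j)))
     = (\<integral>\<^sup>+x. g (?r x) * indicator {x. alive \<theta> (Suc m) x} x * ennreal (survival \<theta> \<xi> j (x (Suc m))) \<partial>path_law \<xi> y (Suc (Suc m)))"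
    using Suc.IH[OF gr] by (simp only: rr add_Suc add_Suc_right)
  also have "\<dots> = (\<integral>\<^sup>+x. \<integral>\<^sup>+t. g (?r (x(Suc m := t))) * indicator {x. alive \<theta> (Suc m) x} (x(Suc m := t))
        * ennreal (survival \<theta> \<xi> j t) * ennreal (phi \<xi> t) \<partial>lborel \<partial>path_law \<xi> y (Suc m))"
    by (subst nn_integral_path_law_Suc_Suc[OF \<xi>]) simp_all
  also have "\<dots> = (\<integral>\<^sup>+x. \<integral>\<^sup>+t. (g x * indicator {x. alive \<theta> m x} x) *
        (ennreal (survival \<theta> \<xi> j t * phi \<xi> t) * indicator {\<theta> * x m<..} t) \<partial>lborel \<partial>path_law \<xi> y (Suc m))"
  proof (intro nn_integral_cong)
    fix x t assume x: "x \<in> space (path_law \<xi> y (Suc m))"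
    have "?r (x(Suc m := t)) = x" using x by (auto simp: space_PiM PiE_def extensional_def)
    moreover have "alive \<theta> (Suc m) (x(Suc m := t)) \<longleftrightarrow> alive \<theta> m x \<and> t > \<theta> * x m"
      by (auto simp: alive_def less_Suc_eq)
    ultimately show "g (?r (x(Suc m := t))) * indicator {x. alive \<theta> (Suc m) x} (x(Suc m := t))
        * ennreal (survival \<theta> \<xi> j t) * ennreal (phi \<xi> t) = (g x * indicator {x. alive \<theta> m x} x) *
        (ennreal (survival \<theta> \<xi> j t * phi \<xi> t) * indicator {\<theta> * x m<..} t)"
      using survival_bounds[OF \<xi>] phi_nonneg[OF \<xi>]
      by (auto simp: ennreal_mult mult_ac split: split_indicator)
  qed
  also have "\<dots> = (\<integral>\<^sup>+x. g x * indicator {x. alive \<theta> m x} x * ennreal (survival \<theta> \<xi> (Suc j) (x m)) \<partial>path_law \<xi> y (Suc m))"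
    using survival_bounds[OF \<xi>]
    by (subst nn_integral_cmult) (auto simp: ennreal_step_op[OF \<xi>, where K = 1])
  finally show ?case by (rule sym)
qed

text \<open>Dropping X_0 and shifting is a reindexing along the injection \<open>Suc\<close>, under
  which a product measure remains a product measure.\<close>

lemma distr_P_y:
  assumes \<xi>: "\<xi> \<in> {0..1}"
  shows "distr (P_y \<xi> y) (PiM {0..<n} (\<lambda>_. borel)) (\<lambda>\<omega>. \<lambda>k\<in>{0..<n}. \<omega> (Suc k)) = path_law \<xi> y n"
proof -
  let ?D = "\<lambda>i :: nat. if i = 1 then return borel y else density lborel (\<lambda>x. ennreal (phi \<xi> x))"
  have "distr (Pi\<^sub>M UNIV ?D) (\<Pi>\<^sub>M i\<in>{0..<n}. ?D (Suc i)) (\<lambda>\<omega>. \<lambda>k\<in>{0..<n}. \<omega> (Suc k)) = (\<Pi>\<^sub>M i\<in>{0..<n}. ?D (Suc i))"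
    by (rule distr_PiM_reindex) (auto simp: prob_space_return prob_space_density_phi[OF \<xi>])
  moreover have "(\<Pi>\<^sub>M i\<in>{0..<n}. ?D (Suc i)) = path_law \<xi> y n"
    unfolding path_law_def by (intro PiM_cong) (auto simp: state_law_def)
  ultimately show ?thesis unfolding P_y_def
    by (metis (no_types, lifting) distr_cong sets_path_law)
qed

text \<open>The interface between the analysis of the operator and the probabilistic conclusion. The
  constant c stays unspecified because it cancels in conditional probabilities. The uniform bound
  \<open>survival_le\<close> is the dominating function for the limit under the integral.
  \<open>h_outside\<close> leaves the value at 0 open: this point is not in the negative half line,
  but it is a null set.\<close>

locale ground_state =
  fixes \<theta> \<xi> lam c K K' :: real and \<Omega> :: "real set" and h :: "real \<Rightarrow> real"
  assumes \<xi>: "\<xi> \<in> {0..1}"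
    and \<Omega> [measurable]: "\<Omega> \<in> sets borel"
    and lam: "lam > 0"
    and h_measurable [measurable]: "h \<in> borel_measurable borel"
    and h_nonneg: "h x \<ge> 0" and h_le: "h x \<le> K"
    and h_pos: "x \<in> \<Omega> \<Longrightarrow> h x > 0"
    and h_outside: "x \<notin> \<Omega> \<Longrightarrow> x \<noteq> 0 \<Longrightarrow> h x = 0"
    and eigen: "lam * h x = step_op \<theta> \<xi> h x"
    and c: "c > 0"
    and survival_asymp: "(\<lambda>n. survival \<theta> \<xi> n x / lam ^ n) \<longlonglongrightarrow> c * h x"
    and survival_le: "survival \<theta> \<xi> n x \<le> K' * lam ^ n"
begin

abbreviation E :: "real measure" where "E \<equiv> restrict_space borel \<Omega>"
abbreviation ker :: "real \<Rightarrow> real measure" where "ker \<equiv> kernel' \<theta> \<xi> \<Omega> lam h"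

lemma space_E [simp]: "space E = \<Omega>" by (simp add: space_restrict_space)

lemma sets_ker [measurable_cong, simp]: "sets (ker x) = sets E"
  by (simp add: kernel'_def sets_restrict_space)

lemma space_ker [simp]: "space (ker x) = \<Omega>"
  using sets_eq_imp_space_eq[OF sets_ker] by simp

lemma sets_E_borel: "A \<in> sets E \<Longrightarrow> A \<in> sets borel"
  by (auto simp: sets_restrict_space)

text \<open>If \<open>h x = 0\<close>, both sides vanish because \<open>1 / 0 = 0\<close>.\<close>

lemma nn_integral_ker:
  assumes [measurable]: "f \<in> borel_measurable borel"
  shows "(\<integral>\<^sup>+t. f t \<partial>ker x) =
    (\<integral>\<^sup>+t. f t * indicator {\<theta> * x<..} t * ennreal (h t * phi \<xi> t) * ennreal (1 / (lam * h x)) \<partial>lborel)"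
proof -
  have f: "f \<in> borel_measurable (restrict_space lborel \<Omega>)"
    using measurable_restrict_space1[of f lborel borel \<Omega>] by simp
  have d: "(\<lambda>x2. ennreal (indicator {\<theta> * x<..} x2 * (h x2 / h x) * (1 / lam) * phi \<xi> x2)) \<in> borel_measurable (restrict_space lborel \<Omega>)"
    by (rule measurable_restrict_space1) measurable
  have "(\<integral>\<^sup>+t. f t \<partial>ker x) = (\<integral>\<^sup>+t. ennreal (indicator {\<theta> * x<..} t * (h t / h x) * (1 / lam) * phi \<xi> t) * f t * indicator \<Omega> t \<partial>lborel)"
    unfolding kernel'_def nn_integral_density[OF d f] by (rule nn_integral_restrict_space) simp
  also have "\<dots> = (\<integral>\<^sup>+t. f t * indicator {\<theta> * x<..} t * ennreal (h t * phi \<xi> t) * ennreal (1 / (lam * h x)) \<partial>lborel)"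
  proof (rule nn_integral_cong_AE)
    show "AE t in lborel. ennreal (indicator {\<theta> * x<..} t * (h t / h x) * (1 / lam) * phi \<xi> t) * f t * indicator \<Omega> t =
      f t * indicator {\<theta> * x<..} t * ennreal (h t * phi \<xi> t) * ennreal (1 / (lam * h x))"
      using AE_lborel_singleton[of 0]
    proof eventually_elim
      case (elim t)
      have "ennreal (indicator {\<theta> * x<..} t * (h t / h x) * (1 / lam) * phi \<xi> t)
        = indicator {\<theta> * x<..} t * (ennreal (h t * phi \<xi> t) * ennreal (1 / (lam * h x)))"
        using lam by (subst ennreal_mult[symmetric])
          (auto simp: phi_nonneg[OF \<xi>] h_nonneg indicator_def intro!: arg_cong[of _ _ ennreal])
      thus ?case using elim h_outside[of t] by (auto simp: mult_ac split: split_indicator)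
    qed
  qed
  finally show ?thesis .
qed

lemma nn_integral_h:
  "(\<integral>\<^sup>+t. indicator {\<theta> * x<..} t * ennreal (h t * phi \<xi> t) \<partial>lborel) = ennreal (lam * h x)"
  unfolding eigen using ennreal_step_op[OF \<xi> h_measurable h_nonneg h_le] by (simp add: mult.commute)

lemma prob_space_ker:
  assumes "x \<in> \<Omega>" shows "prob_space (ker x)"
proof (rule prob_spaceI)
  have "emeasure (ker x) (space (ker x)) = (\<integral>\<^sup>+t. 1 \<partial>ker x)" by simp
  also have "\<dots> = ennreal (lam * h x) * ennreal (1 / (lam * h x))"
    by (subst nn_integral_ker) (auto simp: nn_integral_multc nn_integral_h)
  also have "\<dots> = 1"
    using h_pos[OF assms] lam by (subst ennreal_mult[symmetric]) auto
  finally show "emeasure (ker x) (space (ker x)) = 1" .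
qed

lemma ker_measurable_subprob [measurable]: "ker \<in> E \<rightarrow>\<^sub>M subprob_algebra E"
proof (rule measurable_subprob_algebra)
  fix A assume A: "A \<in> sets E"
  hence [measurable]: "A \<in> sets borel" by (rule sets_E_borel)
  have "emeasure (ker a) A = (\<integral>\<^sup>+t. indicator A t * (if \<theta> * a < t then 1 else 0) * ennreal (h t * phi \<xi> t) * ennreal (1 / (lam * h a)) \<partial>lborel)" for a
  proof -
    have "emeasure (ker a) A = (\<integral>\<^sup>+t. indicator A t \<partial>ker a)" using A by simp
    also have "\<dots> = (\<integral>\<^sup>+t. indicator A t * indicator {\<theta> * a<..} t * ennreal (h t * phi \<xi> t) * ennreal (1 / (lam * h a)) \<partial>lborel)"
      by (rule nn_integral_ker) measurable
    also have "\<dots> = (\<integral>\<^sup>+t. indicator A t * (if \<theta> * a < t then 1 else 0) * ennreal (h t * phi \<xi> t) * ennreal (1 / (lam * h a)) \<partial>lborel)"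
      by (intro nn_integral_cong) (auto split: split_indicator)
    finally show ?thesis .
  qed
  moreover have "(\<lambda>a. \<integral>\<^sup>+t. indicator A t * (if \<theta> * a < t then 1 else 0) * ennreal (h t * phi \<xi> t) * ennreal (1 / (lam * h a)) \<partial>lborel) \<in> borel_measurable borel"
    by measurable
  ultimately have "(\<lambda>a. emeasure (ker a) A) \<in> borel_measurable borel" by simp
  thus "(\<lambda>a. emeasure (ker a) A) \<in> borel_measurable E" by (rule measurable_restrict_space1)
qed (auto intro!: prob_space_imp_subprob_space prob_space_ker)

lemma ker_measurable: "ker \<in> E \<rightarrow>\<^sub>M prob_algebra E"
  by (intro measurable_prob_algebraI) (auto intro: prob_space_ker)

end

section \<open>Construction of the transformed chain and its finite-dimensional laws\<close>

locale ground_state_at = ground_state +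
  fixes y :: real
  assumes y: "y \<in> \<Omega>"
begin

text \<open>The initial law is the zeroth kernel, so the Ionescu-Tulcea construction starts from the
  empty history and coordinate i is the state at time i.\<close>

definition step_kernel :: "nat \<Rightarrow> (nat \<Rightarrow> real) \<Rightarrow> real measure" where
  "step_kernel i \<omega> = (if i = 0 then return E y else ker (\<omega> (i - 1)))"

sublocale IT: Ionescu_Tulcea step_kernel "\<lambda>_. E"
proof (rule Ionescu_Tulcea.intro)
  fix i
  show "step_kernel i \<in> PiM {0..<i} (\<lambda>_. E) \<rightarrow>\<^sub>M subprob_algebra E"
  proof (cases i)
    case 0
    have "step_kernel 0 = (\<lambda>_. return E y)" by (auto simp: step_kernel_def)
    thus ?thesis using 0 y by (auto intro!: measurable_const simp: space_subprob_algebra intro: prob_space_imp_subprob_space prob_space_return)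
  next
    case (Suc n)
    have "step_kernel i = (\<lambda>\<omega>. ker (\<omega> n))" by (auto simp: step_kernel_def Suc)
    moreover have "(\<lambda>\<omega>. ker (\<omega> n)) \<in> PiM {0..<i} (\<lambda>_. E) \<rightarrow>\<^sub>M subprob_algebra E"
      using measurable_component_singleton[of n "{0..<i}" "\<lambda>_. E"]
      by (intro measurable_compose[OF _ ker_measurable_subprob]) (simp add: Suc)
    ultimately show ?thesis by simp
  qed
  fix x assume "x \<in> space (PiM {0..<i} (\<lambda>_. E))"
  thus "prob_space (step_kernel i x)"
    using y by (cases i) (auto simp: step_kernel_def space_PiM PiE_def intro!: prob_space_return prob_space_ker)
qed

text \<open>The history of length 0 is the only point of the empty product, which is the function
  that is \<open>undefined\<close> everywhere.\<close>

definition marginal_law :: "nat \<Rightarrow> (nat \<Rightarrow> real) measure" where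
  "marginal_law n = IT.C 0 n (\<lambda>_. undefined)"

lemma sets_marginal_law [measurable_cong, simp]: "sets (marginal_law n) = sets (PiM {0..<n} (\<lambda>_. E))"
  unfolding marginal_law_def by (subst IT.sets_C) auto

lemma space_marginal_law [simp]: "space (marginal_law n) = space (PiM {0..<n} (\<lambda>_. E))"
  by (rule sets_eq_imp_space_eq) simp

lemma prob_space_marginal_law: "prob_space (marginal_law n)"
  unfolding marginal_law_def by (rule IT.prob_space_C) simp

text \<open>Allows one and the same integrand on real paths to be integrated against the law of the
  chain, whose paths live in \<Omega>, and against \<open>path_law\<close>.\<close>

lemma id_measurable_E: "(\<lambda>x. x) \<in> PiM I (\<lambda>_. E) \<rightarrow>\<^sub>M PiM I (\<lambda>_. borel)"
proof -
  have "(\<lambda>x. \<lambda>i\<in>I. x i) \<in> PiM I (\<lambda>_. E) \<rightarrow>\<^sub>M PiM I (\<lambda>_. borel)"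
  proof (rule measurable_restrict)
    fix i assume "i \<in> I"
    from measurable_component_singleton[OF this, of "\<lambda>_. E"]
    show "(\<lambda>x. x i) \<in> borel_measurable (PiM I (\<lambda>_. E))"
      by (rule measurable_compose) (simp add: measurable_restrict_space1)
  qed
  moreover have "(\<lambda>i\<in>I. x i) = x" if "x \<in> space (PiM I (\<lambda>_. E))" for x
    using that by (simp add: space_PiM PiE_def extensional_restrict)
  ultimately show ?thesis
    using measurable_cong[of "PiM I (\<lambda>_. E)" "\<lambda>x. \<lambda>i\<in>I. x i" "\<lambda>x. x"] by blast
qed

lemma nn_integral_marginal_law_Suc_Suc:
  assumes [measurable]: "g \<in> borel_measurable (PiM {0..<Suc (Suc n)} (\<lambda>_. E))"
  shows "(\<integral>\<^sup>+x. g x \<partial>marginal_law (Suc (Suc n))) = (\<integral>\<^sup>+x. \<integral>\<^sup>+t. g (x(Suc n := t)) \<partial>ker (x n) \<partial>marginal_law (Suc n))"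
proof -
  have C: "marginal_law (Suc (Suc n)) = marginal_law (Suc n) \<bind> IT.eP (0 + Suc n)"
    by (simp only: marginal_law_def IT.C.simps(2))
  have "(\<integral>\<^sup>+x. g x \<partial>marginal_law (Suc (Suc n))) = (\<integral>\<^sup>+x. \<integral>\<^sup>+z. g z \<partial>IT.eP (0 + Suc n) x \<partial>marginal_law (Suc n))"
    unfolding C using IT.measurable_eP[of "Suc n"]
    by (intro nn_integral_bind[OF assms]) (simp add: measurable_cong_sets[OF sets_marginal_law refl])
  also have "\<dots> = (\<integral>\<^sup>+x. \<integral>\<^sup>+t. g (x(Suc n := t)) \<partial>ker (x n) \<partial>marginal_law (Suc n))"
    by (intro nn_integral_cong) (simp add: IT.nn_integral_eP step_kernel_def)
  finally show ?thesis .
qed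

lemma fin_integrand_measurable:
  assumes "g \<in> borel_measurable (PiM {0..<Suc n} (\<lambda>_. borel))"
  shows "(\<lambda>x. g x * indicator {x. alive \<theta> n x} x * ennreal (h (x n) / (lam ^ n * h y)))
    \<in> borel_measurable (PiM {0..<Suc n} (\<lambda>_. borel))"
proof (intro borel_measurable_times_ennreal assms)
  show "indicator {x. alive \<theta> n x} \<in> borel_measurable (PiM {0..<Suc n} (\<lambda>_. borel))"
    using alive_measurable[OF order.refl] by measurable
  have "(\<lambda>x. ennreal (h x / (lam ^ n * h y))) \<in> borel_measurable borel" by measurable
  thus "(\<lambda>x. ennreal (h (x n) / (lam ^ n * h y))) \<in> borel_measurable (PiM {0..<Suc n} (\<lambda>_. borel))"
    by (rule measurable_compose[OF measurable_component_singleton[of n _ "\<lambda>_. borel"], rotated]) simp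
qed

text \<open>The h-transform: the factors h(x (k + 1)) / (lam h(x k)) of the kernels telescope to h(x
  n) / (lam^n h y), and the restrictions on the single steps combine to
  \<open>alive\<close>.\<close>

lemma nn_integral_marginal_law:
  fixes g :: "(nat \<Rightarrow> real) \<Rightarrow> ennreal"
  assumes g[measurable]: "g \<in> borel_measurable (PiM {0..<Suc n} (\<lambda>_. borel))"
  shows "(\<integral>\<^sup>+x. g x \<partial>marginal_law (Suc n)) =
    (\<integral>\<^sup>+x. g x * indicator {x. alive \<theta> n x} x * ennreal (h (x n) / (lam ^ n * h y)) \<partial>path_law \<xi> y (Suc n))"
proof -
  have ind: "indicator {a<..} \<in> borel_measurable lborel" for a :: real by measurable
  have hphi: "(\<lambda>t. ennreal (h t * phi \<xi> t)) \<in> borel_measurable lborel" by measurable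
  \<comment> \<open>The kernel density as a function on the plane, so that the inner integral G is
    seen to be measurable in the path.\<close>
  define F where "F = (\<lambda>(a, t). (if \<theta> * a < t then 1 else 0) * ennreal (h t * phi \<xi> t) * ennreal (1 / (lam * h a)))"
  have F: "F \<in> borel_measurable (borel \<Otimes>\<^sub>M borel)" unfolding F_def by measurable
  show ?thesis using g
  proof (induction n arbitrary: g)
    case (0 g)
    let ?u = "\<lambda>_ :: nat. undefined :: real"
    have g0: "g \<in> borel_measurable (PiM {0..<Suc 0} (\<lambda>_. E))"
      by (rule measurable_compose[OF id_measurable_E 0])
    have gu: "(\<lambda>x. g (?u(0 := x))) \<in> borel_measurable borel"
      by (intro measurable_compose[OF measurable_fun_upd[where J = "{}"] 0]) (auto simp: space_PiM)
    have "(\<integral>\<^sup>+x. g x \<partial>marginal_law (Suc 0)) = (\<integral>\<^sup>+x. \<integral>\<^sup>+z. g z \<partial>IT.eP (0 + 0) x \<partial>IT.C 0 0 ?u)"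
      unfolding marginal_law_def IT.C.simps(2)[of 0 0]
      using IT.measurable_eP[of 0] IT.sets_C[of ?u 0 0]
      by (intro nn_integral_bind[OF g0]) (simp add: measurable_cong_sets[OF IT.sets_C refl] del: IT.C.simps)
    also have "\<dots> = (\<integral>\<^sup>+z. g z \<partial>IT.eP 0 ?u)"
      unfolding IT.C.simps(1) add_0
    proof (rule nn_integral_return)
      show "(\<lambda>x. integral\<^sup>N (IT.eP 0 x) g) \<in> borel_measurable (PiM {0..<0} (\<lambda>_. E))"
        using measurable_compose[OF IT.measurable_eP[of 0] nn_integral_measurable_subprob_algebra[OF g0]] .
    qed (simp add: space_PiM)
    also have "\<dots> = (\<integral>\<^sup>+x. g (?u(0 := x)) \<partial>return E y)"
      using IT.nn_integral_eP[OF _ g0, of ?u] by (simp add: step_kernel_def space_PiM)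
    also have "\<dots> = g (?u(0 := y))"
      using y gu by (intro nn_integral_return) (auto intro!: measurable_restrict_space1)
    finally have 1: "(\<integral>\<^sup>+x. g x \<partial>marginal_law (Suc 0)) = g (?u(0 := y))" .
    note gh = fin_integrand_measurable[OF 0]
    have "(\<integral>\<^sup>+x. g x * indicator {x. alive \<theta> 0 x} x * ennreal (h (x 0) / (lam ^ 0 * h y)) \<partial>path_law \<xi> y (Suc 0))
      = (\<integral>\<^sup>+x. (\<integral>\<^sup>+t. g (x(0 := t)) * ennreal (h t / h y) \<partial>return borel y) \<partial>path_law \<xi> y 0)"
      by (subst nn_integral_path_law_Suc[OF \<xi> gh]) (simp add: alive_def state_law_def)
    also have "path_law \<xi> y 0 = count_space {?u}"
      by (simp add: path_law_def PiM_empty)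
    also have "(\<integral>\<^sup>+x. (\<integral>\<^sup>+t. g (x(0 := t)) * ennreal (h t / h y) \<partial>return borel y) \<partial>count_space {?u}) = g (?u(0 := y))"
      using h_pos[OF y] gu by (simp add: nn_integral_count_space_finite nn_integral_return fun_upd_def)
    finally show ?case using 1 by simp
  next
    case (Suc n g)
    have "g \<in> borel_measurable (PiM {0..<Suc (Suc n)} (\<lambda>_. E))"
      by (rule measurable_compose[OF id_measurable_E Suc.prems])
    have upd: "(\<lambda>(x, t). x(Suc n := t)) \<in> PiM {0..<Suc n} (\<lambda>_. borel :: real measure) \<Otimes>\<^sub>M borel \<rightarrow>\<^sub>M PiM {0..<Suc (Suc n)} (\<lambda>_. borel)"
      unfolding split_beta' by (rule measurable_fun_upd[where J = "{0..<Suc n}"]) auto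
    define G where "G x = (\<integral>\<^sup>+t. g (x(Suc n := t)) * indicator {\<theta> * x n<..} t * ennreal (h t * phi \<xi> t) * ennreal (1 / (lam * h (x n))) \<partial>lborel)" for x :: "nat \<Rightarrow> real"
    have gx: "(\<lambda>t. g (x(Suc n := t))) \<in> borel_measurable borel" if "x \<in> space (PiM {0..<Suc n} (\<lambda>_. borel))" for x :: "nat \<Rightarrow> real"
      using that by (intro measurable_compose[OF measurable_fun_upd[where J = "{0..<Suc n}"] Suc.prems]) auto
    let ?B = "PiM {0..<Suc n} (\<lambda>_. borel :: real measure)"
    have gu: "(\<lambda>(x, t). g (x(Suc n := t))) \<in> borel_measurable (?B \<Otimes>\<^sub>M borel)"
      using measurable_compose[OF upd Suc.prems] by (simp add: split_beta' fun_upd_def)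
    have xn: "(\<lambda>p. fst p n) \<in> borel_measurable (?B \<Otimes>\<^sub>M borel)"
      by (rule measurable_compose[OF measurable_fst]) (intro measurable_component_singleton, simp)
    have pr: "(\<lambda>p. (fst p n, snd p)) \<in> ?B \<Otimes>\<^sub>M borel \<rightarrow>\<^sub>M borel \<Otimes>\<^sub>M borel"
      by (intro measurable_Pair xn measurable_snd)
    have "(\<lambda>p. (case p of (x, t) \<Rightarrow> g (x(Suc n := t))) * F (fst p n, snd p)) \<in> borel_measurable (?B \<Otimes>\<^sub>M borel)"
      by (intro borel_measurable_times_ennreal gu measurable_compose[OF pr F])
    also have "(\<lambda>p. (case p of (x, t) \<Rightarrow> g (x(Suc n := t))) * F (fst p n, snd p)) =
      (\<lambda>(x, t). g (x(Suc n := t)) * indicator {\<theta> * x n<..} t * ennreal (h t * phi \<xi> t) * ennreal (1 / (lam * h (x n))))"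
      by (auto simp: fun_eq_iff F_def mult_ac split: split_indicator)
    finally have "(\<lambda>(x, t). g (x(Suc n := t)) * indicator {\<theta> * x n<..} t * ennreal (h t * phi \<xi> t) * ennreal (1 / (lam * h (x n)))) \<in> borel_measurable (?B \<Otimes>\<^sub>M lborel)"
      unfolding measurable_cong_sets[OF sets_pair_measure_cong[OF refl sets_lborel] refl] .
    hence G: "G \<in> borel_measurable ?B"
      unfolding G_def by (rule lborel.borel_measurable_nn_integral)
    have "(\<integral>\<^sup>+x. g x \<partial>marginal_law (Suc (Suc n))) = (\<integral>\<^sup>+x. G x \<partial>marginal_law (Suc n))"
      unfolding nn_integral_marginal_law_Suc_Suc[OF \<open>g \<in> borel_measurable (PiM {0..<Suc (Suc n)} (\<lambda>_. E))\<close>] G_def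
    proof (intro nn_integral_cong nn_integral_ker gx)
      fix x assume "x \<in> space (marginal_law (Suc n))"
      thus "x \<in> space (PiM {0..<Suc n} (\<lambda>_. borel))" by (auto simp: space_PiM PiE_def)
    qed
    also have "\<dots> = (\<integral>\<^sup>+x. G x * indicator {x. alive \<theta> n x} x * ennreal (h (x n) / (lam ^ n * h y)) \<partial>path_law \<xi> y (Suc n))"
      by (rule Suc.IH) fact
    also have "\<dots> = (\<integral>\<^sup>+x. \<integral>\<^sup>+t. g (x(Suc n := t)) * indicator {x. alive \<theta> (Suc n) x} (x(Suc n := t))
         * ennreal (h ((x(Suc n := t)) (Suc n)) / (lam ^ Suc n * h y)) * ennreal (phi \<xi> t) \<partial>lborel \<partial>path_law \<xi> y (Suc n))"
    proof (intro nn_integral_cong)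
      fix x assume "x \<in> space (path_law \<xi> y (Suc n))"
      hence x: "x \<in> space (PiM {0..<Suc n} (\<lambda>_. borel :: real measure))" by simp
      have gx': "(\<lambda>t. g (x(Suc n := t))) \<in> borel_measurable lborel" using gx[OF x] by simp
      have al: "alive \<theta> (Suc n) (x(Suc n := t)) \<longleftrightarrow> alive \<theta> n x \<and> t > \<theta> * x n" for t
        by (auto simp: alive_def less_Suc_eq)
      have "G x * indicator {x. alive \<theta> n x} x * ennreal (h (x n) / (lam ^ n * h y))
        = (\<integral>\<^sup>+t. g (x(Suc n := t)) * indicator {\<theta> * x n<..} t * ennreal (h t * phi \<xi> t) * ennreal (1 / (lam * h (x n))) * 
            (indicator {x. alive \<theta> n x} x * ennreal (h (x n) / (lam ^ n * h y))) \<partial>lborel)"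
        unfolding G_def mult.assoc[of "integral\<^sup>N _ _"] by (intro nn_integral_multc[symmetric] borel_measurable_times_ennreal gx' ind hphi borel_measurable_const)
      also have "\<dots> = (\<integral>\<^sup>+t. g (x(Suc n := t)) * indicator {x. alive \<theta> (Suc n) x} (x(Suc n := t))
         * ennreal (h ((x(Suc n := t)) (Suc n)) / (lam ^ Suc n * h y)) * ennreal (phi \<xi> t) \<partial>lborel)"
      proof (cases "h (x n) = 0")
        case False
        have "ennreal (h t * phi \<xi> t) * ennreal (1 / (lam * h (x n))) * ennreal (h (x n) / (lam ^ n * h y))
           = ennreal (h t / (lam ^ Suc n * h y)) * ennreal (phi \<xi> t)" for t
          using lam h_nonneg phi_nonneg[OF \<xi>, of t] False
          by (simp add: ennreal_mult'[symmetric])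
        thus ?thesis
          by (intro nn_integral_cong) (auto simp: al mult_ac split: split_indicator)
      next
        \<comment> \<open>Nothing telescopes here. The left side carries the factor h (x n) = 0; on
          the right, the eigenvalue equation at x n says that h \<open>phi\<close> vanishes almost
          everywhere beyond \<theta> (x n), so the integrand is null as well.\<close>
        case True
        have "(\<integral>\<^sup>+t. indicator {\<theta> * x n<..} t * ennreal (h t * phi \<xi> t) \<partial>lborel) = 0"
          using nn_integral_h[of "x n"] True by simp
        hence ae: "AE t in lborel. indicator {\<theta> * x n<..} t * ennreal (h t * phi \<xi> t) = 0"
          by (subst (asm) nn_integral_0_iff_AE) auto
        have "(\<integral>\<^sup>+t. g (x(Suc n := t)) * indicator {x. alive \<theta> (Suc n) x} (x(Suc n := t))
         * ennreal (h ((x(Suc n := t)) (Suc n)) / (lam ^ Suc n * h y)) * ennreal (phi \<xi> t) \<partial>lborel) = (\<integral>\<^sup>+t. 0 \<partial>(lborel :: real measure))"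
        proof (rule nn_integral_cong_AE, rule eventually_mono[OF ae])
          fix t assume elim: "indicator {\<theta> * x n<..} t * ennreal (h t * phi \<xi> t) = 0"
          show "g (x(Suc n := t)) * indicator {x. alive \<theta> (Suc n) x} (x(Suc n := t))
            * ennreal (h ((x(Suc n := t)) (Suc n)) / (lam ^ Suc n * h y)) * ennreal (phi \<xi> t) = 0"
          proof (cases "\<theta> * x n < t")
            case True
            with elim have "h t * phi \<xi> t \<le> 0" by (simp add: ennreal_eq_0_iff)
            hence "h t = 0 \<or> phi \<xi> t = 0"
              using h_nonneg[of t] phi_nonneg[OF \<xi>, of t] by (auto simp: mult_le_0_iff)
            thus ?thesis by auto
          qed (simp add: al)
        qed
        thus ?thesis using True by simp
      qed
      finally show "G x * indicator {x. alive \<theta> n x} x * ennreal (h (x n) / (lam ^ n * h y)) = \<dots>" .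
    qed
    also have "\<dots> = (\<integral>\<^sup>+x. g x * indicator {x. alive \<theta> (Suc n) x} x * ennreal (h (x (Suc n)) / (lam ^ Suc n * h y)) \<partial>path_law \<xi> y (Suc (Suc n)))"
      by (rule nn_integral_path_law_Suc_Suc[OF \<xi> fin_integrand_measurable[OF Suc.prems], symmetric])
    finally show ?case .
  qed
qed

end

section \<open>Conditioning on survival\<close>

text \<open>In the shifted coordinates component k is M_k, as x k stands for X_(k+1) and x (k - 1)
  for X_k.\<close>

definition pairs :: "nat \<Rightarrow> (nat \<Rightarrow> real) \<Rightarrow> nat \<Rightarrow> real \<times> real" where
  "pairs m x = (\<lambda>k\<in>{1..m}. (x k, x (k - 1)))"

lemma pairs_measurable [measurable]:
  "m \<le> n \<Longrightarrow> pairs m \<in> PiM {0..<Suc n} (\<lambda>_. borel) \<rightarrow>\<^sub>M PiM {1..m} (\<lambda>_. borel)"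
  unfolding pairs_def
  by (intro measurable_restrict borel_measurable_Pair measurable_component_singleton) auto

lemma pairs_restrict: "m \<le> n \<Longrightarrow> pairs m (restrict x {0..<Suc n}) = pairs m x"
  by (rule ext) (auto simp: pairs_def)

lemma survives_alive: "survives \<theta> n \<omega> \<longleftrightarrow> alive \<theta> n (\<lambda>k. \<omega> (Suc k))"
proof -
  have "{1..n} = Suc ` {..<n}" by (simp add: image_Suc_lessThan)
  thus ?thesis by (auto simp: survives_def alive_def M_chain_def S_set_def)
qed

lemma alive_cong: "(\<And>i. i \<le> n \<Longrightarrow> x i = x' i) \<Longrightarrow> alive \<theta> n x = alive \<theta> n x'"
  by (auto simp: alive_def)

text \<open>The event depends on finitely many coordinates and can be computed under
  \<open>path_law\<close>; the j steps after time m are then integrated out into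
  \<open>survival\<close>.\<close>

lemma emeasure_P_y:
  assumes \<xi>: "\<xi> \<in> {0..1}" and [measurable]: "B \<in> sets (PiM {1..m} (\<lambda>_. borel))"
  shows "emeasure (P_y \<xi> y) {\<omega>\<in>space (P_y \<xi> y). (\<lambda>k\<in>{1..m}. M_chain k \<omega>) \<in> B \<and> survives \<theta> (m + j) \<omega>} =
    (\<integral>\<^sup>+x. indicator B (pairs m x) * indicator {x. alive \<theta> m x} x * ennreal (survival \<theta> \<xi> j (x m)) \<partial>path_law \<xi> y (Suc m))"
proof -
  let ?s = "\<lambda>\<omega>. \<lambda>k\<in>{0..<Suc (m + j)}. \<omega> (Suc k) :: real"
  let ?X = "PiM {0..<Suc (m + j)} (\<lambda>_. borel :: real measure)"
  define S where "S = {x \<in> space ?X. pairs m x \<in> B \<and> alive \<theta> (m + j) x}"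
  have [measurable]: "pairs m \<in> ?X \<rightarrow>\<^sub>M PiM {1..m} (\<lambda>_. borel)" "Measurable.pred ?X (alive \<theta> (m + j))"
    by (rule pairs_measurable alive_measurable; simp)+
  have [measurable]: "S \<in> sets ?X" unfolding S_def by measurable
  have s: "?s \<in> P_y \<xi> y \<rightarrow>\<^sub>M ?X"
  proof (rule measurable_restrict)
    fix i
    have "(\<lambda>\<omega>. \<omega> (Suc i)) \<in> P_y \<xi> y \<rightarrow>\<^sub>M (if Suc i = 1 then return borel y else density lborel (\<lambda>x. ennreal (phi \<xi> x)))"
      unfolding P_y_def by (rule measurable_component_singleton) simp
    thus "(\<lambda>\<omega>. \<omega> (Suc i)) \<in> borel_measurable (P_y \<xi> y)"
      by (rule measurable_cong_sets[OF refl, THEN equalityD1, THEN subsetD, rotated]) simp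
  qed
  have pa: "pairs m (?s \<omega>) = (\<lambda>k\<in>{1..m}. M_chain k \<omega>)" for \<omega>
    by (auto simp: pairs_def M_chain_def restrict_def fun_eq_iff)
  have al: "alive \<theta> (m + j) (?s \<omega>) = survives \<theta> (m + j) \<omega>" for \<omega>
    unfolding survives_alive by (rule alive_cong) auto
  have "{\<omega>\<in>space (P_y \<xi> y). (\<lambda>k\<in>{1..m}. M_chain k \<omega>) \<in> B \<and> survives \<theta> (m + j) \<omega>} = ?s -` S \<inter> space (P_y \<xi> y)"
    using measurable_space[OF s] by (auto simp: S_def pa al)
  hence "emeasure (P_y \<xi> y) {\<omega>\<in>space (P_y \<xi> y). (\<lambda>k\<in>{1..m}. M_chain k \<omega>) \<in> B \<and> survives \<theta> (m + j) \<omega>}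
     = emeasure (distr (P_y \<xi> y) ?X ?s) S"
    by (simp add: emeasure_distr[OF s])
  also have "\<dots> = (\<integral>\<^sup>+x. indicator S x \<partial>path_law \<xi> y (Suc (m + j)))"
    unfolding distr_P_y[OF \<xi>] by simp
  also have "\<dots> = (\<integral>\<^sup>+x. indicator B (pairs m (restrict x {0..<Suc m})) * indicator {x. alive \<theta> (m + j) x} x \<partial>path_law \<xi> y (Suc (m + j)))"
    by (intro nn_integral_cong) (auto simp: S_def pairs_restrict simp del: restrict_apply split: split_indicator)
  also have "\<dots> = (\<integral>\<^sup>+x. indicator B (pairs m x) * indicator {x. alive \<theta> m x} x * ennreal (survival \<theta> \<xi> j (x m)) \<partial>path_law \<xi> y (Suc m))"
    by (rule nn_integral_survival[OF \<xi>, symmetric]) measurable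
  finally show ?thesis .
qed

section \<open>The infinite path measure, its Markov property, and the conditional limit\<close>

context ground_state_at
begin

abbreviation chain :: "(nat \<Rightarrow> real) measure" where "chain \<equiv> IT.PF.lim"

lemma sets_chain [measurable_cong, simp]: "sets chain = sets (PiM UNIV (\<lambda>_. E))"
  by (rule IT.PF.sets_lim)

lemma space_chain: "space chain = space (PiM UNIV (\<lambda>_. E))"
  by (rule sets_eq_imp_space_eq) simp

lemma distr_chain: "distr chain (PiM {0..<n} (\<lambda>_. E)) (\<lambda>x. restrict x {0..<n}) = marginal_law n"
proof -
  have "n \<le> IT.up_to {0..<n}"
    using IT.up_to[of "{0..<n}"] by (cases n) auto
  from IT.distr_C[OF this, of "\<lambda>_. undefined" 0] show ?thesis
    by (simp add: IT.distr_lim IT.CI_def marginal_law_def)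
qed

lemma prob_space_chain: "prob_space chain"
proof (rule prob_space_distrD)
  show "(\<lambda>x. restrict x {0..<0}) \<in> chain \<rightarrow>\<^sub>M PiM {0..<0} (\<lambda>_. E)"
    unfolding measurable_cong_sets[OF sets_chain refl] by (rule measurable_restrict_subset) auto
  show "prob_space (distr chain (PiM {0..<0} (\<lambda>_. E)) (\<lambda>x. restrict x {0..<0}))"
    unfolding distr_chain by (rule prob_space_marginal_law)
qed

lemma restrict_chain [measurable]: "(\<lambda>x. restrict x {0..<n}) \<in> chain \<rightarrow>\<^sub>M PiM {0..<n} (\<lambda>_. E)"
  unfolding measurable_cong_sets[OF sets_chain refl] by (rule measurable_restrict_subset) auto

lemma component_chain [measurable]: "(\<lambda>x. x i) \<in> chain \<rightarrow>\<^sub>M E"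
  using measurable_component_singleton[of i UNIV "\<lambda>_. E"]
  by (simp add: measurable_cong_sets[OF sets_chain refl])

lemma nn_integral_chain:
  assumes "g \<in> borel_measurable (PiM {0..<n} (\<lambda>_. E))"
  shows "(\<integral>\<^sup>+\<omega>. g (restrict \<omega> {0..<n}) \<partial>chain) = (\<integral>\<^sup>+x. g x \<partial>marginal_law n)"
  unfolding distr_chain[symmetric] using assms by (subst nn_integral_distr) auto

lemma AE_chain_initial: "AE \<omega> in chain. \<omega> 0 = y"
proof -
  have E0: "(\<lambda>x. x 0) \<in> PiM {0..<Suc 0} (\<lambda>_. borel :: real measure) \<rightarrow>\<^sub>M borel"
    by (intro measurable_component_singleton) auto
  define g :: "(nat \<Rightarrow> real) \<Rightarrow> ennreal" where "g x = indicator {y} (x 0)" for x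
  have g: "g \<in> borel_measurable (PiM {0..<Suc 0} (\<lambda>_. borel))"
    unfolding g_def by (rule measurable_compose[OF E0]) measurable
  interpret prob_space chain by (rule prob_space_chain)
  have "(\<integral>\<^sup>+\<omega>. indicator {y} (\<omega> 0) \<partial>chain) = (\<integral>\<^sup>+\<omega>. g (restrict \<omega> {0..<Suc 0}) \<partial>chain)"
    by (simp add: g_def)
  also have "\<dots> = (\<integral>\<^sup>+x. g x \<partial>marginal_law (Suc 0))"
    by (rule nn_integral_chain) (rule measurable_compose[OF id_measurable_E g])
  also have "\<dots> = (\<integral>\<^sup>+x. g x * indicator {x. alive \<theta> 0 x} x * ennreal (h (x 0) / (lam ^ 0 * h y)) \<partial>path_law \<xi> y (Suc 0))"
    by (rule nn_integral_marginal_law[OF g])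
  also have "\<dots> = (\<integral>\<^sup>+x. \<integral>\<^sup>+t. indicator {y} t * ennreal (h t / h y) \<partial>return borel y \<partial>path_law \<xi> y 0)"
    using E0 by (subst nn_integral_path_law_Suc[OF \<xi>]) (auto simp: g_def alive_def state_law_def)
  also have "\<dots> = 1"
    using h_pos[OF y] prob_space.emeasure_space_1[OF prob_space_path_law[OF \<xi>, of y 0]]
    by (simp add: nn_integral_return)
  finally have "(\<integral>\<^sup>+\<omega>. indicator {y} (\<omega> 0) \<partial>chain) = 1" .
  moreover have "(\<integral>\<^sup>+\<omega>. indicator {y} (\<omega> 0) \<partial>chain) = emeasure chain {\<omega>\<in>space chain. \<omega> 0 = y}"
  proof -
    have "(\<lambda>\<omega>. \<omega> 0) \<in> borel_measurable chain"
      by (rule measurable_compose[OF component_chain]) (simp add: measurable_restrict_space1)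
    hence "{\<omega>\<in>space chain. \<omega> 0 = y} \<in> sets chain" by measurable
    hence "emeasure chain {\<omega>\<in>space chain. \<omega> 0 = y} = (\<integral>\<^sup>+\<omega>. indicator {\<omega>\<in>space chain. \<omega> 0 = y} \<omega> \<partial>chain)"
      by simp
    also have "\<dots> = (\<integral>\<^sup>+\<omega>. indicator {y} (\<omega> 0) \<partial>chain)"
      by (intro nn_integral_cong) (auto split: split_indicator)
    finally show ?thesis by simp
  qed
  ultimately have "prob {\<omega>\<in>space chain. \<omega> 0 = y} = 1"
    by (simp add: measure_def)
  thus ?thesis by (rule AE_prob_1[THEN eventually_mono]) auto
qed

lemma measure_ker_measurable [measurable]: "A \<in> sets E \<Longrightarrow> (\<lambda>x. measure (ker x) A) \<in> borel_measurable E"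
  using measurable_compose[OF ker_measurable_subprob measurable_measure_subprob_algebra] .

text \<open>Conditional expectations are characterised by their integrals over the sets of the
  filtration. Such a set is the preimage of a set G of paths of length n + 1, so both integrals
  reduce to the law of the first n + 2 coordinates, where the last one is integrated out with the
  kernel.\<close>

lemma markov_property:
  assumes A: "A \<in> sets E"
  shows "AE \<omega> in chain. real_cond_exp chain (natural_filtration chain E (\<lambda>k \<omega>. \<omega> k) n)
    (\<lambda>\<omega>'. indicator A (\<omega>' (Suc n))) \<omega> = measure (ker (\<omega> n)) A"
proof -
  interpret prob_space chain by (rule prob_space_chain)
  let ?F = "natural_filtration chain E (\<lambda>k \<omega>. \<omega> k) n"
  let ?r = "\<lambda>\<omega> :: nat \<Rightarrow> real. restrict \<omega> {0..<Suc n}"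
  have F: "?F = vimage_algebra (space chain) ?r (PiM {0..<Suc n} (\<lambda>_. E))"
    by (simp add: natural_filtration_def atLeast0LessThan lessThan_Suc_atMost)
  have sub: "subalgebra chain ?F"
    unfolding subalgebra_def F using sets_image_in_sets[OF refl restrict_chain] by auto
  interpret finite_measure_subalgebra chain ?F
    by standard (rule sub)
  have A': "A \<in> sets borel" using A by (rule sets_E_borel)
  have rF: "?r \<in> ?F \<rightarrow>\<^sub>M PiM {0..<Suc n} (\<lambda>_. E)"
    unfolding F by (rule measurable_vimage_algebra1) (use measurable_space[OF restrict_chain] in auto)
  have comp: "(\<lambda>x. x n) \<in> PiM {0..<Suc n} (\<lambda>_. E) \<rightarrow>\<^sub>M E"
    using measurable_component_singleton[of n "{0..<Suc n}" "\<lambda>_. E"] by simp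
  have comp1: "(\<lambda>x. x (Suc n)) \<in> PiM {0..<Suc (Suc n)} (\<lambda>_. E) \<rightarrow>\<^sub>M E"
    using measurable_component_singleton[of "Suc n" "{0..<Suc (Suc n)}" "\<lambda>_. E"] by simp
  have [measurable]: "(\<lambda>\<omega>. indicator A (\<omega> (Suc n)) :: real) \<in> borel_measurable chain"
    by (rule measurable_compose[OF component_chain]) (use A in measurable)
  have gF: "(\<lambda>\<omega>. measure (ker (\<omega> n)) A) \<in> borel_measurable ?F"
  proof -
    have "(\<lambda>\<omega>. measure (ker (?r \<omega> n)) A) \<in> borel_measurable ?F"
      by (rule measurable_compose[OF rF measurable_compose[OF comp measure_ker_measurable[OF A]]])
    thus ?thesis by simp
  qed
  hence [measurable]: "(\<lambda>\<omega>. measure (ker (\<omega> n)) A) \<in> borel_measurable chain"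
    by (rule measurable_from_subalg[OF sub])
  have ker1: "measure (ker (\<omega> n)) A \<le> 1" if "\<omega> \<in> space chain" for \<omega>
  proof -
    have "\<omega> n \<in> \<Omega>" using measurable_space[OF component_chain that, of n] by simp
    from prob_space_ker[OF this] show ?thesis by (rule prob_space.prob_le_1)
  qed
  show ?thesis
  proof (rule real_cond_exp_charact)
    show "integrable chain (\<lambda>\<omega>. indicator A (\<omega> (Suc n)) :: real)"
      by (rule integrable_const_bound[of _ 1]) (simp add: indicator_def, fact)
    show "integrable chain (\<lambda>\<omega>. measure (ker (\<omega> n)) A)"
      by (rule integrable_const_bound[of _ 1]) (auto intro: ker1)
    fix B assume "B \<in> sets ?F"
    then obtain G where G[measurable]: "G \<in> sets (PiM {0..<Suc n} (\<lambda>_. E))" and B: "B = ?r -` G \<inter> space chain"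
      unfolding F by (subst (asm) sets_vimage_algebra2) (use measurable_space[OF restrict_chain] in auto)
    have [measurable]: "B \<in> sets chain" unfolding B by (rule measurable_sets[OF restrict_chain G])
    define g :: "(nat \<Rightarrow> real) \<Rightarrow> ennreal" where "g x = indicator G (?r x) * indicator A (x (Suc n))" for x
    have r2: "?r \<in> PiM {0..<Suc (Suc n)} (\<lambda>_. E) \<rightarrow>\<^sub>M PiM {0..<Suc n} (\<lambda>_. E)"
      by (rule measurable_restrict_subset) auto
    have g: "g \<in> borel_measurable (PiM {0..<Suc (Suc n)} (\<lambda>_. E))"
      unfolding g_def by (intro borel_measurable_times_ennreal measurable_compose[OF r2] measurable_compose[OF comp1]) (use A in measurable)
    have "(\<integral>\<^sup>+\<omega>. ennreal (indicator B \<omega> * indicator A (\<omega> (Suc n))) \<partial>chain) =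
       (\<integral>\<^sup>+\<omega>. g (restrict \<omega> {0..<Suc (Suc n)}) \<partial>chain)"
    proof (rule nn_integral_cong)
      fix \<omega> assume "\<omega> \<in> space chain"
      moreover have "?r (restrict \<omega> {0..<Suc (Suc n)}) = ?r \<omega>" by auto
      ultimately show "ennreal (indicator B \<omega> * indicator A (\<omega> (Suc n))) = g (restrict \<omega> {0..<Suc (Suc n)})"
        by (simp only: g_def B) (auto split: split_indicator)
    qed
    also have "\<dots> = (\<integral>\<^sup>+x. \<integral>\<^sup>+t. g (x(Suc n := t)) \<partial>ker (x n) \<partial>marginal_law (Suc n))"
      unfolding nn_integral_chain[OF g] by (rule nn_integral_marginal_law_Suc_Suc[OF g])
    also have "\<dots> = (\<integral>\<^sup>+x. indicator G x * emeasure (ker (x n)) A \<partial>marginal_law (Suc n))"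
    proof (rule nn_integral_cong)
      fix x assume x: "x \<in> space (marginal_law (Suc n))"
      have "?r (x(Suc n := t)) = x" for t
        using x by (auto simp: space_PiM PiE_def extensional_def)
      hence eq: "g (x(Suc n := t)) = indicator G x * indicator A t" for t
        by (simp only: g_def) simp
      have "(\<integral>\<^sup>+t. g (x(Suc n := t)) \<partial>ker (x n)) = (\<integral>\<^sup>+t. indicator G x * indicator A t \<partial>ker (x n))"
        by (intro nn_integral_cong eq)
      also have "\<dots> = indicator G x * emeasure (ker (x n)) A"
        by (rule nn_integral_cmult_indicator) (simp only: sets_ker A)
      finally show "(\<integral>\<^sup>+t. g (x(Suc n := t)) \<partial>ker (x n)) = indicator G x * emeasure (ker (x n)) A" .
    qed
    also have "\<dots> = (\<integral>\<^sup>+\<omega>. indicator G (?r \<omega>) * emeasure (ker (?r \<omega> n)) A \<partial>chain)"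
    proof (rule nn_integral_chain[symmetric])
      have "(\<lambda>x. emeasure (ker (x n)) A) \<in> borel_measurable (PiM {0..<Suc n} (\<lambda>_. E))"
        by (rule measurable_compose[OF comp measurable_compose[OF ker_measurable_subprob measurable_emeasure_subprob_algebra[OF A]]])
      thus "(\<lambda>x. indicator G x * emeasure (ker (x n)) A) \<in> borel_measurable (PiM {0..<Suc n} (\<lambda>_. E))"
        by measurable
    qed
    also have "\<dots> = (\<integral>\<^sup>+\<omega>. ennreal (indicator B \<omega> * measure (ker (\<omega> n)) A) \<partial>chain)"
    proof (rule nn_integral_cong)
      fix \<omega> assume \<omega>: "\<omega> \<in> space chain"
      have "\<omega> n \<in> \<Omega>" using measurable_space[OF component_chain \<omega>, of n] by simp
      then interpret k: prob_space "ker (\<omega> n)" by (rule prob_space_ker)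
      have "?r \<omega> n = \<omega> n" by simp
      thus "indicator G (?r \<omega>) * emeasure (ker (?r \<omega> n)) A = ennreal (indicator B \<omega> * measure (ker (\<omega> n)) A)"
        using \<omega> by (simp only: B k.emeasure_eq_measure) (auto split: split_indicator)
    qed
    finally have "(\<integral>\<^sup>+\<omega>. ennreal (indicator B \<omega> * indicator A (\<omega> (Suc n))) \<partial>chain) = (\<integral>\<^sup>+\<omega>. ennreal (indicator B \<omega> * measure (ker (\<omega> n)) A) \<partial>chain)" .
    moreover have "(LINT \<omega>:B|chain. indicator A (\<omega> (Suc n))) = enn2real (\<integral>\<^sup>+\<omega>. ennreal (indicator B \<omega> * indicator A (\<omega> (Suc n))) \<partial>chain)"
      unfolding set_lebesgue_integral_def real_scaleR_def
      by (intro integral_eq_nn_integral borel_measurable_times borel_measurable_indicator AE_I2 mult_nonneg_nonneg indicator_pos_le) fact+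
    moreover have "(LINT \<omega>:B|chain. measure (ker (\<omega> n)) A) = enn2real (\<integral>\<^sup>+\<omega>. ennreal (indicator B \<omega> * measure (ker (\<omega> n)) A) \<partial>chain)"
      unfolding set_lebesgue_integral_def real_scaleR_def
      by (intro integral_eq_nn_integral borel_measurable_times borel_measurable_indicator AE_I2 mult_nonneg_nonneg indicator_pos_le measure_nonneg) fact+
    ultimately show "(LINT \<omega>:B|chain. indicator A (\<omega> (Suc n))) = (LINT \<omega>:B|chain. measure (ker (\<omega> n)) A)"
      by (simp only:)
  qed (rule gF)
qed

lemma markov_chain_chain: "markov_chain chain E ker y (\<lambda>k \<omega>. \<omega> k)"
  unfolding markov_chain_def
  using prob_space_chain ker_measurable AE_chain_initial markov_property by auto

text \<open>The unnormalised expectation of f at time m on the event B and survival up to m.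
  Numerators of the conditional probabilities (f = T^j 1), their limit (f = c h) and the law of the
  chain (f = h) are all values of this one functional.\<close>

definition killed_expectation :: "nat \<Rightarrow> (nat \<Rightarrow> real \<times> real) set \<Rightarrow> (real \<Rightarrow> real) \<Rightarrow> real" where
  "killed_expectation m B f = (\<integral>x. indicator B (pairs m x) * indicator {x. alive \<theta> m x} x * f (x m) \<partial>path_law \<xi> y (Suc m))"

lemma killed_integrand_measurable:
  assumes [measurable]: "B \<in> sets (PiM {1..m} (\<lambda>_. borel))" "f \<in> borel_measurable borel"
  shows "(\<lambda>x. indicator B (pairs m x) * indicator {x. alive \<theta> m x} x * f (x m) :: real) \<in> borel_measurable (path_law \<xi> y (Suc m))"
proof -
  have [measurable]: "(\<lambda>x. x m) \<in> borel_measurable (PiM {0..<Suc m} (\<lambda>_. borel :: real measure))"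
    by (intro measurable_component_singleton) auto
  have [measurable]: "pairs m \<in> PiM {0..<Suc m} (\<lambda>_. borel) \<rightarrow>\<^sub>M PiM {1..m} (\<lambda>_. borel)"
     "Measurable.pred (PiM {0..<Suc m} (\<lambda>_. borel)) (alive \<theta> m)"
    by (rule pairs_measurable alive_measurable; simp)+
  show ?thesis unfolding measurable_cong_sets[OF sets_path_law refl] by measurable
qed

lemma nn_integral_killed_expectation:
  assumes [measurable]: "B \<in> sets (PiM {1..m} (\<lambda>_. borel))" "f \<in> borel_measurable borel" and f: "\<And>x. 0 \<le> f x" "\<And>x. f x \<le> C"
  shows "(\<integral>\<^sup>+x. indicator B (pairs m x) * indicator {x. alive \<theta> m x} x * ennreal (f (x m)) \<partial>path_law \<xi> y (Suc m)) = ennreal (killed_expectation m B f)"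
    and "killed_expectation m B f \<ge> 0"
proof -
  interpret prob_space "path_law \<xi> y (Suc m)" by (rule prob_space_path_law[OF \<xi>])
  have "(\<integral>\<^sup>+x. ennreal (indicator B (pairs m x) * indicator {x. alive \<theta> m x} x * f (x m)) \<partial>path_law \<xi> y (Suc m)) = ennreal (killed_expectation m B f)"
    unfolding killed_expectation_def using f order.trans[OF f]
    by (intro nn_integral_eq_integral integrable_const_bound[of _ C] killed_integrand_measurable assms) (auto simp: indicator_def)
  thus "(\<integral>\<^sup>+x. indicator B (pairs m x) * indicator {x. alive \<theta> m x} x * ennreal (f (x m)) \<partial>path_law \<xi> y (Suc m)) = ennreal (killed_expectation m B f)"
    by (simp add: ennreal_mult'' f ennreal_indicator)
  show "killed_expectation m B f \<ge> 0" unfolding killed_expectation_def using f by (intro integral_nonneg_AE) auto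
qed

lemma killed_expectation_tendsto:
  assumes [measurable]: "B \<in> sets (PiM {1..m} (\<lambda>_. borel))"
  shows "(\<lambda>n. killed_expectation m B (\<lambda>x. survival \<theta> \<xi> n x / lam ^ n)) \<longlonglongrightarrow> killed_expectation m B (\<lambda>x. c * h x)"
  unfolding killed_expectation_def
proof (rule integral_dominated_convergence[where w = "\<lambda>_. K'"])
  interpret prob_space "path_law \<xi> y (Suc m)" by (rule prob_space_path_law[OF \<xi>])
  show "(\<lambda>x. indicat_real B (pairs m x) * indicat_real {x. alive \<theta> m x} x * (c * h (x m))) \<in> borel_measurable (path_law \<xi> y (Suc m))"
    "(\<lambda>x. indicat_real B (pairs m x) * indicat_real {x. alive \<theta> m x} x * (survival \<theta> \<xi> i (x m) / lam ^ i)) \<in> borel_measurable (path_law \<xi> y (Suc m))" for i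
    by (rule killed_integrand_measurable[OF assms]; simp)+
  show "integrable (path_law \<xi> y (Suc m)) (\<lambda>_. K')" by simp
  have "0 \<le> survival \<theta> \<xi> i x / lam ^ i" "survival \<theta> \<xi> i x / lam ^ i \<le> K'" for i x
    using survival_bounds[OF \<xi>] survival_le[of i x] lam by (auto simp: field_simps)
  hence "\<bar>survival \<theta> \<xi> i x / lam ^ i\<bar> \<le> K'" for i x by (simp only: abs_of_nonneg)
  moreover from this[of 0 0] have "0 \<le> K'" by linarith
  ultimately have "norm (indicat_real B (pairs m x) * indicat_real {x. alive \<theta> m x} x * (survival \<theta> \<xi> i (x m) / lam ^ i)) \<le> K'" for i x
    unfolding indicator_def by (cases "pairs m x \<in> B"; cases "alive \<theta> m x") (simp_all del: abs_divide)
  thus "AE x in path_law \<xi> y (Suc m). norm (indicat_real B (pairs m x) * indicat_real {x. alive \<theta> m x} x * (survival \<theta> \<xi> i (x m) / lam ^ i)) \<le> K'" for i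
    by (intro AE_I2)
  show "AE x in path_law \<xi> y (Suc m). (\<lambda>i. indicat_real B (pairs m x) * indicat_real {x. alive \<theta> m x} x * (survival \<theta> \<xi> i (x m) / lam ^ i)) \<longlonglongrightarrow>
    indicat_real B (pairs m x) * indicat_real {x. alive \<theta> m x} x * (c * h (x m))"
    by (intro AE_I2 tendsto_intros survival_asymp)
qed

lemma measure_P_y:
  assumes [measurable]: "B \<in> sets (PiM {1..m} (\<lambda>_. borel))"
  shows "measure (P_y \<xi> y) {\<omega>\<in>space (P_y \<xi> y). (\<lambda>k\<in>{1..m}. M_chain k \<omega>) \<in> B \<and> survives \<theta> (m + j) \<omega>} = killed_expectation m B (survival \<theta> \<xi> j)"
  unfolding measure_def emeasure_P_y[OF \<xi> assms]
  using nn_integral_killed_expectation[OF assms survival_measurable, of \<theta> \<xi> j 1] survival_bounds[OF \<xi>] by simp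

lemma measure_survives: "measure (P_y \<xi> y) {\<omega>\<in>space (P_y \<xi> y). survives \<theta> n \<omega>} = survival \<theta> \<xi> n y"
proof -
  \<comment> \<open>For m = 0 the joint event of the previous lemma reduces to survival alone; the
    empty product has exactly this one point.\<close>
  have B: "{\<lambda>_. undefined} \<in> sets (PiM {1..0 :: nat} (\<lambda>_. borel :: (real \<times> real) measure))"
    by (simp add: PiM_empty)
  have "pairs 0 x = (\<lambda>_. undefined)" for x by (simp add: pairs_def fun_eq_iff)
  moreover have "(\<lambda>k\<in>{1..0::nat}. M_chain k \<omega>) = (\<lambda>_. undefined)" for \<omega> by (simp add: fun_eq_iff)
  ultimately have "measure (P_y \<xi> y) {\<omega>\<in>space (P_y \<xi> y). survives \<theta> n \<omega>} = (\<integral>x. survival \<theta> \<xi> n (x 0) \<partial>path_law \<xi> y (Suc 0))"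
    using measure_P_y[OF B, of n] by (simp add: killed_expectation_def alive_def)
  also have "\<dots> = enn2real (\<integral>\<^sup>+x. survival \<theta> \<xi> n (x 0) \<partial>path_law \<xi> y (Suc 0))"
  proof (rule integral_eq_nn_integral)
    show "(\<lambda>x. survival \<theta> \<xi> n (x 0)) \<in> borel_measurable (path_law \<xi> y (Suc 0))"
      unfolding measurable_cong_sets[OF sets_path_law refl]
      by (rule measurable_compose[OF measurable_component_singleton[of 0 _ "\<lambda>_. borel"] survival_measurable]) simp
  qed (use survival_bounds[OF \<xi>] in auto)
  also have "(\<integral>\<^sup>+x. survival \<theta> \<xi> n (x 0) \<partial>path_law \<xi> y (Suc 0)) = (\<integral>\<^sup>+x. survival \<theta> \<xi> n y \<partial>path_law \<xi> y 0)"
  proof (subst nn_integral_path_law_Suc[OF \<xi>])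
    show "(\<lambda>x. ennreal (survival \<theta> \<xi> n (x 0))) \<in> borel_measurable (PiM {0..<Suc 0} (\<lambda>_. borel))"
      by (rule measurable_compose[OF measurable_component_singleton[of 0 _ "\<lambda>_. borel"]]) simp_all
  qed (simp add: state_law_def nn_integral_return)
  also have "\<dots> = ennreal (survival \<theta> \<xi> n y)"
    using prob_space.emeasure_space_1[OF prob_space_path_law[OF \<xi>, of y 0]] by simp
  finally show ?thesis using survival_bounds[OF \<xi>] by simp
qed

lemma measure_chain:
  assumes B[measurable]: "B \<in> sets (PiM {1..m} (\<lambda>_. borel))"
  shows "measure chain {\<omega>\<in>space chain. (\<lambda>k\<in>{1..m}. (\<omega> k, \<omega> (k - 1))) \<in> B} = killed_expectation m B h / (lam ^ m * h y)"
proof -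
  let ?X = "PiM {0..<Suc m} (\<lambda>_. borel :: real measure)"
  have [measurable]: "(\<lambda>x. x m) \<in> borel_measurable ?X"
    by (intro measurable_component_singleton) auto
  have p: "(\<lambda>x. indicator B (pairs m x)) \<in> borel_measurable ?X" by measurable
  have pE: "pairs m \<in> PiM {0..<Suc m} (\<lambda>_. E) \<rightarrow>\<^sub>M PiM {1..m} (\<lambda>_. borel)"
    by (rule measurable_compose[OF id_measurable_E pairs_measurable]) simp
  have "(\<lambda>\<omega>. pairs m (restrict \<omega> {0..<Suc m})) \<in> chain \<rightarrow>\<^sub>M PiM {1..m} (\<lambda>_. borel)"
    by (rule measurable_compose[OF restrict_chain pE])
  hence [measurable]: "pairs m \<in> chain \<rightarrow>\<^sub>M PiM {1..m} (\<lambda>_. borel)"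
    unfolding pairs_restrict[OF order.refl] .
  have "{\<omega>\<in>space chain. pairs m \<omega> \<in> B} \<in> sets chain" by measurable
  hence "emeasure chain {\<omega>\<in>space chain. pairs m \<omega> \<in> B} = (\<integral>\<^sup>+\<omega>. indicator {\<omega>\<in>space chain. pairs m \<omega> \<in> B} \<omega> \<partial>chain)"
    by simp
  also have "\<dots> = (\<integral>\<^sup>+\<omega>. indicator B (pairs m (restrict \<omega> {0..<Suc m})) \<partial>chain)"
    unfolding pairs_restrict[OF order.refl] by (intro nn_integral_cong) (auto split: split_indicator)
  also have "\<dots> = (\<integral>\<^sup>+x. indicator B (pairs m x) \<partial>marginal_law (Suc m))"
    by (rule nn_integral_chain) (rule measurable_compose[OF pE], use B in measurable)
  also have "\<dots> = (\<integral>\<^sup>+x. indicator B (pairs m x) * indicator {x. alive \<theta> m x} x * ennreal (h (x m) / (lam ^ m * h y)) \<partial>path_law \<xi> y (Suc m))"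
    by (rule nn_integral_marginal_law[OF p])
  also have "\<dots> = ennreal (killed_expectation m B (\<lambda>x. h x / (lam ^ m * h y)))"
    using lam h_nonneg h_le by (intro nn_integral_killed_expectation(1)[OF B, of _ "K / (lam ^ m * h y)"]) (auto intro!: divide_right_mono)
  also have "killed_expectation m B (\<lambda>x. h x / (lam ^ m * h y)) = killed_expectation m B h / (lam ^ m * h y)"
    unfolding killed_expectation_def by simp
  finally have "emeasure chain {\<omega>\<in>space chain. pairs m \<omega> \<in> B} = ennreal (killed_expectation m B h / (lam ^ m * h y))" .
  moreover have "killed_expectation m B h / (lam ^ m * h y) \<ge> 0"
    using nn_integral_killed_expectation(2)[OF B h_measurable h_nonneg h_le] lam h_nonneg by simp
  ultimately show ?thesis
    unfolding pairs_def[symmetric] measure_def by simp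
qed

text \<open>With n + m in place of n, the conditional probability is a quotient of the killed
  expectation of T^n 1 and of T^(n+m) 1 at y. Dividing both by the power of lam, numerator and
  denominator converge, c cancels, and what remains is the h-transformed law.\<close>

lemma conditional_law_tendsto:
  assumes B[measurable]: "B \<in> sets (PiM {1..m} (\<lambda>_. borel))"
  shows "(\<lambda>n. \<P>(\<omega> in P_y \<xi> y. (\<lambda>k\<in>{1..m}. M_chain k \<omega>) \<in> B \<bar> survives \<theta> n \<omega>))
     \<longlonglongrightarrow> \<P>(\<omega> in chain. (\<lambda>k\<in>{1..m}. (\<omega> k, \<omega> (k - 1))) \<in> B)"
proof (rule LIMSEQ_offset[where k = m])
  have "(\<lambda>n. killed_expectation m B (\<lambda>x. survival \<theta> \<xi> n x / lam ^ n) / (lam ^ m * (survival \<theta> \<xi> (n + m) y / lam ^ (n + m))))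
     \<longlonglongrightarrow> killed_expectation m B (\<lambda>x. c * h x) / (lam ^ m * (c * h y))"
    using lam c h_pos[OF y]
    by (intro tendsto_intros killed_expectation_tendsto[OF B] LIMSEQ_ignore_initial_segment[OF survival_asymp]) auto
  also have "killed_expectation m B (\<lambda>x. c * h x) = c * killed_expectation m B h"
    unfolding killed_expectation_def by (subst integral_mult_right_zero[symmetric]) (simp add: mult_ac)
  also have "c * killed_expectation m B h / (lam ^ m * (c * h y)) = measure chain {\<omega>\<in>space chain. (\<lambda>k\<in>{1..m}. (\<omega> k, \<omega> (k - 1))) \<in> B}"
    using c by (subst measure_chain[OF B]) (simp add: field_simps)
  also have "(\<lambda>n. killed_expectation m B (\<lambda>x. survival \<theta> \<xi> n x / lam ^ n) / (lam ^ m * (survival \<theta> \<xi> (n + m) y / lam ^ (n + m))))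
     = (\<lambda>n. \<P>(\<omega> in P_y \<xi> y. (\<lambda>k\<in>{1..m}. M_chain k \<omega>) \<in> B \<bar> survives \<theta> (n + m) \<omega>))"
  proof
    fix n
    have "killed_expectation m B (\<lambda>x. survival \<theta> \<xi> n x / lam ^ n) = killed_expectation m B (survival \<theta> \<xi> n) / lam ^ n"
      unfolding killed_expectation_def by simp
    moreover have "\<P>(\<omega> in P_y \<xi> y. (\<lambda>k\<in>{1..m}. M_chain k \<omega>) \<in> B \<bar> survives \<theta> (n + m) \<omega>) = killed_expectation m B (survival \<theta> \<xi> n) / survival \<theta> \<xi> (n + m) y"
      using measure_P_y[OF B, of n] measure_survives[of "n + m"] by (simp add: cond_prob_def add.commute)
    ultimately show "killed_expectation m B (\<lambda>x. survival \<theta> \<xi> n x / lam ^ n) / (lam ^ m * (survival \<theta> \<xi> (n + m) y / lam ^ (n + m)))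
      = \<P>(\<omega> in P_y \<xi> y. (\<lambda>k\<in>{1..m}. M_chain k \<omega>) \<in> B \<bar> survives \<theta> (n + m) \<omega>)"
      using lam by (simp add: power_add)
  qed
  finally show "(\<lambda>n. \<P>(\<omega> in P_y \<xi> y. (\<lambda>k\<in>{1..m}. M_chain k \<omega>) \<in> B \<bar> survives \<theta> (n + m) \<omega>))
     \<longlonglongrightarrow> \<P>(\<omega> in chain. (\<lambda>k\<in>{1..m}. (\<omega> k, \<omega> (k - 1))) \<in> B)" .
qed

end

context ground_state
begin

lemma markov_chain_and_conditional_limit:
  "lam > 0 \<and>
    (\<forall>x. set_integrable lborel {\<theta> * x<..} (\<lambda>t. h t * phi \<xi> t) \<and>
         lam * h x = (LINT t:{\<theta> * x<..}|lborel. h t * phi \<xi> t)) \<and>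
    (\<forall>y\<in>\<Omega>. \<exists>(N :: (nat \<Rightarrow> real) measure) Y.
       markov_chain N (restrict_space borel \<Omega>) (kernel' \<theta> \<xi> \<Omega> lam h) y Y \<and>
       (\<forall>m\<ge>1. \<forall>B\<in>sets (\<Pi>\<^sub>M k\<in>{1..m}. (borel :: (real \<times> real) measure)).
          (\<lambda>n. \<P>(\<omega> in P_y \<xi> y. (\<lambda>k\<in>{1..m}. M_chain k \<omega>) \<in> B \<bar> survives \<theta> n \<omega>))
            \<longlonglongrightarrow> \<P>(\<omega> in N. (\<lambda>k\<in>{1..m}. (Y k \<omega>, Y (k - 1) \<omega>)) \<in> B)))"
proof (intro conjI allI ballI)
  show "lam > 0" by (rule lam)
  show "set_integrable lborel {\<theta> * x<..} (\<lambda>t. h t * phi \<xi> t)" for x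
    using h_nonneg h_le by (intro integrable_bounded_phi[of _ K]) auto
  show "lam * h x = (LINT t:{\<theta> * x<..}|lborel. h t * phi \<xi> t)" for x
    using eigen[of x] by (simp add: step_op_def)
  fix y assume "y \<in> \<Omega>"
  then interpret ground_state_at \<theta> \<xi> lam c K K' \<Omega> h y by unfold_locales
  show "\<exists>(N :: (nat \<Rightarrow> real) measure) Y.
       markov_chain N (restrict_space borel \<Omega>) (kernel' \<theta> \<xi> \<Omega> lam h) y Y \<and>
       (\<forall>m\<ge>1. \<forall>B\<in>sets (\<Pi>\<^sub>M k\<in>{1..m}. (borel :: (real \<times> real) measure)).
          (\<lambda>n. \<P>(\<omega> in P_y \<xi> y. (\<lambda>k\<in>{1..m}. M_chain k \<omega>) \<in> B \<bar> survives \<theta> n \<omega>))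
            \<longlonglongrightarrow> \<P>(\<omega> in N. (\<lambda>k\<in>{1..m}. (Y k \<omega>, Y (k - 1) \<omega>)) \<in> B))"
    by (intro exI[of _ chain] exI[of _ "\<lambda>k \<omega>. \<omega> k"] conjI allI impI ballI markov_chain_chain conditional_law_tendsto)
qed

end

section \<open>The step operator on half lines\<close>

definition upper_int :: "(real \<Rightarrow> real) \<Rightarrow> real \<Rightarrow> real" where
  "upper_int f a = (LINT t:{a<..}|lborel. f t * exp (- t))"

text \<open>The interval is closed, unlike the half line in \<open>step_op\<close>, so that the
  fundamental theorem of calculus applies on a compact set; the end points are null.\<close>

definition lower_int :: "(real \<Rightarrow> real) \<Rightarrow> real \<Rightarrow> real" where
  "lower_int f a = (LINT t:{a..0}|lborel. f t * exp t)"

lemma upper_integrable: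
  fixes f :: "real \<Rightarrow> real"
  assumes [measurable]: "f \<in> borel_measurable borel" and b: "\<And>x. \<bar>f x\<bar> \<le> K"
  shows "set_integrable lborel {a<..} (\<lambda>t. f t * exp (- t))"
  unfolding set_integrable_def
proof (rule Bochner_Integration.integrable_bound)
  show "integrable lborel (\<lambda>t. K * (indicator {a<..} t * exp (- (1 * t))))"
    using exp_pos_bochner[of 1 a] by (intro integrable_mult_right) (auto simp: has_bochner_integral_iff)
  show "AE t in lborel. norm (indicator {a<..} t *\<^sub>R (f t * exp (- t))) \<le> norm (K * (indicator {a<..} t * exp (- (1 * t))))"
    using b by (intro AE_I2) (auto simp: indicator_def abs_mult intro!: mult_right_mono order.trans[OF b])
qed measurable

lemma lower_integrable:
  fixes f :: "real \<Rightarrow> real"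
  assumes [measurable]: "f \<in> borel_measurable borel" and b: "\<And>x. \<bar>f x\<bar> \<le> K"
  shows "set_integrable lborel {a..0} (\<lambda>t. f t * exp t)"
  unfolding set_integrable_def
proof (rule Bochner_Integration.integrable_bound)
  show "integrable lborel (\<lambda>t. K * (indicator {..<1} t * exp (1 * t)))"
    using exp_neg_bochner[of 1 1] by (intro integrable_mult_right) (auto simp: has_bochner_integral_iff)
  show "AE t in lborel. norm (indicator {a..0} t *\<^sub>R (f t * exp t)) \<le> norm (K * (indicator {..<1} t * exp (1 * t)))"
    using b by (intro AE_I2) (auto simp: indicator_def abs_mult intro!: mult_right_mono order.trans[OF b])
qed measurable

lemma step_op_upper:
  assumes "\<theta> * x \<ge> 0"
  shows "step_op \<theta> \<xi> f x = (1 - \<xi>) * upper_int f (\<theta> * x)"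
proof -
  have "step_op \<theta> \<xi> f x = (LINT t:{\<theta> * x<..}|lborel. (1 - \<xi>) * (f t * exp (- t)))"
    unfolding step_op_def set_lebesgue_integral_def using assms
    by (intro Bochner_Integration.integral_cong) (auto simp: indicator_def phi_def)
  thus ?thesis unfolding upper_int_def by simp
qed

lemma step_op_lower:
  assumes f: "f \<in> borel_measurable borel" "\<And>x. \<bar>f x\<bar> \<le> K" and "\<theta> * x \<le> 0"
  shows "step_op \<theta> \<xi> f x = \<xi> * lower_int f (\<theta> * x) + (1 - \<xi>) * upper_int f 0"
proof -
  note [measurable] = f(1)
  have l: "set_integrable lborel {\<theta> * x..0} (\<lambda>t. \<xi> * (f t * exp t))"
    and u: "set_integrable lborel {0<..} (\<lambda>t. (1 - \<xi>) * (f t * exp (- t)))"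
    using lower_integrable[OF f] upper_integrable[OF f] by simp_all
  have "step_op \<theta> \<xi> f x = (\<integral>t. indicator {\<theta> * x..0} t *\<^sub>R (\<xi> * (f t * exp t)) + indicator {0<..} t *\<^sub>R ((1 - \<xi>) * (f t * exp (- t))) \<partial>lborel)"
    unfolding step_op_def set_lebesgue_integral_def
  proof (rule integral_cong_AE)
    show "AE t in lborel. indicator {\<theta> * x<..} t *\<^sub>R (f t * phi \<xi> t) =
      indicator {\<theta> * x..0} t *\<^sub>R (\<xi> * (f t * exp t)) + indicator {0<..} t *\<^sub>R ((1 - \<xi>) * (f t * exp (- t)))"
      using AE_lborel_singleton[of 0] AE_lborel_singleton[of "\<theta> * x"]
      by eventually_elim (use assms(3) in \<open>auto simp: indicator_def phi_def\<close>)
  qed measurable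
  also have "\<dots> = (LINT t:{\<theta> * x..0}|lborel. \<xi> * (f t * exp t)) + (LINT t:{0<..}|lborel. (1 - \<xi>) * (f t * exp (- t)))"
    using l u unfolding set_integrable_def set_lebesgue_integral_def by (rule Bochner_Integration.integral_add)
  finally show ?thesis unfolding upper_int_def lower_int_def by simp
qed

lemma upper_int_exp:
  assumes "1 + b > 0" "a \<ge> 0" "\<And>t. t \<ge> 0 \<Longrightarrow> f t = c * exp (- (b * t))"
  shows "upper_int f a = c * exp (- ((1 + b) * a)) / (1 + b)"
proof -
  have "upper_int f a = (LINT t|lborel. c * (indicator {a<..} t * exp (- ((1 + b) * t))))"
    unfolding upper_int_def set_lebesgue_integral_def
    using assms by (intro Bochner_Integration.integral_cong) (auto simp: indicator_def exp_add[symmetric] algebra_simps)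
  thus ?thesis using exp_pos_bochner[OF assms(1), of a] by (simp add: has_bochner_integral_iff)
qed

lemma lower_int_FTC:
  assumes "a \<le> 0" "\<And>t. a \<le> t \<Longrightarrow> t \<le> 0 \<Longrightarrow> (F has_real_derivative f t * exp t) (at t within {a..0})" "continuous_on {a..0} f"
  shows "lower_int f a = F 0 - F a"
  unfolding lower_int_def set_lebesgue_integral_def
  using assms by (intro integral_FTC_Icc continuous_intros) (auto simp: has_real_derivative_iff_has_vector_derivative)

text \<open>The continuous g stands in for f beyond a, since f itself may be given by another
  formula at and below a. The improper integral is the limit of the integrals up to y.\<close>

lemma upper_int_FTC:
  assumes f: "f \<in> borel_measurable borel" "\<And>x. \<bar>f x\<bar> \<le> K"
    and g: "\<And>t. t > a \<Longrightarrow> f t = g t" "continuous_on {a..} g"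
    and F: "\<And>t. a \<le> t \<Longrightarrow> (F has_real_derivative g t * exp (- t)) (at t within {a..})"
    and l: "(F \<longlongrightarrow> l) at_top"
  shows "upper_int f a = l - F a"
proof -
  have "((\<lambda>y. \<integral>t. indicator {..y} t *\<^sub>R (indicator {a<..} t *\<^sub>R (f t * exp (- t))) \<partial>lborel) \<longlongrightarrow> upper_int f a) at_top"
    unfolding upper_int_def set_lebesgue_integral_def
    using upper_integrable[OF f, of a] unfolding set_integrable_def
    by (intro tendsto_integral_at_top) auto
  moreover have "eventually (\<lambda>y. (\<integral>t. indicator {..y} t *\<^sub>R (indicator {a<..} t *\<^sub>R (f t * exp (- t))) \<partial>lborel) = F y - F a) at_top"
    using eventually_ge_at_top[of a]
  proof eventually_elim
    case (elim y)
    have cont: "continuous_on {a..y} (\<lambda>t. g t * exp (- t))"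
      by (intro continuous_intros continuous_on_subset[OF g(2)]) auto
    have "has_bochner_integral lborel (\<lambda>t. indicator {a..y} t *\<^sub>R (g t * exp (- t))) (F y - F a)"
    proof (rule has_bochner_integral_FTC_Icc[OF elim _ cont])
      fix t assume "a \<le> t" "t \<le> y"
      thus "(F has_vector_derivative g t * exp (- t)) (at t within {a..y})"
        using F[of t] by (auto simp: has_real_derivative_iff_has_vector_derivative[symmetric] intro: DERIV_subset)
    qed
    moreover have "AE t in lborel. indicator {a..y} t *\<^sub>R (g t * exp (- t)) = indicator {..y} t *\<^sub>R (indicator {a<..} t *\<^sub>R (f t * exp (- t)))"
      using AE_lborel_singleton[of a] by eventually_elim (auto simp: indicator_def g)
    ultimately have "has_bochner_integral lborel (\<lambda>t. indicator {..y} t *\<^sub>R (indicator {a<..} t *\<^sub>R (f t * exp (- t)))) (F y - F a)"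
      using f(1) by (subst has_bochner_integral_cong_AE[symmetric]) (auto dest: borel_measurable_has_bochner_integral)
    thus ?case by (simp add: has_bochner_integral_iff)
  qed
  ultimately have "((\<lambda>y. F y - F a) \<longlongrightarrow> upper_int f a) at_top"
    by (rule Lim_transform_eventually)
  moreover have "((\<lambda>y. F y - F a) \<longlongrightarrow> l - F a) at_top"
    by (intro tendsto_intros l)
  ultimately show ?thesis by (rule tendsto_unique[rotated 1]) simp
qed

lemma upper_int_mono:
  assumes "f \<in> borel_measurable borel" "g \<in> borel_measurable borel" "\<And>x. \<bar>f x\<bar> \<le> K" "\<And>x. \<bar>g x\<bar> \<le> K'" "\<And>x. x > a \<Longrightarrow> f x \<le> g x"
  shows "upper_int f a \<le> upper_int g a"
  unfolding upper_int_def
  using assms by (intro set_integral_mono upper_integrable) auto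

lemma lower_int_mono:
  assumes "f \<in> borel_measurable borel" "g \<in> borel_measurable borel" "\<And>x. \<bar>f x\<bar> \<le> K" "\<And>x. \<bar>g x\<bar> \<le> K'" "\<And>x. a \<le> x \<Longrightarrow> x \<le> 0 \<Longrightarrow> f x \<le> g x"
  shows "lower_int f a \<le> lower_int g a"
  unfolding lower_int_def
  using assms by (intro set_integral_mono lower_integrable) auto

text \<open>For q \<noteq> 1 this is b_j = q + q^2 + ... + q^j. It is generated by the step
  operator: the density adds 1 to an exponent and the integration limit \<theta> x multiplies it by
  q, whence b_(j+1) = q (1 + b_j).\<close>

definition qexponent :: "real \<Rightarrow> nat \<Rightarrow> real" where
  "qexponent q j = q * ((1 - q ^ j) / (1 - q))"

lemma one_plus_qexponent: "q \<noteq> 1 \<Longrightarrow> 1 + qexponent q j = qnumber q (Suc j)"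
  by (simp add: qexponent_def qnumber_def field_simps)

lemma qexponent_Suc: "q \<noteq> 1 \<Longrightarrow> qexponent q (Suc j) = q * (1 + qexponent q j)"
  by (simp add: qexponent_def field_simps)

lemma qexponent_0 [simp]: "qexponent q 0 = 0"
  by (simp add: qexponent_def)

lemma qnumber_pos: "q > 0 \<Longrightarrow> q \<noteq> 1 \<Longrightarrow> qnumber q (Suc j) > 0"
  by (cases "q < 1") (auto simp: qnumber_def power_less_one_iff divide_neg_neg simp del: power_Suc)

lemma qexponent_nonneg: "q > 0 \<Longrightarrow> q \<noteq> 1 \<Longrightarrow> qexponent q j \<ge> 0"
  by (cases "q < 1") (auto simp: qexponent_def power_le_one one_le_power intro!: mult_nonneg_nonneg divide_nonpos_nonpos simp del: times_divide_eq_right)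

lemma qfact_Suc: "q \<noteq> 1 \<Longrightarrow> qfact q (Suc n) = qfact q n * qnumber q (Suc n)"
  by (simp add: qfact_def)

lemma qfact_0 [simp]: "qfact q 0 = 1"
  by (simp add: qfact_def)

lemma qfact_pos: "q > 0 \<Longrightarrow> qfact q n > 0"
  by (cases "q = 1") (simp add: qfact_def, induction n, auto simp: qfact_Suc qnumber_pos)

text \<open>For x \<ge> 0 only t > \<theta> x \<ge> 0 matter, where each step maps an exponential of
  rate b_n to a multiple of the one of rate b_(n+1) and contributes the factor (1 - \<xi>) /
  [n + 1].\<close>

lemma survival_upper:
  assumes "\<theta> > 0" "\<theta> \<noteq> 1" "x \<ge> 0"
  shows "survival \<theta> \<xi> n x = (1 - \<xi>) ^ n / qfact \<theta> n * exp (- (qexponent \<theta> n * x))"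
  using assms(3)
proof (induction n arbitrary: x)
  case (Suc n)
  have p: "1 + qexponent \<theta> n > 0" using qexponent_nonneg[of \<theta> n] assms by simp
  have "survival \<theta> \<xi> (Suc n) x = (1 - \<xi>) * upper_int (survival \<theta> \<xi> n) (\<theta> * x)"
    using assms Suc.prems by (simp add: step_op_upper)
  also have "upper_int (survival \<theta> \<xi> n) (\<theta> * x) = (1 - \<xi>) ^ n / qfact \<theta> n * exp (- ((1 + qexponent \<theta> n) * (\<theta> * x))) / (1 + qexponent \<theta> n)"
    using assms Suc by (intro upper_int_exp p) auto
  finally show ?case
    using assms by (simp add: qfact_Suc one_plus_qexponent[symmetric] qexponent_Suc mult_ac)
qed auto

text \<open>The limit is the infinite product (p; p), which supplies the constant c = 1 / (p; p) in
  regimes (i) and (ii).\<close>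

lemma qpochhammer_tendsto_pos:
  assumes p: "0 < p" "p < 1"
  obtains c where "c > 0" "qpochhammer p p \<longlonglongrightarrow> c"
proof -
  let ?f = "\<lambda>i. 1 - p * p ^ i"
  have fpos: "?f i > 0" for i
    using p power_less_one_iff[of p "Suc i"] by simp
  have "summable (\<lambda>i. p * p ^ i)"
    using p by (intro summable_mult summable_geometric) auto
  hence "summable (\<lambda>i. norm (?f i - 1))"
    using p by simp
  hence "convergent_prod ?f"
    by (intro abs_convergent_prod_imp_convergent_prod) (simp add: abs_convergent_prod_conv_summable)
  then obtain L where L: "(\<lambda>n. \<Prod>i\<le>n. ?f i) \<longlonglongrightarrow> L" "L \<noteq> 0"
    using fpos by (subst (asm) convergent_prod_iff_nz_lim) (auto simp: less_le)
  have "L \<ge> 0"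
    by (rule LIMSEQ_le_const[OF L(1)]) (use fpos in \<open>auto intro!: prod_nonneg simp: less_imp_le\<close>)
  moreover have "(\<lambda>n. qpochhammer p p (Suc n)) \<longlonglongrightarrow> L"
    using L(1) by (simp add: qpochhammer_def lessThan_Suc_atMost)
  hence "qpochhammer p p \<longlonglongrightarrow> L" by (rule LIMSEQ_imp_Suc)
  ultimately show ?thesis using L(2) by (intro that[of L]) auto
qed

section \<open>Poisson averages\<close>

text \<open>For s \<ge> 0 this is the mean of a_N with N Poisson distributed of parameter s. The
  function h of regime (i) and the two-variable functions for q < 1 have this form on the negative
  half line, so bounds and signs of the sequence pass to them.\<close>

definition poisson :: "(nat \<Rightarrow> 'a :: {real_normed_field, banach}) \<Rightarrow> real \<Rightarrow> 'a" where
  "poisson a s = exp (- s) *\<^sub>R (\<Sum>m. (s ^ m / fact m) *\<^sub>R a m)"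

lemma poisson_summable:
  fixes a :: "nat \<Rightarrow> 'a :: {real_normed_field, banach}"
  assumes "\<And>m. norm (a m) \<le> B"
  shows "summable (\<lambda>m. norm ((s ^ m / fact m) *\<^sub>R a m))"
proof (rule summable_comparison_test')
  have "summable (\<lambda>m. inverse (fact m) * \<bar>s\<bar> ^ m)" by (rule summable_exp)
  thus "summable (\<lambda>m. \<bar>s\<bar> ^ m / fact m * B)"
    by (intro summable_mult2) (simp add: field_simps)
  show "norm (norm ((s ^ m / fact m) *\<^sub>R a m)) \<le> \<bar>s\<bar> ^ m / fact m * B" if "m \<ge> 0" for m
    using assms[of m] by (simp add: power_abs abs_mult divide_right_mono mult_left_mono)
qed

lemma poisson_summable': 
  fixes a :: "nat \<Rightarrow> 'a :: {real_normed_field, banach}"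
  assumes "\<And>m. norm (a m) \<le> B"
  shows "summable (\<lambda>m. (s ^ m / fact m) *\<^sub>R a m)"
  using poisson_summable[OF assms] by (rule summable_norm_cancel)

lemma exp_series_real: "(\<lambda>m. s ^ m / fact m) sums exp (s :: real)"
  using exp_converges[of s] by (simp add: field_simps)

lemma norm_poisson_le:
  fixes a :: "nat \<Rightarrow> 'a :: {real_normed_field, banach}"
  assumes "\<And>m. norm (a m) \<le> B" "s \<ge> 0"
  shows "norm (poisson a s) \<le> B"
proof -
  have "norm (\<Sum>m. (s ^ m / fact m) *\<^sub>R a m) \<le> (\<Sum>m. norm ((s ^ m / fact m) *\<^sub>R a m))"
    by (rule summable_norm[OF poisson_summable[OF assms(1)]])
  also have "\<dots> \<le> (\<Sum>m. s ^ m / fact m * B)"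
    using assms by (intro suminf_le poisson_summable[of _ B] summable_mult2 sums_summable[OF exp_series_real]) (auto intro!: mult_left_mono divide_right_mono)
  also have "\<dots> = exp s * B"
    using sums_mult2[OF exp_series_real[of s], of B] by (simp add: sums_iff)
  finally show ?thesis by (simp add: poisson_def exp_minus field_simps)
qed

lemma poisson_ge:
  fixes a :: "nat \<Rightarrow> real"
  assumes "\<And>m. \<bar>a m\<bar> \<le> B" "\<And>m. a m \<ge> \<delta>" "s \<ge> 0"
  shows "poisson a s \<ge> \<delta>"
proof -
  have "exp s * \<delta> = (\<Sum>m. s ^ m / fact m * \<delta>)"
    using sums_mult2[OF exp_series_real[of s], of \<delta>] by (simp add: sums_iff)
  also have "\<dots> \<le> (\<Sum>m. (s ^ m / fact m) *\<^sub>R a m)"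
    using assms by (intro suminf_le poisson_summable'[of _ B] summable_mult2 sums_summable[OF exp_series_real]) (auto intro!: mult_left_mono divide_right_mono)
  finally show ?thesis by (simp add: poisson_def exp_minus field_simps)
qed

lemma poisson_0 [simp]: "poisson a 0 = a 0"
  unfolding poisson_def by (subst suminf_finite[of "{0}"]) auto

text \<open>Thinning: a geometric weight rescales the parameter. As differentiation in s amounts to
  a forward difference of the sequence, a recursion a (m + 1) - a m = k q^m b m becomes a delay
  equation whose right side is evaluated at q s.\<close>

lemma poisson_scale:
  fixes a :: "nat \<Rightarrow> 'a :: {real_normed_field, banach}"
  shows "poisson (\<lambda>m. q ^ m *\<^sub>R a m) s = exp (- ((1 - q) * s)) *\<^sub>R poisson a (q * s)"
proof -
  have "(s ^ m / fact m) *\<^sub>R q ^ m *\<^sub>R a m = ((q * s) ^ m / fact m) *\<^sub>R a m" for m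
    by (simp add: power_mult_distrib mult_ac)
  thus ?thesis by (simp add: poisson_def exp_add[symmetric] algebra_simps)
qed

lemma poisson_mult:
  fixes a :: "nat \<Rightarrow> 'a :: {real_normed_field, banach}"
  assumes "\<And>m. norm (a m) \<le> B"
  shows "poisson (\<lambda>m. c * a m) s = c * poisson a s"
proof -
  have "(\<Sum>m. (s ^ m / fact m) *\<^sub>R (c * a m)) = (\<Sum>m. c * ((s ^ m / fact m) *\<^sub>R a m))"
    by simp
  also have "\<dots> = c * (\<Sum>m. (s ^ m / fact m) *\<^sub>R a m)"
    by (rule suminf_mult[OF poisson_summable'[OF assms]])
  finally show ?thesis by (simp add: poisson_def)
qed

lemma poisson_has_vector_derivative:
  fixes a :: "nat \<Rightarrow> 'a :: {real_normed_field, banach}"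
  assumes B: "\<And>m. norm (a m) \<le> B"
  shows "(poisson a has_vector_derivative poisson (\<lambda>m. a (Suc m) - a m) s) (at s within S)"
proof -
  \<comment> \<open>The series is differentiated as a power series over the field of values and then
    restricted to the real line.\<close>
  define c where "c m = a m / fact m" for m
  have c: "c m * of_real s ^ m = (s ^ m / fact m) *\<^sub>R a m" for m s
    by (simp add: c_def scaleR_conv_of_real)
  have summ: "summable (\<lambda>m. c m * z ^ m)" for z
  proof (rule summable_norm_cancel)
    have "norm (c m * z ^ m) = norm ((norm z ^ m / fact m) *\<^sub>R a m)" for m
      by (simp add: c_def norm_mult norm_divide norm_power)
    thus "summable (\<lambda>m. norm (c m * z ^ m))"
      using poisson_summable[OF B, of "norm z"] by simp
  qed
  have "((\<lambda>z. \<Sum>m. c m * z ^ m) has_field_derivative (\<Sum>m. diffs c m * of_real s ^ m)) (at (of_real s))"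
    by (rule termdiffs_strong_converges_everywhere[OF summ])
  hence "((\<lambda>s. \<Sum>m. c m * of_real s ^ m) has_vector_derivative (\<Sum>m. diffs c m * of_real s ^ m)) (at s within S)"
    by (rule has_vector_derivative_real_field)
  moreover have "diffs c m * of_real s ^ m = (s ^ m / fact m) *\<^sub>R a (Suc m)" for m
    by (simp add: c_def diffs_def scaleR_conv_of_real field_simps del: of_nat_Suc)
  ultimately have d: "((\<lambda>s. \<Sum>m. (s ^ m / fact m) *\<^sub>R a m) has_vector_derivative (\<Sum>m. (s ^ m / fact m) *\<^sub>R a (Suc m))) (at s within S)"
    by (simp add: c)
  have e: "((\<lambda>s. exp (- s)) has_real_derivative - exp (- s)) (at s within S)"
    by (auto intro!: derivative_eq_intros)
  have "((\<lambda>s. exp (- s) *\<^sub>R (\<Sum>m. (s ^ m / fact m) *\<^sub>R a m)) has_vector_derivative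
     exp (- s) *\<^sub>R (\<Sum>m. (s ^ m / fact m) *\<^sub>R a (Suc m)) + (- exp (- s)) *\<^sub>R (\<Sum>m. (s ^ m / fact m) *\<^sub>R a m)) (at s within S)"
    by (rule has_vector_derivative_scaleR[OF e d])
  moreover have "(\<Sum>m. (s ^ m / fact m) *\<^sub>R a (Suc m)) - (\<Sum>m. (s ^ m / fact m) *\<^sub>R a m) = (\<Sum>m. (s ^ m / fact m) *\<^sub>R (a (Suc m) - a m))"
    using suminf_diff[OF poisson_summable'[of "\<lambda>m. a (Suc m)" B s] poisson_summable'[OF B, of s]] B
    by (simp add: scaleR_diff_right)
  ultimately show ?thesis
    unfolding poisson_def[abs_def] by (simp add: scaleR_diff_right[symmetric])
qed

lemma upper_int_const_exp: "a \<ge> 0 \<Longrightarrow> (\<And>t. t \<ge> 0 \<Longrightarrow> f t = c) \<Longrightarrow> upper_int f a = c * exp (- a)"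
  using upper_int_exp[of 0 a f c] by simp

section \<open>Regimes (v), (iv) and (i)\<close>

lemma ground_state_v:
  assumes "\<xi> \<in> {0..<1}"
  shows "ground_state 0 \<xi> (1 - \<xi>) 1 1 1 UNIV (\<lambda>_. 1)"
proof -
  have s: "step_op 0 \<xi> (\<lambda>_. c) x = (1 - \<xi>) * c" for c x :: real
    by (subst step_op_upper) (simp_all add: upper_int_const_exp)
  have "survival 0 \<xi> n = (\<lambda>_. (1 - \<xi>) ^ n)" for n
    by (induction n) (auto simp: s)
  thus ?thesis
    by unfold_locales (use assms s[of 1] in auto)
qed

text \<open>For \<xi> = 0 there is no mass on the negative half line, so the step operator only sees
  the values of f on [0, \<infinity>). Every f that is 1 there is sent to the same function h, and
  the survival probabilities are stationary from n = 1 on.\<close>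

lemma ground_state_iv:
  assumes "\<theta> < 0"
  shows "ground_state \<theta> 0 1 1 1 1 UNIV (h_iv \<theta>)"
proof -
  have m [measurable]: "h_iv \<theta> \<in> borel_measurable borel"
    unfolding h_iv_def by measurable
  have b: "0 \<le> h_iv \<theta> x" "h_iv \<theta> x \<le> 1" for x
    using assms by (auto simp: h_iv_def mult_nonneg_nonpos2 mult_nonpos_nonpos)
  have s: "step_op \<theta> 0 f x = h_iv \<theta> x"
    if f: "f \<in> borel_measurable borel" "\<And>x. 0 \<le> f x" "\<And>x. f x \<le> 1" "\<And>t. t \<ge> 0 \<Longrightarrow> f t = 1" for f x
  proof (cases "x < 0")
    case True
    hence "\<theta> * x \<ge> 0" using assms by (simp add: mult_nonpos_nonpos)
    thus ?thesis using True f by (simp add: step_op_upper upper_int_const_exp h_iv_def)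
  next
    case False
    hence "\<theta> * x \<le> 0" using assms by (simp add: mult_nonpos_nonneg)
    moreover have "\<bar>f x\<bar> \<le> 1" for x using f(2,3)[of x] by simp
    ultimately show ?thesis
      using False f by (subst step_op_lower[of _ 1]) (auto simp: upper_int_const_exp h_iv_def)
  qed
  have S: "survival \<theta> 0 (Suc n) = h_iv \<theta>" for n
  proof (induction n)
    case 0
    show ?case using s[of "\<lambda>_. 1"] by auto
  next
    case (Suc n)
    show ?case unfolding survival.simps(2)[of _ _ "Suc n"] Suc by (intro ext s m b) (simp add: h_iv_def)
  qed
  show ?thesis
  proof unfold_locales
    show "1 * h_iv \<theta> x = step_op \<theta> 0 (h_iv \<theta>) x" for x
      unfolding mult_1 by (rule s[OF m b, symmetric]) (simp add: h_iv_def)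
    have "(\<lambda>n. survival \<theta> 0 (Suc n) x / 1 ^ Suc n) \<longlonglongrightarrow> 1 * h_iv \<theta> x" for x
      unfolding S by simp
    thus "(\<lambda>n. survival \<theta> 0 n x / 1 ^ n) \<longlonglongrightarrow> 1 * h_iv \<theta> x" for x by (rule LIMSEQ_imp_Suc)
    show "survival \<theta> 0 n x \<le> 1 * 1 ^ n" for n x
      using survival_bounds[of 0 \<theta> n x] by simp
  qed (use b in \<open>auto simp: h_iv_def\<close>)
qed

lemma lower_int_abs_le:
  assumes "f \<in> borel_measurable borel" "g \<in> borel_measurable borel" "\<And>x. \<bar>f x\<bar> \<le> K" "\<And>x. \<bar>g x\<bar> \<le> K'"
    "\<And>x. a \<le> x \<Longrightarrow> x \<le> 0 \<Longrightarrow> \<bar>f x\<bar> \<le> g x"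
  shows "\<bar>lower_int f a\<bar> \<le> lower_int g a"
proof -
  have "lower_int f a \<le> lower_int g a"
    using assms by (intro lower_int_mono[of _ _ K K']) (auto simp: abs_le_iff)
  moreover have "lower_int (\<lambda>t. - f t) a \<le> lower_int g a"
    using assms by (intro lower_int_mono[of _ _ K K']) (auto simp: abs_le_iff)
  moreover have "lower_int (\<lambda>t. - f t) a = - lower_int f a"
    by (simp add: lower_int_def set_integral_uminus lower_integrable[OF assms(1,3)])
  ultimately show ?thesis by linarith
qed

lemma lower_int_cmult: "lower_int (\<lambda>t. c * f t) a = c * lower_int f a"
  unfolding lower_int_def by (simp add: mult.assoc)

lemma lower_int_diff:
  assumes "f \<in> borel_measurable borel" "g \<in> borel_measurable borel" "\<And>x. \<bar>f x\<bar> \<le> K" "\<And>x. \<bar>g x\<bar> \<le> K'"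
  shows "lower_int (\<lambda>t. f t - g t) a = lower_int f a - lower_int g a"
  unfolding lower_int_def left_diff_distrib
  using lower_integrable[OF assms(1,3), of a] lower_integrable[OF assms(2,4), of a] by simp

text \<open>On the negative half line the step operator is a Volterra operator; the weight
  \<open>exp (- k * exp (\<theta> * x))\<close> turns it into a contraction while being bounded from above and below.\<close>

lemma lower_int_weight:
  assumes k: "k > 0" and \<theta>: "0 < \<theta>" "\<theta> < 1" and x: "x \<le> 0"
  shows "lower_int (\<lambda>t. exp (- (k * exp (\<theta> * t)))) (\<theta> * x) \<le> exp (- (k * exp (\<theta> * x))) / k"
proof -
  have a: "\<theta> * x \<le> 0" using \<theta> x by (simp add: mult_nonneg_nonpos)
  \<comment> \<open>For t \<le> 0, replacing \<theta> t by t in the inner exponential only enlarges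
    the integrand, and after multiplication by exp t it becomes an exact derivative.\<close>
  have "lower_int (\<lambda>t. exp (- (k * exp (\<theta> * t)))) (\<theta> * x) \<le> lower_int (\<lambda>t. exp (- (k * exp t))) (\<theta> * x)"
  proof (rule lower_int_mono[of _ _ 1 1])
    fix t :: real assume "t \<le> 0"
    hence "\<theta> * t \<ge> t" using \<theta> by (metis mult.commute mult_le_cancel_left1 less_imp_le not_le)
    thus "exp (- (k * exp (\<theta> * t))) \<le> exp (- (k * exp t))" using k by simp
  qed (use k in auto)
  also have "\<dots> = - exp (- (k * exp 0)) / k - (- exp (- (k * exp (\<theta> * x))) / k)"
  proof (rule lower_int_FTC[OF a])
    show "((\<lambda>t. - exp (- (k * exp t)) / k) has_real_derivative exp (- (k * exp t)) * exp t) (at t within {\<theta> * x..0})" for t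
      using k by (auto intro!: derivative_eq_intros)
  qed (intro continuous_intros)
  also have "\<dots> \<le> exp (- (k * exp (\<theta> * x))) / k"
    using k by simp
  finally show ?thesis .
qed

text \<open>On [0, \<infinity>) the limit is explicit. On the negative half line the error v = u - c
  h satisfies v_(n+1) = V v_n + v_(n+1)(0) with V a Volterra operator of weighted norm at most 1/2,
  so it is driven to 0 by its value at 0.\<close>

lemma ground_state_i:
  assumes \<theta>: "0 < \<theta>" "\<theta> < 1" and \<xi>: "\<xi> \<in> {0..<1}" and lam_def: "lam = (1 - \<xi>) * (1 - \<theta>)"
  shows "\<exists>c K K'. ground_state \<theta> \<xi> lam c K K' UNIV (h_i \<theta> \<xi> lam)"
proof -
  have \<xi>': "\<xi> \<in> {0..1}" using \<xi> by simp
  have lam: "lam > 0" using \<theta> \<xi> by (simp add: lam_def)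
  \<comment> \<open>Inserting lam makes the Pochhammer parameter - \<kappa>, so the weights are
    products of 1 + \<kappa> \<theta>^k: they are at least 1, and 1 + t \<le> exp t bounds them by
    B.\<close>
  define \<kappa> where "\<kappa> = \<xi> / (1 - \<xi>)"
  have \<kappa>: "\<kappa> \<ge> 0" using \<xi> by (simp add: \<kappa>_def)
  have \<alpha>: "- \<xi> / lam * (1 - \<theta>) = - \<kappa>"
    using \<theta> \<xi> by (simp add: lam_def \<kappa>_def)
  define a where "a = qpochhammer (- \<kappa>) \<theta>"
  define B where "B = exp (\<kappa> / (1 - \<theta>))"
  have a_Suc: "a (Suc m) - a m = \<kappa> * (\<theta> ^ m *\<^sub>R a m)" for m
    by (simp add: a_def qpochhammer_def algebra_simps)
  have a_ge: "a m \<ge> 1" for m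
    unfolding a_def qpochhammer_def using \<kappa> \<theta> by (intro prod_ge_1) simp
  have a_le: "a m \<le> B" for m
  proof -
    have "a m \<le> (\<Prod>k<m. exp (\<kappa> * \<theta> ^ k))"
      unfolding a_def qpochhammer_def using \<kappa> \<theta> by (intro prod_mono) (auto simp: exp_ge_add_one_self)
    also have "\<dots> = exp (\<kappa> * (\<Sum>k<m. \<theta> ^ k))"
      by (simp add: exp_sum sum_distrib_left)
    also have "(\<Sum>k<m. \<theta> ^ k) = (1 - \<theta> ^ m) / (1 - \<theta>)"
      using \<theta> by (simp add: sum_gp_strict)
    also have "exp (\<kappa> * ((1 - \<theta> ^ m) / (1 - \<theta>))) \<le> B"
      unfolding B_def using \<theta> \<kappa> by (auto simp: divide_right_mono mult_left_le intro!: divide_right_mono)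
    finally show ?thesis .
  qed
  have na: "norm (a m) \<le> B" for m using a_ge[of m] a_le[of m] by simp
  define g where "g x = poisson a (- (\<theta> * x / (1 - \<theta>)))" for x
  let ?h = "h_i \<theta> \<xi> lam"
  have h_neg: "?h x = g x" if "x \<le> 0" for x
    using that unfolding h_i_def \<alpha> g_def poisson_def a_def by simp
  define b where "b = \<theta> / (1 - \<theta>)"
  have h_pos: "?h x = exp (- (b * x))" if "x \<ge> 0" for x
  proof (cases "x = 0")
    case True
    thus ?thesis by (simp add: h_neg g_def) (simp add: a_def qpochhammer_def)
  next
    case False
    moreover have "\<theta> / (\<theta> - 1) = - b" using \<theta> by (simp add: b_def field_simps)
    ultimately show ?thesis using that by (simp add: h_i_def)
  qed
  have b: "b > 0" "1 + b = 1 / (1 - \<theta>)" using \<theta> by (auto simp: b_def field_simps)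
  have g': "(g has_real_derivative - (\<theta> * \<kappa> / (1 - \<theta>)) * exp (\<theta> * x) * g (\<theta> * x)) (at x within S)" for x S
  proof -
    define s where "s = - (\<theta> * x / (1 - \<theta>))"
    have "poisson (\<lambda>m. a (Suc m) - a m) s = \<kappa> * (exp (- ((1 - \<theta>) * s)) *\<^sub>R poisson a (\<theta> * s))"
      unfolding a_Suc poisson_scale[symmetric]
    proof (rule poisson_mult)
      have "\<theta> ^ m * \<bar>a m\<bar> \<le> 1 * B" for m
        using \<theta> na[of m] by (intro mult_mono) (auto simp: power_le_one)
      thus "norm (\<theta> ^ m *\<^sub>R a m) \<le> B" for m using \<theta> by (simp add: abs_mult)
    qed
    also have "(1 - \<theta>) * s = - (\<theta> * x)" using \<theta> by (simp add: s_def)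
    finally have 1: "(poisson a has_real_derivative \<kappa> * (exp (\<theta> * x) * poisson a (\<theta> * s))) (at s)"
      using poisson_has_vector_derivative[of a B s UNIV, OF na] by (simp add: has_real_derivative_iff_has_vector_derivative)
    have "((\<lambda>x. - (\<theta> * x / (1 - \<theta>))) has_real_derivative - (\<theta> / (1 - \<theta>))) (at x within S)"
      using \<theta> by (auto intro!: derivative_eq_intros)
    from DERIV_chain2[OF 1[unfolded s_def] this] show ?thesis
      unfolding g_def s_def by (simp add: mult_ac)
  qed
  have g_cont: "continuous_on S g" for S
    by (rule DERIV_continuous_on[OF g'])
  have [measurable]: "g \<in> borel_measurable borel"
    by (rule borel_measurable_continuous_onI[OF g_cont])
  have "(\<lambda>x. if x \<ge> 0 then exp (- (b * x)) else g x) \<in> borel_measurable borel" by measurable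
  also have "(\<lambda>x. if x \<ge> 0 then exp (- (b * x)) else g x) = ?h"
    using h_pos h_neg by (auto simp: fun_eq_iff)
  finally have h_meas[measurable]: "?h \<in> borel_measurable borel" .
  have B1: "B \<ge> 1" using a_ge[of 0] a_le[of 0] by simp
  have s_nonneg: "- (\<theta> * x / (1 - \<theta>)) \<ge> 0" if "x \<le> 0" for x
    using \<theta> that by (simp add: divide_nonpos_pos mult_nonneg_nonpos)
  have h_gt: "?h x > 0" for x
  proof (cases "x \<ge> 0")
    case False
    have "g x \<ge> 1" unfolding g_def
      by (rule poisson_ge[of _ B]) (use na a_ge s_nonneg False in auto)
    thus ?thesis using False h_neg by simp
  qed (simp add: h_pos)
  have h_le: "?h x \<le> B" for x
  proof (cases "x \<ge> 0")
    case True
    hence "?h x \<le> 1" using b by (simp add: h_pos)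
    thus ?thesis using B1 by simp
  next
    case False
    have "norm (g x) \<le> B" unfolding g_def
      by (rule norm_poisson_le) (use na s_nonneg False in auto)
    thus ?thesis using False h_neg by simp
  qed
  have h_abs: "\<bar>?h x\<bar> \<le> B" for x using h_gt[of x] h_le[of x] by simp
  have eigen_pos: "lam * ?h x = step_op \<theta> \<xi> ?h x" if "x \<ge> 0" for x
  proof -
    have "step_op \<theta> \<xi> ?h x = (1 - \<xi>) * upper_int ?h (\<theta> * x)"
      using \<theta> that by (intro step_op_upper) auto
    also have "upper_int ?h (\<theta> * x) = 1 * exp (- ((1 + b) * (\<theta> * x))) / (1 + b)"
      using b \<theta> that by (intro upper_int_exp) (auto simp: h_pos)
    also have "(1 - \<xi>) * (1 * exp (- ((1 + b) * (\<theta> * x))) / (1 + b)) = lam * exp (- (b * x))"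
      using b \<theta> by (simp add: lam_def b_def mult_ac)
    finally show ?thesis unfolding h_pos[OF that] by (rule sym)
  qed
  have F: "\<xi> * lower_int ?h (\<theta> * x) = lam * ?h x - lam" if x: "x \<le> 0" for x
  proof -
    have le: "\<theta> * x \<le> 0" using \<theta> x by (simp add: mult_nonneg_nonpos)
    \<comment> \<open>Since g'(x) is a multiple of exp (\<theta> x) g(\<theta> x), the
      antiderivative of \<xi> h(t) exp t is - lam g(t / \<theta>); the quotients 0 / \<theta> and
      \<theta> x / \<theta> are its arguments at the end points.\<close>
    have "lower_int (\<lambda>t. \<xi> * ?h t) (\<theta> * x) = - lam * g (0 / \<theta>) - (- lam * g (\<theta> * x / \<theta>))"
    proof (rule lower_int_FTC[OF le])
      show "continuous_on {\<theta> * x..0} (\<lambda>t. \<xi> * ?h t)"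
        by (rule continuous_on_eq[of _ "\<lambda>t. \<xi> * g t"]) (auto intro!: continuous_intros g_cont simp: h_neg)
      fix t :: real assume "t \<le> 0"
      have 1: "((\<lambda>t. t / \<theta>) has_real_derivative 1 / \<theta>) (at t within {\<theta> * x..0})"
        using \<theta> by (auto intro!: derivative_eq_intros)
      have 2: "((\<lambda>t. g (t / \<theta>)) has_real_derivative - (\<theta> * \<kappa> / (1 - \<theta>)) * exp (\<theta> * (t / \<theta>)) * g (\<theta> * (t / \<theta>)) * (1 / \<theta>)) (at t within {\<theta> * x..0})"
        by (rule DERIV_chain2[OF g' 1])
      have "((\<lambda>t. - lam * g (t / \<theta>)) has_real_derivative - lam * (- (\<theta> * \<kappa> / (1 - \<theta>)) * exp (\<theta> * (t / \<theta>)) * g (\<theta> * (t / \<theta>)) * (1 / \<theta>))) (at t within {\<theta> * x..0})"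
        by (rule DERIV_cmult[OF 2])
      moreover have "- lam * (- (\<theta> * \<kappa> / (1 - \<theta>)) * exp (\<theta> * (t / \<theta>)) * g (\<theta> * (t / \<theta>)) * (1 / \<theta>)) = \<xi> * ?h t * exp t"
        using \<theta> \<xi> h_neg[OF \<open>t \<le> 0\<close>] by (simp add: lam_def \<kappa>_def)
      ultimately show "((\<lambda>t. - lam * g (t / \<theta>)) has_real_derivative \<xi> * ?h t * exp t) (at t within {\<theta> * x..0})" by simp
    qed
    moreover have "g 0 = 1" using h_pos[of 0] h_neg[of 0] by simp
    ultimately show ?thesis using \<theta> h_neg[OF x] by (simp add: lower_int_cmult)
  qed
  have eigen: "lam * ?h x = step_op \<theta> \<xi> ?h x" for x
  proof (cases "x \<ge> 0")
    case False
    have "(1 - \<xi>) * upper_int ?h 0 = lam"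
      using eigen_pos[of 0] step_op_upper[of \<theta> 0 \<xi> ?h] h_pos[of 0] by simp
    thus ?thesis using False \<theta> F[of x] by (subst step_op_lower[OF h_meas h_abs]) (auto simp: mult_nonneg_nonpos)
  qed (rule eigen_pos)

  obtain C where C: "C > 0" "qpochhammer \<theta> \<theta> \<longlonglongrightarrow> C"
    using qpochhammer_tendsto_pos[OF \<theta>] .
  define c where "c = 1 / C"
  have c: "c > 0" using C by (simp add: c_def)
  define u where "u n x = survival \<theta> \<xi> n x / lam ^ n" for n x
  have qp: "(1 - \<theta>) ^ n * qfact \<theta> n = qpochhammer \<theta> \<theta> n" for n
  proof (induction n)
    case (Suc n)
    have "(1 - \<theta>) ^ Suc n * qfact \<theta> (Suc n) = qpochhammer \<theta> \<theta> n * ((1 - \<theta>) * qnumber \<theta> (Suc n))"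
      using \<theta> by (simp add: qfact_Suc Suc[symmetric])
    also have "(1 - \<theta>) * qnumber \<theta> (Suc n) = 1 - \<theta> * \<theta> ^ n"
      using \<theta> by (simp add: qnumber_def)
    finally show ?case by (simp add: qpochhammer_def)
  qed (simp add: qpochhammer_def)
  have u_pos: "u n x = exp (- (qexponent \<theta> n * x)) / qpochhammer \<theta> \<theta> n" if "x \<ge> 0" for n x
    using \<theta> \<xi> that
    by (simp add: u_def survival_upper qp[symmetric] lam_def power_mult_distrib)
  have u_lim: "(\<lambda>n. u n x) \<longlonglongrightarrow> c * ?h x" if "x \<ge> 0" for x
  proof -
    have "(\<lambda>n. \<theta> * ((1 - \<theta> ^ n) / (1 - \<theta>))) \<longlonglongrightarrow> \<theta> * ((1 - 0) / (1 - \<theta>))"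
      using \<theta> by (intro tendsto_intros LIMSEQ_realpow_zero) auto
    hence "(\<lambda>n. qexponent \<theta> n) \<longlonglongrightarrow> b" by (simp add: qexponent_def b_def)
    hence "(\<lambda>n. exp (- (qexponent \<theta> n * x)) / qpochhammer \<theta> \<theta> n) \<longlonglongrightarrow> exp (- (b * x)) / C"
      using C by (intro tendsto_intros) auto
    thus ?thesis using that by (simp add: u_pos h_pos c_def)
  qed
  have u_bnd: "0 \<le> u n x" "u n x \<le> 1 / lam ^ n" for n x
    using survival_bounds[OF \<xi>', of \<theta> n x] lam by (auto simp: u_def divide_right_mono)
  have u_meas[measurable]: "u n \<in> borel_measurable borel" for n
    unfolding u_def[abs_def] by measurable
  define v where "v n x = u n x - c * ?h x" for n x
  have v_meas[measurable]: "v n \<in> borel_measurable borel" for n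
    unfolding v_def[abs_def] by measurable
  have u_abs: "\<bar>u n x\<bar> \<le> 1 / lam ^ n" for n x using u_bnd[of n x] by simp
  have ch_abs: "\<bar>c * ?h x\<bar> \<le> c * B" for x using h_abs[of x] c by (simp add: abs_mult)
  have v_abs: "\<bar>v n x\<bar> \<le> 1 / lam ^ n + c * B" for n x
    using u_abs[of n x] ch_abs[of x] unfolding v_def by linarith
  \<comment> \<open>The positive half line enters the step operator at x \<le> 0 only through a
    constant, which is the value of the new function at 0.\<close>
  have v_rec: "v (Suc n) x = \<xi> / lam * lower_int (v n) (\<theta> * x) + v (Suc n) 0" if x: "x \<le> 0" for n x
  proof -
    have le: "\<theta> * x \<le> 0" using \<theta> x by (simp add: mult_nonneg_nonpos)
    have sa: "\<bar>survival \<theta> \<xi> n x\<bar> \<le> 1" for x using survival_bounds[OF \<xi>', of \<theta> n x] by simp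
    have "lam * u (Suc n) x = step_op \<theta> \<xi> (survival \<theta> \<xi> n) x / lam ^ n"
      using lam by (simp add: u_def)
    also have "step_op \<theta> \<xi> (survival \<theta> \<xi> n) x = \<xi> * lower_int (survival \<theta> \<xi> n) (\<theta> * x) + survival \<theta> \<xi> (Suc n) 0"
      by (subst step_op_lower[OF survival_measurable sa le]) (simp add: step_op_upper)
    also have "\<dots> / lam ^ n = \<xi> * lower_int (u n) (\<theta> * x) + lam * u (Suc n) 0"
      using lam lower_int_cmult[of "1 / lam ^ n" "survival \<theta> \<xi> n" "\<theta> * x"] by (simp add: u_def[abs_def] add_divide_distrib del: survival.simps)
    finally have "u (Suc n) x = \<xi> / lam * lower_int (u n) (\<theta> * x) + u (Suc n) 0"
      using lam by (simp add: field_simps)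
    moreover have "?h x = \<xi> / lam * lower_int ?h (\<theta> * x) + ?h 0"
      using F[OF x] lam h_pos[of 0] by (simp add: field_simps)
    moreover have "lower_int (v n) (\<theta> * x) = lower_int (u n) (\<theta> * x) - c * lower_int ?h (\<theta> * x)"
      unfolding v_def[abs_def] lower_int_cmult[symmetric]
      by (rule lower_int_diff[OF _ _ u_abs ch_abs]) measurable
    moreover have "v (Suc n) x = u (Suc n) x - c * ?h x" "v (Suc n) 0 = u (Suc n) 0 - c * ?h 0"
      by (simp_all only: v_def)
    moreover have "U = k * L + U0 \<Longrightarrow> H = k * L' + H0 \<Longrightarrow> LV = L - c * L' \<Longrightarrow> V = U - c * H \<Longrightarrow> V0 = U0 - c * H0 \<Longrightarrow> V = k * LV + V0"
      for U H L L' LV V V0 U0 H0 k :: real by hypsubst (simp add: algebra_simps)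
    ultimately show ?thesis by blast
  qed
  \<comment> \<open>Chosen so that (\<xi> / lam) / k \<le> 1/2, where 1 / k is the gain from the
    weight; the summand 1 keeps k positive when \<xi> = 0.\<close>
  define k where "k = 2 * (\<xi> / lam) + 1"
  have k: "k > 0" "\<xi> / lam / k \<le> 1 / 2"
  proof -
    have "\<xi> / lam \<ge> 0" using lam \<xi> by auto
    thus "k > 0" by (simp add: k_def)
    have "z \<le> 1 / 2 * (2 * z + 1)" for z :: real by simp
    hence "\<xi> / lam \<le> 1 / 2 * k" unfolding k_def .
    thus "\<xi> / lam / k \<le> 1 / 2" using \<open>k > 0\<close> by (simp only: pos_divide_le_eq)
  qed
  define W where "W x = exp (- (k * exp (\<theta> * x)))" for x
  have [measurable]: "W \<in> borel_measurable borel" unfolding W_def[abs_def] by measurable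
  have W1: "W x > 0" "W x \<le> 1" for x using k by (auto simp: W_def)
  have W2: "W x \<ge> exp (- k)" if "x \<le> 0" for x
  proof -
    have "\<theta> * x \<le> 0" using \<theta> that by (simp add: mult_nonneg_nonpos)
    thus ?thesis using k by (simp add: W_def)
  qed
  have contr: "\<bar>v (Suc n) x\<bar> \<le> \<beta> * W x / 2 + \<bar>v (Suc n) 0\<bar>"
    if x: "x \<le> 0" and v: "\<And>x. x \<le> 0 \<Longrightarrow> \<bar>v n x\<bar> \<le> \<beta> * W x" for n x \<beta>
  proof -
    have "0 \<le> \<beta> * W 0" using v[of 0] by linarith
    hence \<beta>: "\<beta> \<ge> 0" using W1(1)[of 0] by (simp add: zero_le_mult_iff)
    have "\<bar>\<beta> * W x\<bar> \<le> \<beta>" for x using \<beta> W1[of x] by (simp add: abs_mult mult_left_le)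
    hence "\<bar>lower_int (v n) (\<theta> * x)\<bar> \<le> lower_int (\<lambda>t. \<beta> * W t) (\<theta> * x)"
      by (intro lower_int_abs_le[where K' = \<beta>, OF _ _ v_abs] v) auto
    also have "\<dots> \<le> \<beta> * (W x / k)"
      unfolding lower_int_cmult W_def using \<beta> lower_int_weight[OF k(1) \<theta> x] by (rule mult_left_mono[rotated])
    finally have "\<xi> / lam * \<bar>lower_int (v n) (\<theta> * x)\<bar> \<le> \<xi> / lam * (\<beta> * (W x / k))"
      using lam \<xi> by (intro mult_left_mono) auto
    also have "\<dots> = (\<xi> / lam / k) * (\<beta> * W x)" by simp
    also have "\<dots> \<le> 1 / 2 * (\<beta> * W x)"
      using k \<beta> W1[of x] by (intro mult_right_mono) auto
    also have "\<dots> = \<beta> * W x / 2" by simp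
    finally have "\<xi> / lam * \<bar>lower_int (v n) (\<theta> * x)\<bar> \<le> \<beta> * W x / 2" .
    moreover have "\<bar>\<xi> / lam * lower_int (v n) (\<theta> * x)\<bar> = \<xi> / lam * \<bar>lower_int (v n) (\<theta> * x)\<bar>"
      using lam \<xi> by (subst abs_mult) simp
    ultimately show ?thesis
      unfolding v_rec[OF x] using abs_triangle_ineq[of "\<xi> / lam * lower_int (v n) (\<theta> * x)" "v (Suc n) 0"] by linarith
  qed
  have v0: "(\<lambda>n. v n 0) \<longlonglongrightarrow> 0"
    unfolding v_def using tendsto_diff[OF u_lim[of 0] tendsto_const[of "c * ?h 0"]] by simp
  then obtain E where E: "E > 0" "\<And>n. \<bar>v n 0\<bar> \<le> E"
    using Bseq_def[of "\<lambda>n. v n 0"] convergent_imp_Bseq[OF convergentI[OF v0]] by auto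
  \<comment> \<open>D exp (- k) is at least the initial bound 1 + c B and at least 2 E. As exp (- k)
    bounds the weight from below, the estimate D W / 2 + E \<le> D W propagates the bound.\<close>
  define D where "D = (1 + c * B + 2 * E) * exp k"
  have cB: "c * B > 0" using c B1 by simp
  have D: "D * exp (- k) = 1 + c * B + 2 * E" by (simp add: D_def exp_minus)
  have D0: "D > 0" using cB E by (simp add: D_def)
  have vD: "\<forall>x\<le>0. \<bar>v n x\<bar> \<le> D * W x" for n
  proof (induction n)
    case 0
    have "\<bar>v 0 x\<bar> \<le> D * exp (- k)" for x using v_abs[of 0 x] E unfolding D by simp
    moreover have "D * exp (- k) \<le> D * W x" if "x \<le> 0" for x
      using W2[OF that] D0 by (intro mult_left_mono) auto
    ultimately show ?case using order.trans by blast
  next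
    case (Suc n)
    show ?case
    proof (intro allI impI)
      fix x :: real assume x: "x \<le> 0"
      have "D * exp (- k) \<le> D * W x"
        using W2[OF x] D0 by (intro mult_left_mono) auto
      hence "2 * E \<le> D * W x" using D cB by linarith
      thus "\<bar>v (Suc n) x\<bar> \<le> D * W x"
        using contr[OF x, of n D] Suc E(2)[of "Suc n"] by simp
    qed
  qed
  \<comment> \<open>3/4 = 1/2 + 1/4: the contraction gives 1/2, and eventually the value at 0 is
    below a quarter of the current bound.\<close>
  have vj: "\<exists>N. \<forall>n\<ge>N. \<forall>x\<le>0. \<bar>v n x\<bar> \<le> D * (3 / 4) ^ j * W x" for j
  proof (induction j)
    case 0
    show ?case using vD by auto
  next
    case (Suc j)
    then obtain N where N: "\<And>n x. n \<ge> N \<Longrightarrow> x \<le> 0 \<Longrightarrow> \<bar>v n x\<bar> \<le> D * (3 / 4) ^ j * W x" by blast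
    define \<beta> where "\<beta> = D * (3 / 4) ^ j"
    have \<beta>: "\<beta> > 0" using D0 by (simp add: \<beta>_def)
    have "eventually (\<lambda>n. \<bar>v n 0\<bar> < \<beta> * exp (- k) / 4) sequentially"
      using tendsto_rabs[OF v0] \<beta> by (intro order_tendstoD) auto
    then obtain N' where N': "\<And>n. n \<ge> N' \<Longrightarrow> \<bar>v n 0\<bar> < \<beta> * exp (- k) / 4"
      by (auto simp: eventually_sequentially)
    show ?case
    proof (intro exI[of _ "Suc (max N N')"] allI impI)
      fix n and x :: real assume n: "n \<ge> Suc (max N N')" and x: "x \<le> 0"
      then obtain n' where n': "n = Suc n'" "n' \<ge> N" "n \<ge> N'" by (cases n) auto
      have "\<bar>v n x\<bar> \<le> \<beta> * W x / 2 + \<bar>v n 0\<bar>"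
        unfolding n'(1) using N[OF n'(2)] by (intro contr[OF x]) (simp add: \<beta>_def)
      moreover have "\<beta> * exp (- k) \<le> \<beta> * W x" using W2[OF x] \<beta> by (intro mult_left_mono) auto
      ultimately show "\<bar>v n x\<bar> \<le> D * (3 / 4) ^ Suc j * W x"
        using N'[OF n'(3)] by (simp add: \<beta>_def)
    qed
  qed
  have lim_neg: "(\<lambda>n. v n x) \<longlonglongrightarrow> 0" if x: "x \<le> 0" for x
  proof (rule LIMSEQ_I)
    fix r :: real assume "r > 0"
    have "(\<lambda>j. D * (3 / 4 :: real) ^ j) \<longlonglongrightarrow> D * 0"
      by (intro tendsto_intros LIMSEQ_realpow_zero) auto
    hence "eventually (\<lambda>j. D * (3 / 4 :: real) ^ j < r) sequentially"
      using \<open>r > 0\<close> by (intro order_tendstoD) auto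
    then obtain j where j: "D * (3 / 4 :: real) ^ j < r" by (auto simp: eventually_sequentially)
    obtain N where N: "\<And>n x. n \<ge> N \<Longrightarrow> x \<le> 0 \<Longrightarrow> \<bar>v n x\<bar> \<le> D * (3 / 4) ^ j * W x"
      using vj by blast
    have "D * (3 / 4) ^ j * W x \<le> D * (3 / 4) ^ j"
      using D0 W1[of x] by (intro mult_left_le) auto
    with N[OF _ x] j show "\<exists>no. \<forall>n\<ge>no. norm (v n x - 0) < r"
      by (intro exI[of _ N]) (auto intro: le_less_trans order.trans)
  qed
  have u_lim': "(\<lambda>n. u n x) \<longlonglongrightarrow> c * ?h x" for x
  proof (cases "x \<ge> 0")
    case False
    thus ?thesis using lim_neg[of x] unfolding v_def LIM_zero_iff by simp
  qed (rule u_lim)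
  obtain E' where E': "E' > 0" "\<And>n. \<bar>1 / qpochhammer \<theta> \<theta> n\<bar> \<le> E'"
  proof -
    have "(\<lambda>n. 1 / qpochhammer \<theta> \<theta> n) \<longlonglongrightarrow> 1 / C" using C by (intro tendsto_intros) auto
    thus ?thesis
      using that Bseq_def[of "\<lambda>n. 1 / qpochhammer \<theta> \<theta> n"] convergent_imp_Bseq[OF convergentI] by (metis real_norm_def)
  qed
  have u_le: "u n x \<le> E' + (D + c * B)" for n x
  proof (cases "x \<ge> 0")
    case True
    have "exp (- (qexponent \<theta> n * x)) * \<bar>1 / qpochhammer \<theta> \<theta> n\<bar> \<le> 1 * E'"
      using True \<theta> E' qexponent_nonneg[of \<theta> n] by (intro mult_mono) auto
    moreover have "u n x \<le> exp (- (qexponent \<theta> n * x)) * \<bar>1 / qpochhammer \<theta> \<theta> n\<bar>"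
    proof -
      have "u n x = exp (- (qexponent \<theta> n * x)) * (1 / qpochhammer \<theta> \<theta> n)"
        by (simp add: u_pos[OF True])
      also have "\<dots> \<le> exp (- (qexponent \<theta> n * x)) * \<bar>1 / qpochhammer \<theta> \<theta> n\<bar>"
        by (intro mult_left_mono abs_ge_self) simp
      finally show ?thesis .
    qed
    ultimately show ?thesis using D0 cB by linarith
  next
    case False
    have "\<bar>v n x\<bar> \<le> D * W x" using vD False by auto
    also have "D * W x \<le> D" using D0 W1[of x] by (intro mult_left_le) auto
    finally have "v n x \<le> D" by linarith
    moreover have "c * ?h x \<le> c * B" using h_le c by (intro mult_left_mono) auto
    ultimately show ?thesis using E' unfolding v_def by linarith
  qed
  have "ground_state \<theta> \<xi> lam c B (E' + (D + c * B)) UNIV ?h"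
  proof unfold_locales
    show "survival \<theta> \<xi> n x \<le> (E' + (D + c * B)) * lam ^ n" for n x
      using u_le[of n x] lam by (simp add: u_def pos_divide_le_eq)
    show "(\<lambda>n. survival \<theta> \<xi> n x / lam ^ n) \<longlonglongrightarrow> c * ?h x" for x
      using u_lim'[of x] by (simp add: u_def)
  qed (use \<xi>' lam h_gt h_le eigen c less_imp_le[OF h_gt] in auto)
  thus ?thesis by blast
qed

section \<open>Regime (ii)\<close>

text \<open>For q > 1 one has [n + 1] \<ge> n + 1, so the ratio of successive terms tends to
  0.\<close>

lemma qexp_summable:
  fixes x :: real
  assumes q: "q > 1"
  shows "summable (\<lambda>j. x ^ j / qfact q j)"
proof (cases "x = 0")
  case True
  have "(\<lambda>j. (0::real) ^ j / qfact q j) = (\<lambda>j. if j = 0 then 1 else 0)" by (auto simp: power_0_left)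
  thus ?thesis using True by simp
next
  case False
  have lim: "filterlim (\<lambda>n. qnumber q (Suc n)) at_top sequentially"
  proof (rule filterlim_at_top_mono)
    show "filterlim (\<lambda>n. real (Suc n)) at_top sequentially"
      by (rule filterlim_compose[OF filterlim_real_sequentially filterlim_Suc])
    show "eventually (\<lambda>n. real (Suc n) \<le> qnumber q (Suc n)) sequentially"
    proof (intro always_eventually allI)
      fix n
      have "qnumber q (Suc n) = (\<Sum>i<Suc n. q ^ i)"
        using q by (simp add: qnumber_def sum_gp_strict del: sum.lessThan_Suc)
      also have "\<dots> \<ge> (\<Sum>i<Suc n. 1)" using q by (intro sum_mono one_le_power) auto
      finally show "real (Suc n) \<le> qnumber q (Suc n)" by simp
    qed
  qed
  hence "eventually (\<lambda>n. qnumber q (Suc n) \<ge> 2 * \<bar>x\<bar>) sequentially"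
    by (simp add: filterlim_at_top)
  then obtain N where N: "\<And>n. n \<ge> N \<Longrightarrow> qnumber q (Suc n) \<ge> 2 * \<bar>x\<bar>"
    by (auto simp: eventually_sequentially)
  show ?thesis
  proof (rule summable_ratio_test[of "1/2" N])
    fix n assume "n \<ge> N"
    from N[OF this] have "\<bar>x\<bar> / qnumber q (Suc n) \<le> 1 / 2"
      using qnumber_pos[of q n] q by (simp add: field_simps)
    hence "\<bar>x\<bar> / qnumber q (Suc n) * (\<bar>x\<bar> ^ n / qfact q n) \<le> 1 / 2 * (\<bar>x\<bar> ^ n / qfact q n)"
      using qfact_pos[of q n] q by (intro mult_right_mono) auto
    thus "norm (x ^ Suc n / qfact q (Suc n)) \<le> 1 / 2 * norm (x ^ n / qfact q n)"
      using qfact_pos[of q n] qnumber_pos[of q n] q by (simp add: qfact_Suc abs_mult power_abs mult_ac)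
  qed simp
qed

text \<open>The \<open>q\<close>-exponential \<open>\<Sum> (- \<xi> z)^j / [j]!\<close> and the series \<open>\<Sum> (lam z)^j / (p; p)_j\<close>, with \<open>p = 1 / \<theta>\<close>,
  are inverse to each other: the substitution of \<open>\<theta> z\<close> for \<open>z\<close> leaves the product invariant.\<close>

lemma qexp_inverse_convolution:
  fixes \<theta> \<xi> :: real
  assumes \<theta>: "\<theta> > 1" and lam: "lam = (1 - 1 / \<theta>) * \<xi>" and n: "n > 0"
  defines "e \<equiv> (\<lambda>j. (- \<xi>) ^ j / qfact \<theta> j)" and "r \<equiv> (\<lambda>j. lam ^ j / qpochhammer (1 / \<theta>) (1 / \<theta>) j)"
  shows "(\<Sum>j\<le>n. e j * r (n - j)) = 0"
proof -
  define p where "p = 1 / \<theta>"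
  have p: "0 < p" "p < 1" "p * \<theta> = 1" using \<theta> by (auto simp: p_def)
  have qp: "qpochhammer p p j > 0" for j
    unfolding qpochhammer_def
  proof (intro prod_pos)
    fix i show "0 < 1 - p * p ^ i" using p power_less_one_iff[of p "Suc i"] by simp
  qed
  define E where "E = Abs_fps e"
  define R where "R = Abs_fps r"
  \<comment> \<open>The substitution of \<theta> z for z in a formal power series.\<close>
  define sc where "sc f = Abs_fps (\<lambda>n. \<theta> ^ n * fps_nth f n)" for f :: "real fps"
  have sc_mult: "sc (f * g) = sc f * sc g" for f g
  proof (rule fps_ext)
    fix n
    have "fps_nth (sc f * sc g) n = (\<Sum>i=0..n. (\<theta> ^ i * \<theta> ^ (n - i)) * (fps_nth f i * fps_nth g (n - i)))"
      by (simp add: sc_def fps_mult_nth mult_ac)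
    also have "\<dots> = (\<Sum>i=0..n. \<theta> ^ n * (fps_nth f i * fps_nth g (n - i)))"
      by (intro sum.cong) (auto simp: power_add[symmetric])
    finally show "fps_nth (sc (f * g)) n = fps_nth (sc f * sc g) n"
      by (simp add: sc_def fps_mult_nth sum_distrib_left)
  qed
  \<comment> \<open>t = \<theta> lam. The two recursions below are the coefficient forms of
    E(\<theta> z) = (1 - t z) E(z) and (1 - t z) R(\<theta> z) = R(z).\<close>
  define t where "t = (\<theta> - 1) * \<xi>"
  have e_Suc: "\<theta> ^ Suc j * e (Suc j) = e (Suc j) - t * e j" for j
  proof -
    have q: "qnumber \<theta> (Suc j) > 0" "qfact \<theta> j > 0" using \<theta> by (auto intro: qnumber_pos qfact_pos)
    have "(\<theta> ^ Suc j - 1) * e (Suc j) = (\<theta> - 1) * (qnumber \<theta> (Suc j) * e (Suc j))"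
      using \<theta> by (simp add: qnumber_def field_simps)
    also have "qnumber \<theta> (Suc j) * e (Suc j) = - \<xi> * e j"
      using q \<theta> by (simp add: e_def qfact_Suc)
    finally show ?thesis by (simp add: t_def algebra_simps)
  qed
  have r_Suc: "\<theta> ^ Suc j * r (Suc j) - r (Suc j) = t * (\<theta> ^ j * r j)" for j
  proof -
    have "(\<theta> ^ Suc j - 1) * r (Suc j) = \<theta> ^ Suc j * ((1 - p ^ Suc j) * r (Suc j))"
      using p \<theta> by (simp add: p_def algebra_simps power_divide)
    also have "(1 - p ^ Suc j) * r (Suc j) = lam * r j"
    proof -
      have "1 - p ^ Suc j \<noteq> 0" using p power_less_one_iff[of p "Suc j"] by simp
      moreover have "qpochhammer p p (Suc j) = qpochhammer p p j * (1 - p ^ Suc j)"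
        by (simp add: qpochhammer_def)
      ultimately show ?thesis using qp[of j] by (simp add: r_def p_def[symmetric] del: power_Suc) simp
    qed
    also have "\<theta> ^ Suc j * (lam * r j) = t * (\<theta> ^ j * r j)"
      using \<theta> by (simp add: lam t_def field_simps)
    finally show ?thesis by (simp add: algebra_simps)
  qed
  have scE: "sc E = (1 - fps_const t * fps_X) * E"
  proof (rule fps_ext)
    fix n show "fps_nth (sc E) n = fps_nth ((1 - fps_const t * fps_X) * E) n"
      using e_Suc[of "n - 1"] by (cases n) (auto simp: sc_def E_def algebra_simps simp del: power_Suc)
  qed
  have scR: "(1 - fps_const t * fps_X) * sc R = R"
  proof (rule fps_ext)
    fix n show "fps_nth ((1 - fps_const t * fps_X) * sc R) n = fps_nth R n"
      using r_Suc[of "n - 1"] by (cases n) (auto simp: sc_def R_def algebra_simps simp del: power_Suc)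
  qed
  have "sc (E * R) = E * R"
    unfolding sc_mult scE mult.commute[of _ E] mult.assoc scR ..
  hence "\<theta> ^ n * fps_nth (E * R) n = fps_nth (E * R) n"
    by (metis fps_nth_Abs_fps sc_def)
  moreover have "\<theta> ^ n \<noteq> 1" using \<theta> n by (metis less_irrefl one_less_power)
  ultimately have "fps_nth (E * R) n = 0" by simp
  thus ?thesis by (simp add: E_def R_def fps_mult_nth atLeast0AtMost)
qed

text \<open>All exponents except b_0 = 0 are positive, so only the zeroth term survives; Tannery's
  theorem permits the termwise limit.\<close>

lemma exp_series_at_bot:
  fixes d :: "nat \<Rightarrow> real"
  assumes q: "q > 0" "q \<noteq> 1" and d: "summable (\<lambda>n. \<bar>d n\<bar>)"
  shows "((\<lambda>y. \<Sum>n. d n * exp (qexponent q n * y)) \<longlongrightarrow> d 0) at_bot"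
proof -
  have b: "\<bar>d n * exp (qexponent q n * y)\<bar> \<le> \<bar>d n\<bar>" if "y \<le> 0" for n y
    using qexponent_nonneg[OF q, of n] that by (simp add: abs_mult mult_left_le mult_nonneg_nonpos)
  have "((\<lambda>y. \<Sum>n. d n * exp (qexponent q n * y)) \<longlongrightarrow> (\<Sum>n. if n = 0 then d 0 else 0)) at_bot"
  proof (rule conjunct2[OF conjunct2[OF tannerys_theorem]])
    fix n
    show "((\<lambda>y. d n * exp (qexponent q n * y)) \<longlongrightarrow> (if n = 0 then d 0 else 0)) at_bot"
    proof (cases n)
      case (Suc i)
      have "1 + qexponent q i > 0" using qexponent_nonneg[OF q, of i] by simp
      hence "qexponent q n > 0" unfolding Suc using q by (simp add: qexponent_Suc)
      hence "((\<lambda>y. exp (qexponent q n * y)) \<longlongrightarrow> 0) at_bot"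
        by (intro filterlim_compose[OF exp_at_bot] filterlim_tendsto_pos_mult_at_bot[OF tendsto_const] filterlim_ident)
      from tendsto_mult_left[OF this, of "d n"] show ?thesis using Suc by simp
    qed simp
  next
    have "\<forall>\<^sub>F y in at_bot. \<forall>n. norm (d n * exp (qexponent q n * y)) \<le> \<bar>d n\<bar>"
      using eventually_le_at_bot[of 0] by eventually_elim (use b in simp)
    thus "\<forall>\<^sub>F (n, y) in sequentially \<times>\<^sub>F at_bot. norm (d n * exp (qexponent q n * y)) \<le> \<bar>d n\<bar>"
      unfolding eventually_prod_filter
      by (intro exI[of _ "\<lambda>_. True"] exI[of _ "\<lambda>y. \<forall>n. norm (d n * exp (qexponent q n * y)) \<le> \<bar>d n\<bar>"]) auto
  qed (use d in auto)
  moreover have "(\<Sum>n. if n = 0 then d 0 else 0) = d 0"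
    by (subst suminf_finite[of "{0}"]) auto
  ultimately show ?thesis by simp
qed

text \<open>Padded with zeros, the finite sums become series dominated by |a k| times a bound for b,
  and Tannery's theorem applies.\<close>

lemma convolution_tendsto:
  fixes a b :: "nat \<Rightarrow> real"
  assumes a: "summable (\<lambda>k. \<bar>a k\<bar>)" and b: "b \<longlonglongrightarrow> L"
  shows "(\<lambda>n. \<Sum>k\<le>n. a k * b (n - k)) \<longlonglongrightarrow> (\<Sum>k. a k) * L"
proof -
  obtain E where E: "\<And>n. \<bar>b n\<bar> \<le> E"
    using convergent_imp_Bseq[OF convergentI[OF b]] by (auto simp: Bseq_def)
  define t where "t k n = (if k \<le> n then a k * b (n - k) else 0)" for k n
  have "((\<lambda>n. \<Sum>k. t k n) \<longlonglongrightarrow> (\<Sum>k. a k * L))"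
  proof (rule conjunct2[OF conjunct2[OF tannerys_theorem]])
    fix k
    have "(\<lambda>n. a k * b n) \<longlonglongrightarrow> a k * L" by (intro tendsto_intros b)
    hence "(\<lambda>n. t k (n + k)) \<longlonglongrightarrow> a k * L" by (simp add: t_def)
    thus "t k \<longlonglongrightarrow> a k * L" by (rule LIMSEQ_offset)
  next
    have "\<bar>t k n\<bar> \<le> \<bar>a k\<bar> * E" for k n
      using E[of 0] E[of "n - k"] by (auto simp: t_def abs_mult intro!: mult_left_mono)
    thus "\<forall>\<^sub>F (k, n) in sequentially \<times>\<^sub>F sequentially. norm (t k n) \<le> \<bar>a k\<bar> * E"
      by (intro always_eventually) auto
  qed (use a in \<open>auto intro: summable_mult2\<close>)
  moreover have "(\<Sum>k. t k n) = (\<Sum>k\<le>n. a k * b (n - k))" for n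
    by (subst suminf_finite[of "{..n}"]) (auto simp: t_def)
  moreover have "(\<Sum>k. a k * L) = (\<Sum>k. a k) * L"
    by (rule suminf_mult2[symmetric, OF summable_rabs_cancel[OF a]])
  ultimately show ?thesis by simp
qed

text \<open>The asymptotics comes first and everything else follows from it: measurability, the
  bound, nonnegativity and the eigenvalue equation of h are inherited from the normalised survival
  probabilities. Only strict positivity needs an argument of its own.\<close>

lemma ground_state_ii:
  assumes \<theta>: "\<theta> > 1" and \<xi>: "\<xi> \<in> {0<..1}" and lam_def: "lam = (1 - 1 / \<theta>) * \<xi>"
  shows "\<exists>c K K'. ground_state \<theta> \<xi> lam c K K' {..<0} (h_ii \<theta> \<xi> lam)"
proof -
  have \<xi>': "\<xi> \<in> {0..1}" using \<xi> by simp
  have lam: "lam > 0" using \<theta> \<xi> by (simp add: lam_def)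
  define p where "p = 1 / \<theta>"
  have p: "0 < p" "p < 1" using \<theta> by (auto simp: p_def)
  define e where "e j = (- \<xi>) ^ j / qfact \<theta> j" for j
  define r where "r j = lam ^ j / qpochhammer p p j" for j
  define f where "f j = (1 - \<xi>) ^ j / qfact \<theta> j" for j
  \<comment> \<open>s n is the limit of T^n 1 at - infinity; its generating function is the product
    of those of f and r, the latter being the inverse of that of e.\<close>
  define s where "s n = (\<Sum>k\<le>n. f k * r (n - k))" for n
  have ER: "Abs_fps e * Abs_fps r = 1"
  proof (rule fps_ext)
    fix n show "fps_nth (Abs_fps e * Abs_fps r) n = fps_nth 1 n"
    proof (cases "n = 0")
      case False
      thus ?thesis
        using qexp_inverse_convolution[OF \<theta> lam_def, of n]
        by (simp add: fps_mult_nth atLeast0AtMost e_def r_def p_def)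
    qed (simp add: e_def r_def qpochhammer_def)
  qed
  \<comment> \<open>The matching condition at 0: the exponential sum valid for x \<le> 0 and the
    single exponential valid for x \<ge> 0 agree there.\<close>
  have conv: "(\<Sum>j\<le>n. e j * s (n - j)) = f n" for n
  proof -
    have "Abs_fps s = Abs_fps f * Abs_fps r"
      by (rule fps_ext) (simp add: s_def fps_mult_nth atLeast0AtMost)
    hence "Abs_fps e * Abs_fps s = Abs_fps f * (Abs_fps e * Abs_fps r)" by (simp add: mult_ac)
    hence "fps_nth (Abs_fps e * Abs_fps s) n = fps_nth (Abs_fps f) n" by (simp add: ER)
    thus ?thesis by (simp add: fps_mult_nth atLeast0AtMost)
  qed
  let ?b = "qexponent \<theta>"
  have b1: "1 + ?b j > 0" for j using qexponent_nonneg[of \<theta> j] \<theta> by simp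
  \<comment> \<open>Integration divides by 1 + b_j and raises the exponent to b_(j+1); by this
    identity the coefficients e are simply shifted by one index.\<close>
  have e_Suc: "\<xi> * e j / (1 + ?b j) = - e (Suc j)" for j
    using \<theta> by (simp add: e_def one_plus_qexponent qfact_Suc)
  have surv_pos: "survival \<theta> \<xi> n x = f n * exp (- (?b n * x))" if "x \<ge> 0" for n x
    using that \<theta> by (simp add: survival_upper f_def)
  have surv_neg: "survival \<theta> \<xi> n x = (\<Sum>j\<le>n. e j * s (n - j) * exp (?b j * x))" if "x \<le> 0" for n x
    using that
  proof (induction n arbitrary: x)
    case 0
    show ?case by (simp add: e_def s_def f_def r_def qpochhammer_def)
  next
    case (Suc n)
    have le: "\<theta> * x \<le> 0" using \<theta> Suc.prems by (simp add: mult_nonneg_nonpos)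
    have sa: "\<bar>survival \<theta> \<xi> n x\<bar> \<le> 1" for x using survival_bounds[OF \<xi>', of \<theta> n x] by simp
    define F where "F t = (\<Sum>j\<le>n. e j * s (n - j) * (exp ((1 + ?b j) * t) / (1 + ?b j)))" for t
    have li: "lower_int (survival \<theta> \<xi> n) (\<theta> * x) = F 0 - F (\<theta> * x)"
    proof (rule lower_int_FTC[OF le])
      show "continuous_on {\<theta> * x..0} (survival \<theta> \<xi> n)"
        by (rule continuous_on_eq[of _ "\<lambda>x. \<Sum>j\<le>n. e j * s (n - j) * exp (?b j * x)"])
           (auto intro!: continuous_intros simp: Suc.IH)
      fix t :: real assume t: "t \<le> 0"
      have "(F has_real_derivative (\<Sum>j\<le>n. e j * s (n - j) * exp ((1 + ?b j) * t))) (at t within {\<theta> * x..0})"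
        unfolding F_def using b1[THEN less_imp_neq] by (auto intro!: derivative_eq_intros sum.cong)
      moreover have "(\<Sum>j\<le>n. e j * s (n - j) * exp ((1 + ?b j) * t)) = survival \<theta> \<xi> n t * exp t"
        unfolding Suc.IH[OF t] sum_distrib_right
        by (intro sum.cong) (auto simp: exp_add[symmetric] algebra_simps)
      ultimately show "(F has_real_derivative survival \<theta> \<xi> n t * exp t) (at t within {\<theta> * x..0})" by simp
    qed
    have "\<xi> * (F 0 - F (\<theta> * x)) = (\<Sum>j\<le>n. (\<xi> * e j / (1 + ?b j)) * s (n - j) * (1 - exp (?b (Suc j) * x)))"
      unfolding F_def sum_subtractf[symmetric] sum_distrib_left
      using \<theta> by (intro sum.cong) (auto simp: qexponent_Suc algebra_simps diff_divide_distrib)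
    also have "\<dots> = (\<Sum>j\<le>n. e (Suc j) * s (n - j) * exp (?b (Suc j) * x)) - (\<Sum>j\<le>n. e (Suc j) * s (n - j))"
      unfolding e_Suc sum_subtractf[symmetric] by (intro sum.cong) (auto simp: algebra_simps)
    finally have 1: "\<xi> * lower_int (survival \<theta> \<xi> n) (\<theta> * x) = \<dots>" unfolding li .
    have "(1 - \<xi>) * upper_int (survival \<theta> \<xi> n) 0 = survival \<theta> \<xi> (Suc n) 0"
      using step_op_upper[of \<theta> 0 \<xi> "survival \<theta> \<xi> n"] by simp
    also have "\<dots> = f (Suc n)" using surv_pos[of 0 "Suc n"] by simp
    also have "\<dots> = e 0 * s (Suc n) + (\<Sum>j\<le>n. e (Suc j) * s (n - j))"
      unfolding conv[symmetric] by (subst sum.atMost_Suc_shift) simp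
    finally have 2: "(1 - \<xi>) * upper_int (survival \<theta> \<xi> n) 0 = \<dots>" .
    have "survival \<theta> \<xi> (Suc n) x = \<xi> * lower_int (survival \<theta> \<xi> n) (\<theta> * x) + (1 - \<xi>) * upper_int (survival \<theta> \<xi> n) 0"
      by (simp add: step_op_lower[OF survival_measurable sa le])
    also have "\<dots> = e 0 * s (Suc n) + (\<Sum>j\<le>n. e (Suc j) * s (n - j) * exp (?b (Suc j) * x))"
      unfolding 1 2 by simp
    also have "\<dots> = (\<Sum>j\<le>Suc n. e j * s (Suc n - j) * exp (?b j * x))"
      by (subst sum.atMost_Suc_shift) simp
    finally show ?case .
  qed
  obtain C where C: "C > 0" "qpochhammer p p \<longlonglongrightarrow> C"
    using qpochhammer_tendsto_pos[OF p] .
  define c where "c = 1 / C"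
  have c: "c > 0" using C by (simp add: c_def)
  let ?h = "h_ii \<theta> \<xi> lam"
  define u where "u n x = survival \<theta> \<xi> n x / lam ^ n" for n x
  have abs_summ: "summable (\<lambda>j. \<bar>x ^ j / qfact \<theta> j\<bar>)" for x
    using qexp_summable[OF \<theta>, of "\<bar>x\<bar>"] qfact_pos[of \<theta>] \<theta> by (simp add: power_abs abs_of_pos)
  define Sn where "Sn n = s n / lam ^ n" for n
  have Sn: "Sn n = (\<Sum>k\<le>n. ((1 - \<xi>) / lam) ^ k / qfact \<theta> k * (1 / qpochhammer p p (n - k)))" for n
    unfolding Sn_def s_def sum_divide_distrib
  proof (intro sum.cong refl)
    fix k assume "k \<in> {..n}"
    hence "lam ^ n = lam ^ k * lam ^ (n - k)" by (simp add: power_add[symmetric])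
    thus "f k * r (n - k) / lam ^ n = ((1 - \<xi>) / lam) ^ k / qfact \<theta> k * (1 / qpochhammer p p (n - k))"
      using lam by (simp add: f_def r_def power_divide)
  qed
  have e_q: "e_q \<theta> z = (\<Sum>n. z ^ n / qfact \<theta> n)" for z :: real
    using \<theta> by (simp add: e_q_def)
  have Sn_lim: "Sn \<longlonglongrightarrow> e_q \<theta> ((1 - \<xi>) / lam) * (1 / C)"
    unfolding Sn[abs_def] e_q using C by (intro convolution_tendsto abs_summ tendsto_intros) auto
  define a where "a x j = (- \<xi> / lam) ^ j / qfact \<theta> j * exp (?b j * x)" for x j
  have a_le: "\<bar>a x j\<bar> \<le> \<bar>(- \<xi> / lam) ^ j / qfact \<theta> j\<bar>" if "x \<le> 0" for x j
    using that qexponent_nonneg[of \<theta> j] \<theta> unfolding a_def abs_mult by (intro mult_left_le) (auto simp: mult_nonneg_nonpos)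
  have a_summ: "summable (\<lambda>j. \<bar>a x j\<bar>)" if "x \<le> 0" for x
    by (rule summable_comparison_test'[OF abs_summ]) (use a_le[OF that] in auto)
  have u_neg: "u n x = (\<Sum>j\<le>n. a x j * Sn (n - j))" if "x \<le> 0" for n x
    unfolding u_def surv_neg[OF that] sum_divide_distrib
  proof (intro sum.cong refl)
    fix k assume "k \<in> {..n}"
    hence "lam ^ n = lam ^ k * lam ^ (n - k)" by (simp add: power_add[symmetric])
    thus "e k * s (n - k) * exp (?b k * x) / lam ^ n = a x k * Sn (n - k)"
      unfolding a_def power_divide[of "- \<xi>" lam k] using lam by (simp add: e_def Sn_def mult_ac)
  qed
  have h_neg: "?h x = e_q \<theta> ((1 - \<xi>) / lam) * (\<Sum>j. a x j)" if "x \<le> 0" for x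
    using that by (simp add: h_ii_def a_def qexponent_def)
  have f_summ: "summable (\<lambda>n. f n / lam ^ n)"
    using qexp_summable[OF \<theta>, of "(1 - \<xi>) / lam"] by (simp add: f_def power_divide mult_ac)
  have u_lim: "(\<lambda>n. u n x) \<longlonglongrightarrow> c * ?h x" for x
  proof (cases "x \<le> 0")
    case True
    have "(\<lambda>n. \<Sum>j\<le>n. a x j * Sn (n - j)) \<longlonglongrightarrow> (\<Sum>j. a x j) * (e_q \<theta> ((1 - \<xi>) / lam) * (1 / C))"
      by (intro convolution_tendsto a_summ True Sn_lim)
    thus ?thesis using True by (simp add: u_neg h_neg c_def mult_ac)
  next
    case False
    have "u n x = f n / lam ^ n * exp (- (?b n * x))" for n
      using False by (simp add: u_def surv_pos)
    moreover have "(\<lambda>n. f n / lam ^ n * exp (- (?b n * x))) \<longlonglongrightarrow> 0"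
    proof (rule Lim_null_comparison[OF _ summable_LIMSEQ_zero[OF f_summ]])
      have "exp (- (?b n * x)) \<le> 1" for n using False qexponent_nonneg[of \<theta> n] \<theta> by simp
      moreover have "0 \<le> f n / lam ^ n" for n
        using \<xi> lam qfact_pos[of \<theta> n] \<theta> by (simp add: f_def)
      ultimately have "\<bar>f n / lam ^ n * exp (- (?b n * x))\<bar> \<le> f n / lam ^ n" for n
        by (subst abs_of_nonneg) (auto intro: mult_left_le simp del: times_divide_eq_left)
      thus "\<forall>\<^sub>F n in sequentially. norm (f n / lam ^ n * exp (- (?b n * x))) \<le> f n / lam ^ n"
        by (intro always_eventually allI) (simp only: real_norm_def)
    qed
    ultimately show ?thesis using False by (simp add: h_ii_def)
  qed
  have u_bnd: "0 \<le> u n x" for n x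
    using survival_bounds[OF \<xi>', of \<theta> n x] lam by (auto simp: u_def)
  obtain E1 where E1: "E1 > 0" "\<And>n. \<bar>Sn n\<bar> \<le> E1"
    using convergent_imp_Bseq[OF convergentI[OF Sn_lim]] by (auto simp: Bseq_def)
  obtain E2 where E2: "E2 > 0" "\<And>n. \<bar>f n / lam ^ n\<bar> \<le> E2"
    using convergent_imp_Bseq[OF convergentI[OF summable_LIMSEQ_zero[OF f_summ]]] unfolding Bseq_def real_norm_def by blast
  define M where "M = (\<Sum>j. \<bar>(- \<xi> / lam) ^ j / qfact \<theta> j\<bar>)"
  have M: "M \<ge> 0" unfolding M_def by (intro suminf_nonneg abs_summ) auto
  have u_le: "u n x \<le> M * E1 + E2" for n x
  proof (cases "x \<le> 0")
    case True
    have "u n x \<le> (\<Sum>j\<le>n. \<bar>(- \<xi> / lam) ^ j / qfact \<theta> j\<bar> * E1)"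
      unfolding u_neg[OF True]
    proof (rule sum_mono)
      fix j assume "j \<in> {..n}"
      have "a x j * Sn (n - j) \<le> \<bar>a x j\<bar> * \<bar>Sn (n - j)\<bar>" by (metis abs_ge_self abs_mult)
      also have "\<dots> \<le> \<bar>(- \<xi> / lam) ^ j / qfact \<theta> j\<bar> * E1"
        using a_le[OF True] E1 by (intro mult_mono) auto
      finally show "a x j * Sn (n - j) \<le> \<bar>(- \<xi> / lam) ^ j / qfact \<theta> j\<bar> * E1" .
    qed
    also have "\<dots> \<le> M * E1"
      unfolding M_def sum_distrib_right[symmetric] using E1 abs_summ by (intro mult_right_mono sum_le_suminf) auto
    finally show ?thesis using E2 by linarith
  next
    case False
    have "u n x = f n / lam ^ n * exp (- (?b n * x))"
      using False by (simp add: u_def surv_pos)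
    also have "\<dots> \<le> E2 * 1"
      using False E2 qexponent_nonneg[of \<theta> n] \<theta> abs_le_D1[OF E2(2)[of n]] by (intro mult_mono) auto
    finally show ?thesis using M E1 by (metis add.commute add_increasing2 less_imp_le mult.right_neutral mult_nonneg_nonneg)
  qed
  define D where "D = M * E1 + E2"
  have u_meas[measurable]: "u n \<in> borel_measurable borel" for n
    unfolding u_def[abs_def] by measurable
  have ch_meas: "(\<lambda>x. c * ?h x) \<in> borel_measurable borel"
    by (rule borel_measurable_LIMSEQ_real[OF u_lim u_meas])
  have h_meas[measurable]: "?h \<in> borel_measurable borel"
    using borel_measurable_divide[OF ch_meas, of "\<lambda>_. c"] c by simp
  have h_nonneg: "0 \<le> ?h x" for x
  proof -
    have "0 \<le> c * ?h x" by (rule LIMSEQ_le_const[OF u_lim]) (use u_bnd in auto)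
    thus ?thesis using c by (simp add: zero_le_mult_iff)
  qed
  have h_le: "?h x \<le> D / c" for x
  proof -
    have "c * ?h x \<le> D" by (rule LIMSEQ_le_const2[OF u_lim]) (use u_le in \<open>auto simp: D_def\<close>)
    thus ?thesis using c by (simp add: field_simps)
  qed
  have h_abs: "\<bar>?h x\<bar> \<le> D / c" for x using h_nonneg[of x] h_le[of x] by simp
  have eigen: "lam * ?h x = step_op \<theta> \<xi> ?h x" for x
  proof -
    have "(\<lambda>n. step_op \<theta> \<xi> (u n) x) \<longlonglongrightarrow> step_op \<theta> \<xi> (\<lambda>x. c * ?h x) x"
    proof (rule step_op_tendsto)
      show "\<bar>u n x\<bar> \<le> D" for n x using u_bnd[of n x] u_le[of n x] by (simp add: D_def)
    qed (use u_lim in auto)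
    moreover have "step_op \<theta> \<xi> (u n) x = lam * u (Suc n) x" for n
      using step_op_cmult[of \<theta> \<xi> "1 / lam ^ n" "survival \<theta> \<xi> n" x] lam by (simp add: u_def[abs_def])
    moreover have "(\<lambda>n. lam * u (Suc n) x) \<longlonglongrightarrow> lam * (c * ?h x)"
      by (intro tendsto_intros LIMSEQ_Suc u_lim)
    ultimately have "lam * (c * ?h x) = c * step_op \<theta> \<xi> ?h x"
      by (simp add: step_op_cmult LIMSEQ_unique)
    thus ?thesis using c by simp
  qed
  \<comment> \<open>f n / lam^n is a null sequence, being the term of a convergent series; through
    the asymptotics this evaluates the series for h at 0.\<close>
  have h0: "?h 0 = 0"
  proof -
    have "(\<lambda>n. u n 0) \<longlonglongrightarrow> 0"
      using summable_LIMSEQ_zero[OF f_summ] by (simp add: u_def surv_pos)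
    from LIMSEQ_unique[OF u_lim[of 0] this] show ?thesis using c by simp
  qed
  \<comment> \<open>A zero at x < 0 makes the integral of h over [\<theta> x, 0] vanish, since the
    contribution of the positive half line is lam h(0) = 0. This yields a zero further left, and
    iteration contradicts the positive limit of h at - infinity.\<close>
  have h_pos: "?h x > 0" if x: "x < 0" for x
  proof (rule ccontr)
    assume "\<not> ?h x > 0"
    hence hx: "?h x = 0" using h_nonneg[of x] by simp
    \<comment> \<open>Vanishing almost everywhere only gives a zero in a set of positive measure;
      any \<mu> strictly between 1 and \<theta> leaves the interval [\<theta> x, \<mu> x] for it and
      still pushes the zeros to - infinity.\<close>
    define \<mu> where "\<mu> = (1 + \<theta>) / 2"
    have \<mu>: "1 < \<mu>" "\<mu> < \<theta>" using \<theta> by (auto simp: \<mu>_def)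
    have step: "\<exists>t\<le>\<mu> * x. ?h t = 0" if x: "x < 0" and hx: "?h x = 0" for x
    proof (rule ccontr)
      assume "\<not> ?thesis"
      hence nz: "?h t \<noteq> 0" if "t \<le> \<mu> * x" for t using that by blast
      have le: "\<theta> * x \<le> 0" using \<theta> x by (simp add: mult_nonneg_nonpos)
      have "(1 - \<xi>) * upper_int ?h 0 = 0"
        using eigen[of 0] by (subst (asm) step_op_upper) (simp_all add: h0)
      hence "\<xi> * lower_int ?h (\<theta> * x) = 0"
        using eigen[of x] step_op_lower[OF h_meas h_abs le, of \<xi>] unfolding hx by linarith
      hence "lower_int ?h (\<theta> * x) = 0" using \<xi> by simp
      hence "(\<integral>t. indicator {\<theta> * x..0} t *\<^sub>R (?h t * exp t) \<partial>lborel) = 0"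
        by (simp add: lower_int_def set_lebesgue_integral_def)
      moreover have "integrable lborel (\<lambda>t. indicator {\<theta> * x..0} t *\<^sub>R (?h t * exp t))"
        using lower_integrable[OF h_meas h_abs] by (simp add: set_integrable_def)
      ultimately have "AE t in lborel. indicator {\<theta> * x..0} t *\<^sub>R (?h t * exp t) = 0"
        using h_nonneg by (subst (asm) integral_nonneg_eq_0_iff_AE) auto
      hence "AE t in lborel. t \<notin> {\<theta> * x..\<mu> * x}"
      proof eventually_elim
        case (elim t)
        have "\<mu> * x \<le> 0" using \<mu> x by (simp add: mult_nonneg_nonpos)
        thus ?case using elim nz[of t] by (auto simp: indicator_def split: if_splits)
      qed
      hence "{\<theta> * x..\<mu> * x} \<in> null_sets lborel" by (subst AE_iff_null_sets) auto
      hence "emeasure lborel {\<theta> * x..\<mu> * x} = 0" by auto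
      moreover have "\<theta> * x < \<mu> * x" using \<mu> x by simp
      ultimately show False using \<mu> x by simp
    qed
    have iter: "\<exists>t\<le>\<mu> ^ k * x. ?h t = 0" for k
    proof (induction k)
      case (Suc k)
      then obtain t where t: "t \<le> \<mu> ^ k * x" "?h t = 0" by blast
      have "\<mu> ^ k * x < 0" using \<mu> x by (simp add: mult_pos_neg)
      with step[of t] t obtain t' where t': "t' \<le> \<mu> * t" "?h t' = 0" by auto
      have "\<mu> * t \<le> \<mu> * (\<mu> ^ k * x)" using t \<mu> by (intro mult_left_mono) auto
      thus ?case using t' by (intro exI[of _ t']) (auto simp: mult_ac)
    qed (use hx in auto)
    have "((\<lambda>x. \<Sum>j. a x j) \<longlongrightarrow> 1) at_bot"
    proof -
      have "((\<lambda>x. \<Sum>j. a x j) \<longlongrightarrow> (- \<xi> / lam) ^ 0 / qfact \<theta> 0) at_bot"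
        unfolding a_def using \<theta> by (intro exp_series_at_bot abs_summ) auto
      thus ?thesis by simp
    qed
    hence "\<forall>\<^sub>F x in at_bot. (\<Sum>j. a x j) > 0"
      by (rule order_tendstoD) simp
    then obtain L where L: "\<And>x. x \<le> L \<Longrightarrow> (\<Sum>j. a x j) > 0"
      by (auto simp: eventually_at_bot_linorder)
    have eq1: "e_q \<theta> ((1 - \<xi>) / lam) \<ge> 1"
    proof -
      have "(\<Sum>n<1. ((1 - \<xi>) / lam) ^ n / qfact \<theta> n) \<le> (\<Sum>n. ((1 - \<xi>) / lam) ^ n / qfact \<theta> n)"
        using \<xi> lam qfact_pos[of \<theta>] \<theta> by (intro sum_le_suminf qexp_summable) (auto intro!: divide_nonneg_pos zero_le_power)
      thus ?thesis by (simp add: e_q)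
    qed
    obtain k where k: "min L 0 / x < \<mu> ^ k"
      using real_arch_pow[OF \<mu>(1)] by blast
    obtain t where t: "t \<le> \<mu> ^ k * x" "?h t = 0" using iter by blast
    have "\<mu> ^ k * x < min L 0" using k x by (simp add: divide_less_eq)
    hence "t \<le> L" "t \<le> 0" using t by auto
    hence "?h t > 0" using L[of t] eq1 by (simp add: h_neg)
    thus False using t by simp
  qed
  have "ground_state \<theta> \<xi> lam c (D / c) D {..<0} ?h"
  proof unfold_locales
    show "survival \<theta> \<xi> n x \<le> D * lam ^ n" for n x
      using u_le[of n x] lam by (simp add: u_def D_def pos_divide_le_eq)
    show "(\<lambda>n. survival \<theta> \<xi> n x / lam ^ n) \<longlonglongrightarrow> c * ?h x" for x
      using u_lim[of x] by (simp add: u_def)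
    show "?h x = 0" if "x \<notin> {..<0}" "x \<noteq> 0" for x
      using that by (simp add: h_ii_def)
  qed (use \<xi>' lam h_nonneg h_le eigen c h_pos in auto)
  thus ?thesis by blast
qed

section \<open>Regime (iii): the spectral gap\<close>

text \<open>The minorisation. From x \<ge> 0 every positive state is reachable, so T f is at least L
  f = (1 - \<xi>) \<open>upper_int f 0\<close> there. From x < 0 a survivor must jump beyond q |x|,
  so one step sees f only far out; but it lands on the positive half line, with probability (1 -
  \<xi>) exp (q x), and a second step then gives the full L f.\<close>

lemma step_op_step_op_ge:
  assumes q: "q > 0" and \<xi>: "\<xi> \<in> {0..1}" and [measurable]: "f \<in> borel_measurable borel"
    and f: "\<And>x. 0 \<le> f x" "\<And>x. f x \<le> K"
  shows "step_op (- q) \<xi> (step_op (- q) \<xi> f) x \<ge> (1 - \<xi>) * (if x \<ge> 0 then 1 else exp (q * x)) * ((1 - \<xi>) * upper_int f 0)"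
proof -
  let ?T = "step_op (- q) \<xi>"
  let ?L = "\<lambda>f. (1 - \<xi>) * upper_int f 0"
  have abs: "\<bar>f x\<bar> \<le> K" for x using f[of x] by simp
  have Tf: "0 \<le> ?T f x" "?T f x \<le> K" for x using step_op_bounds[OF \<xi> _ f] by auto
  have Tabs: "\<bar>?T f x\<bar> \<le> K" for x using Tf[of x] by simp
  have low0: "lower_int g a \<ge> 0" if "\<And>t. 0 \<le> g t" for g a
    unfolding lower_int_def set_lebesgue_integral_def using that by (intro integral_nonneg_AE) auto
  have T_ge: "?T g x \<ge> ?L g" if x: "x \<ge> 0" and g: "g \<in> borel_measurable borel" "\<And>t. 0 \<le> g t" "\<And>x. \<bar>g x\<bar> \<le> K" for g x
  proof -
    have "- q * x \<le> 0" using q x by (simp add: mult_nonneg_nonneg)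
    thus ?thesis using low0[where a = "- q * x", OF g(2)] \<xi> by (simp add: step_op_lower[OF g(1,3)])
  qed
  have L0: "?L f \<ge> 0"
    unfolding upper_int_def set_lebesgue_integral_def using f \<xi> by (intro mult_nonneg_nonneg integral_nonneg_AE) auto
  have upper: "upper_int (?T f) a \<ge> ?L f * exp (- a)" if "a \<ge> 0" for a
  proof -
    have "?L f * exp (- a) = upper_int (\<lambda>_. ?L f) a" using that by (rule upper_int_const_exp[symmetric]) simp
    also have "\<dots> \<le> upper_int (?T f) a"
      using that by (intro upper_int_mono[where K = "?L f", OF _ _ _ Tabs] T_ge) (use f abs L0 in auto)
    finally show ?thesis .
  qed
  show ?thesis
  proof (cases "x \<ge> 0")
    case True
    have "?T (?T f) x \<ge> ?L (?T f)"
      using True by (intro T_ge) (use Tf Tabs in auto)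
    moreover have "(1 - \<xi>) * ?L f \<le> ?L (?T f)"
      using upper[of 0] \<xi> by (intro mult_left_mono) auto
    ultimately show ?thesis using True by simp
  next
    case False
    hence a: "0 \<le> - q * x" using q by (simp add: mult_nonneg_nonpos)
    have "(1 - \<xi>) * (?L f * exp (- (- q * x))) \<le> (1 - \<xi>) * upper_int (?T f) (- q * x)"
      using upper[OF a] \<xi> by (intro mult_left_mono) auto
    thus ?thesis using False by (simp add: step_op_upper[OF a] mult_ac)
  qed
qed

text \<open>The functions in question are only differentiable within {..c}; at interior points this
  is the full derivative, and the mean value theorem needs no more.\<close>

lemma nondecreasing_of_deriv_nonneg:
  fixes f f' :: "real \<Rightarrow> real"
  assumes f: "\<And>y. y \<le> c \<Longrightarrow> (f has_real_derivative f' y) (at y within {..c})"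
    and f': "\<And>y. y \<le> c \<Longrightarrow> f' y \<ge> 0" and "a \<le> b" "b \<le> c"
  shows "f a \<le> f b"
proof (cases "a = b")
  case False
  hence ab: "a < b" using \<open>a \<le> b\<close> by simp
  have cont: "continuous_on {a..b} f"
    by (rule continuous_on_subset[OF DERIV_continuous_on[of "{..c}", OF f]]) (use \<open>b \<le> c\<close> in auto)
  have D: "(f has_real_derivative f' x) (at x)" if "a < x" "x < b" for x
  proof -
    have x: "x < c" using that \<open>b \<le> c\<close> by simp
    hence "at x within {..c} = at x" by (intro at_within_interior) simp
    thus ?thesis using f[OF less_imp_le[OF x]] by (simp only:)
  qed
  obtain l x where x: "a < x" "x < b" "(f has_real_derivative l) (at x)" "f b - f a = (b - a) * l"
    using MVT[OF ab cont] D unfolding real_differentiable_def by metis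
  have "l = f' x" by (rule DERIV_unique[OF x(3) D[OF x(1,2)]])
  hence "l \<ge> 0" using f'[of x] x(2) \<open>b \<le> c\<close> by simp
  hence "(b - a) * l \<ge> 0" using ab by simp
  thus ?thesis using x(4) by simp
qed simp

text \<open>Two steps of the chain dominate a fixed multiple of \<open>h\<close>, so the oscillation of
  \<open>survival / (lam^n h)\<close> contracts geometrically.\<close>

lemma ground_state_of_delay_equations:
  fixes C S h :: "real \<Rightarrow> real"
  assumes q: "q > 0" and \<xi>: "\<xi> \<in> {0<..<1}" and z: "z > 0"
    and C': "\<And>y. y \<le> 0 \<Longrightarrow> (C has_real_derivative - (q * z * exp (q * y) * S (q * y))) (at y within {..0})"
    and S': "\<And>y. y \<le> 0 \<Longrightarrow> (S has_real_derivative q * z * exp (q * y) * C (q * y)) (at y within {..0})"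
    and S_lim: "(S \<longlongrightarrow> 0) at_bot" and C_le: "\<And>y. y \<le> 0 \<Longrightarrow> C y \<le> B"
    and C_pos: "\<And>y. y \<le> 0 \<Longrightarrow> C y > 0"
    and S0: "S 0 = sqrt (\<xi> / (1 - \<xi>)) * C 0"
    and lam_def: "lam = sqrt (\<xi> * (1 - \<xi>)) / z"
    and h_def: "h = (\<lambda>x. if x > 0 then C (- x) else sqrt (1 - \<xi>) / sqrt \<xi> * S x)"
  shows "\<exists>c K K'. ground_state (- q) \<xi> lam c K K' UNIV h"
proof -
  have \<xi>': "\<xi> \<in> {0..1}" using \<xi> by simp
  define r where "r = sqrt \<xi> / sqrt (1 - \<xi>)"
  have r: "r > 0" "sqrt (1 - \<xi>) / sqrt \<xi> = 1 / r" "sqrt (\<xi> / (1 - \<xi>)) = r"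
    using \<xi> by (auto simp: r_def real_sqrt_divide)
  have lam: "lam > 0" using \<xi> z by (simp add: lam_def)
  \<comment> \<open>The factors by which the delay equation for C and the one for S enter the
    eigenvalue equation; the choice of lam makes them equal.\<close>
  have lamr: "\<xi> / (r * z) = lam" "(1 - \<xi>) * r / z = lam"
  proof -
    define a b where "a = sqrt \<xi>" and "b = sqrt (1 - \<xi>)"
    have ab: "a > 0" "b > 0" "\<xi> = a * a" "1 - \<xi> = b * b" using \<xi> by (auto simp: a_def b_def)
    have lam': "lam = a * b / z" by (simp add: lam_def real_sqrt_mult a_def b_def)
    have r': "r = a / b" by (simp add: r_def a_def b_def)
    show "\<xi> / (r * z) = lam" unfolding lam' r' ab(3) using ab(1,2) z by simp
    show "(1 - \<xi>) * r / z = lam" unfolding lam' r' ab(4) using ab(1,2) z by simp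
  qed
  let ?T = "step_op (- q) \<xi>"
  have S_mono: "S a \<le> S b" if "a \<le> b" "b \<le> 0" for a b
  proof (rule nondecreasing_of_deriv_nonneg[OF S' _ that])
    show "q * z * exp (q * y) * C (q * y) \<ge> 0" if "y \<le> 0" for y
      using q z that C_pos[of "q * y"] by (auto simp: mult_nonneg_nonpos intro!: mult_nonneg_nonneg less_imp_le)
  qed
  have S_nonneg: "S y \<ge> 0" if "y \<le> 0" for y
  proof (rule tendsto_upperbound[OF S_lim])
    show "\<forall>\<^sub>F x in at_bot. S x \<le> S y"
      using eventually_le_at_bot[of y] by eventually_elim (use S_mono that in auto)
  qed simp
  have C_anti: "C b \<le> C a" if "a \<le> b" "b \<le> 0" for a b
  proof -
    have "- C a \<le> - C b"
    proof (rule nondecreasing_of_deriv_nonneg[OF _ _ that])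
      show "((\<lambda>y. - C y) has_real_derivative q * z * exp (q * y) * S (q * y)) (at y within {..0})" if "y \<le> 0" for y
        using DERIV_minus[OF C'[OF that]] by simp
      show "q * z * exp (q * y) * S (q * y) \<ge> 0" if "y \<le> 0" for y
        using q z that by (auto simp: mult_nonneg_nonpos intro!: mult_nonneg_nonneg S_nonneg)
    qed
    thus ?thesis by simp
  qed
  have C_cont: "continuous_on {..0} C" by (rule DERIV_continuous_on[OF C']) auto
  have S_cont: "continuous_on {..0} S" by (rule DERIV_continuous_on[OF S']) auto
  have h_pos: "h x = C (- x)" if "x \<ge> 0" for x
    using that r S0 by (cases "x = 0") (auto simp: h_def)
  have h_neg: "h x = S x / r" if "x \<le> 0" for x
    using that r by (simp add: h_def)
  have h_meas[measurable]: "h \<in> borel_measurable borel"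
  proof -
    have "continuous_on {..0} h"
      by (rule continuous_on_eq[of _ "\<lambda>x. S x / r"]) (use r S_cont h_neg in \<open>auto intro!: continuous_intros\<close>)
    moreover have "continuous_on {0..} h"
      by (rule continuous_on_eq[of _ "\<lambda>x. C (- x)"])
         (use h_pos in \<open>auto intro!: continuous_on_compose2[OF C_cont] continuous_intros\<close>)
    ultimately have "continuous_on ({..0} \<union> {0..}) h" by (intro continuous_on_closed_Un) auto
    moreover have "{..0} \<union> {0..} = (UNIV :: real set)" by auto
    ultimately show ?thesis by (simp add: borel_measurable_continuous_onI)
  qed
  define K where "K = max B (S 0 / r)"
  have h_nonneg: "h x \<ge> 0" for x
    using h_pos[of x] h_neg[of x] C_pos[of "- x"] S_nonneg[of x] r by (cases "x \<ge> 0") auto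
  have h_le: "h x \<le> K" for x
  proof (cases "x \<ge> 0")
    case True
    thus ?thesis using C_le[of "- x"] by (simp add: h_pos K_def)
  next
    case False
    hence "S x / r \<le> S 0 / r" using S_mono[of x 0] r by (simp add: divide_right_mono)
    thus ?thesis using False by (simp add: h_neg K_def)
  qed
  have h_abs: "\<bar>h x\<bar> \<le> K" for x using h_nonneg[of x] h_le[of x] by simp
  have upper: "upper_int h a = S (- (a / q)) / z" if a: "a \<ge> 0" for a
  proof -
    \<comment> \<open>The delay equation at y = - t / q: the derivative of S there contains exp (-
      t) C(- t), which is the integrand.\<close>
    define F where "F t = - (S (- (t / q)) / z)" for t
    have "upper_int h a = 0 - F a"
    proof (rule upper_int_FTC[OF h_meas h_abs])
      show "h t = C (- t)" if "t > a" for t using that a by (simp add: h_pos)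
      show "continuous_on {a..} (\<lambda>t. C (- t))"
        by (rule continuous_on_compose2[OF C_cont]) (use a in \<open>auto intro!: continuous_intros\<close>)
      show "(F \<longlongrightarrow> 0) at_top"
      proof -
        have "filterlim (\<lambda>t. 1 / q * t) at_top at_top"
          using q by (intro filterlim_tendsto_pos_mult_at_top[OF tendsto_const] filterlim_ident) auto
        hence "filterlim (\<lambda>t. - (t / q)) at_bot at_top"
          by (simp add: filterlim_uminus_at_top)
        hence "((\<lambda>t. S (- (t / q))) \<longlongrightarrow> 0) at_top"
          by (rule filterlim_compose[OF S_lim])
        from tendsto_minus[OF tendsto_divide[OF this tendsto_const[of z]]] show ?thesis
          unfolding F_def using z by simp
      qed
      fix t assume t: "a \<le> t"
      have t': "- (t / q) \<le> 0" using a t q by simp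
      have 1: "((\<lambda>t. - (t / q)) has_real_derivative - (1 / q)) (at t within {a..})"
        using q by (auto intro!: derivative_eq_intros)
      have "(\<lambda>t. - (t / q)) ` {a..} \<subseteq> {..0}" using a q by auto
      from DERIV_image_chain[OF DERIV_subset[OF S'[OF t'] this] 1]
      have "((\<lambda>t. S (- (t / q))) has_real_derivative q * z * exp (q * - (t / q)) * C (q * - (t / q)) * - (1 / q)) (at t within {a..})"
        by (simp add: o_def mult_ac)
      from DERIV_minus[OF DERIV_cdivide[OF this, of z]]
      show "(F has_real_derivative C (- t) * exp (- t)) (at t within {a..})"
        unfolding F_def using q z by (simp add: mult_ac)
    qed
    thus ?thesis by (simp add: F_def)
  qed
  have lower: "lower_int h (- q * x) = (C (- x) - C 0) / (r * z)" if x: "x \<ge> 0" for x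
  proof -
    \<comment> \<open>The delay equation at y = t / q: the derivative of C there contains exp t
      S(t).\<close>
    define F where "F t = - (C (t / q) / (r * z))" for t
    have le: "- q * x \<le> 0" using q x by (simp add: mult_nonneg_nonneg)
    have "lower_int h (- q * x) = F 0 - F (- q * x)"
    proof (rule lower_int_FTC[OF le])
      show "continuous_on {- q * x..0} h"
        by (rule continuous_on_eq[of _ "\<lambda>x. S x / r"])
           (use r h_neg in \<open>auto intro!: continuous_intros continuous_on_subset[OF S_cont]\<close>)
      fix t :: real assume t: "t \<le> 0"
      have t': "t / q \<le> 0" using t q by (simp add: divide_nonpos_pos)
      have 1: "((\<lambda>t. t / q) has_real_derivative (1 / q)) (at t within {- q * x..0})"
        using q by (auto intro!: derivative_eq_intros)
      have "(\<lambda>t. t / q) ` {- q * x..0} \<subseteq> {..0}" using q by (auto simp: divide_nonpos_pos)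
      from DERIV_image_chain[OF DERIV_subset[OF C'[OF t'] this] 1]
      have "((\<lambda>t. C (t / q)) has_real_derivative - (q * z * exp (q * (t / q)) * S (q * (t / q))) * (1 / q)) (at t within {- q * x..0})"
        by (simp add: o_def mult_ac)
      from DERIV_minus[OF DERIV_cdivide[OF this, of "r * z"]]
      show "(F has_real_derivative h t * exp t) (at t within {- q * x..0})"
        unfolding F_def using q z r h_neg[OF t] by (simp add: mult_ac)
    qed
    thus ?thesis using q by (simp add: F_def diff_divide_distrib)
  qed
  have up0: "(1 - \<xi>) * upper_int h 0 = lam * C 0"
  proof -
    have "(1 - \<xi>) * upper_int h 0 = (1 - \<xi>) * r / z * C 0"
      using upper[of 0] S0 r(3) by simp
    thus ?thesis unfolding lamr(2) .
  qed
  have eigen: "lam * h x = ?T h x" for x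
  proof (cases "x \<ge> 0")
    case True
    hence le: "- q * x \<le> 0" using q by (simp add: mult_nonneg_nonneg)
    have "?T h x = \<xi> * ((C (- x) - C 0) / (r * z)) + lam * C 0"
      by (simp only: step_op_lower[OF h_meas h_abs le] lower[OF True] up0)
    also have "\<xi> * ((C (- x) - C 0) / (r * z)) = \<xi> / (r * z) * (C (- x) - C 0)" by simp
    finally show ?thesis using True unfolding lamr(1) by (simp add: h_pos algebra_simps)
  next
    case False
    hence ge: "- q * x \<ge> 0" using q by (simp add: mult_nonneg_nonpos)
    have "?T h x = (1 - \<xi>) * (S x / z)"
      unfolding step_op_upper[OF ge] upper[OF ge] using q by simp
    also have "\<dots> = ((1 - \<xi>) * r / z) * (S x / r)" using r by simp
    finally show ?thesis using False unfolding lamr(2) by (simp add: h_neg)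
  qed
  \<comment> \<open>The common order of T 1 and of h: from x < 0 the required jump beyond q |x|
    costs the factor exp (q x). It serves to compare both.\<close>
  define w where "w x = (if x \<ge> 0 then 1 else exp (q * x))" for x :: real
  have C0: "C 0 > 0" by (rule C_pos) simp
  have C0B: "C 0 \<le> B" by (rule C_le) simp
  have B0: "0 \<le> B" using C0 C0B by simp
  define l where "l = (1 - \<xi>) / lam"
  have l: "l > 0" using \<xi> lam by (simp add: l_def)
  define \<alpha> where "\<alpha> = min 1 l * C 0"
  define \<beta> where "\<beta> = max 1 l * B"
  have \<alpha>: "\<alpha> > 0" using l C0 by (simp add: \<alpha>_def)
  have \<beta>: "\<beta> > 0" using l C0 C0B by (simp add: \<beta>_def)
  have w0: "w x > 0" for x by (simp add: w_def)
  have hw: "\<alpha> * w x \<le> h x \<and> h x \<le> \<beta> * w x" for x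
  proof (cases "x \<ge> 0")
    case True
    have "\<alpha> \<le> 1 * C 0" "1 * B \<le> \<beta>"
      unfolding \<alpha>_def \<beta>_def using C0 C0B by (intro mult_right_mono; simp)+
    thus ?thesis using True C_anti[of "- x" 0] C_le[of "- x"] by (simp add: w_def h_pos)
  next
    case False
    hence ge: "- q * x \<ge> 0" using q by (simp add: mult_nonneg_nonpos)
    have "upper_int (\<lambda>_. C 0) (- q * x) \<le> upper_int h (- q * x)"
      using ge C0 C_anti by (intro upper_int_mono[where K = "C 0", OF _ h_meas _ h_abs]) (auto simp: h_pos)
    moreover have "upper_int h (- q * x) \<le> upper_int (\<lambda>_. B) (- q * x)"
      using ge B0 C_le by (intro upper_int_mono[where K' = B, OF h_meas _ h_abs]) (auto simp: h_pos)
    ultimately have "C 0 * exp (q * x) \<le> upper_int h (- q * x)" "upper_int h (- q * x) \<le> B * exp (q * x)"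
      using ge by (simp_all add: upper_int_const_exp)
    hence "l * (C 0 * exp (q * x)) \<le> l * upper_int h (- q * x)" "l * upper_int h (- q * x) \<le> l * (B * exp (q * x))"
      using l by (auto intro: mult_left_mono)
    moreover have "h x = l * upper_int h (- q * x)"
      using eigen[of x] lam unfolding step_op_upper[OF ge] by (simp add: l_def field_simps)
    moreover have "\<alpha> * exp (q * x) \<le> l * (C 0 * exp (q * x))" "l * (B * exp (q * x)) \<le> \<beta> * exp (q * x)"
      unfolding \<alpha>_def \<beta>_def mult.assoc[symmetric] using C0 C0B by (intro mult_right_mono; simp)+
    ultimately have "\<alpha> * exp (q * x) \<le> h x \<and> h x \<le> \<beta> * exp (q * x)" by linarith
    thus ?thesis using False by (simp only: w_def if_False)
  qed
  have h_gt: "h x > 0" for x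
    using hw[of x] mult_pos_pos[OF \<alpha> w0[of x]] by linarith

  define u where "u n x = survival (- q) \<xi> n x / lam ^ n" for n x
  have u_meas[measurable]: "u n \<in> borel_measurable borel" for n
    unfolding u_def[abs_def] by measurable
  have u_bnd: "0 \<le> u n x" "u n x \<le> 1 / lam ^ n" for n x
    using survival_bounds[OF \<xi>', of "- q" n x] lam by (auto simp: u_def divide_right_mono)
  have u_abs: "\<bar>u n x\<bar> \<le> 1 / lam ^ n" for n x using u_bnd[of n x] by simp
  have Tu: "?T (u n) x = lam * u (Suc n) x" for n x
    using step_op_cmult[of "- q" \<xi> "1 / lam ^ n" "survival (- q) \<xi> n" x] lam by (simp add: u_def[abs_def])
  have Th: "?T (\<lambda>t. a * h t) x = a * lam * h x" for a x
    by (simp add: step_op_cmult eigen)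
  have ah_abs: "\<bar>a * h x\<bar> \<le> \<bar>a\<bar> * K" for a x using h_abs by (simp add: abs_mult mult_left_mono)
  define P where "P n a b \<longleftrightarrow> (\<forall>x. a * h x \<le> u n x \<and> u n x \<le> b * h x)" for n a b
  have P_Suc: "P (Suc n) a b" if P: "P n a b" for n a b
    unfolding P_def
  proof
    fix x
    have "?T (\<lambda>t. a * h t) x \<le> ?T (u n) x" "?T (u n) x \<le> ?T (\<lambda>t. b * h t) x"
      using P by (auto simp: P_def intro!: step_op_mono[OF \<xi>'] u_abs ah_abs)
    hence "lam * (a * h x) \<le> lam * u (Suc n) x" "lam * u (Suc n) x \<le> lam * (b * h x)"
      unfolding Tu Th by (auto simp: mult_ac)
    thus "a * h x \<le> u (Suc n) x \<and> u (Suc n) x \<le> b * h x" using lam by simp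
  qed
  have P_add: "P (n + k) a b" if "P n a b" for n k a b
    by (induction k) (use that P_Suc in auto)
  let ?L = "\<lambda>f. (1 - \<xi>) * upper_int f 0"
  have L_ub: "upper_int (\<lambda>t. f t - g t) 0 = upper_int f 0 - upper_int g 0"
    if "f \<in> borel_measurable borel" "g \<in> borel_measurable borel" "\<And>x. \<bar>f x\<bar> \<le> K1" "\<And>x. \<bar>g x\<bar> \<le> K2" for f g K1 K2
    unfolding upper_int_def left_diff_distrib
    using upper_integrable[OF that(1,3), of 0] upper_integrable[OF that(2,4), of 0] by simp
  have L_c: "upper_int (\<lambda>t. a * h t) 0 = a * upper_int h 0" for a
    unfolding upper_int_def by (simp add: mult.assoc)
  \<comment> \<open>Of u - a h and b h - u, one carries at least half of (b - a) L h under L. Two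
    steps spread this as a multiple (1 - \<xi>) / \<beta> of h, and lam^2 normalises two steps. The
    cap 1/2 keeps 1 - \<epsilon> positive.\<close>
  define \<epsilon> where "\<epsilon> = min (1 / 2) ((1 - \<xi>) / \<beta> * ?L h / (2 * lam ^ 2))"
  have Lh: "?L h > 0" using up0 lam C0 by simp
  have \<epsilon>: "0 < \<epsilon>" "\<epsilon> < 1" unfolding \<epsilon>_def using \<xi> \<beta> Lh lam by auto
  have T2: "(1 - \<xi>) / \<beta> * h x * ?L v \<le> ?T (?T v) x"
    if v: "v \<in> borel_measurable borel" "\<And>x. 0 \<le> v x" "\<And>x. v x \<le> K1" for v K1 x
  proof -
    have "?L v \<ge> 0"
      unfolding upper_int_def set_lebesgue_integral_def using v \<xi> by (intro mult_nonneg_nonneg integral_nonneg_AE) auto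
    moreover have "(1 - \<xi>) / \<beta> * h x \<le> (1 - \<xi>) * w x"
    proof -
      have "h x / \<beta> \<le> w x" using hw[of x] \<beta> by (simp add: pos_divide_le_eq mult.commute)
      hence "(1 - \<xi>) * (h x / \<beta>) \<le> (1 - \<xi>) * w x" using \<xi> by (intro mult_left_mono) auto
      thus ?thesis by simp
    qed
    ultimately have "(1 - \<xi>) / \<beta> * h x * ?L v \<le> (1 - \<xi>) * w x * ?L v" by (rule mult_right_mono[rotated])
    also have "\<dots> \<le> ?T (?T v) x"
      unfolding w_def by (rule step_op_step_op_ge[OF q \<xi>' v])
    finally show ?thesis .
  qed
  have contr: "\<exists>a' b'. a \<le> a' \<and> b' - a' = (1 - \<epsilon>) * (b - a) \<and> P (Suc (Suc n)) a' b'"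
    if P: "P n a b" for n a b
  proof -
    have ah[measurable]: "(\<lambda>t. s * h t) \<in> borel_measurable borel" for s by measurable
    have ab: "a \<le> b"
    proof -
      have "a * h 0 \<le> b * h 0" using P unfolding P_def by (meson order.trans)
      thus ?thesis using h_gt[of 0] by simp
    qed
    have P2: "P (Suc (Suc n)) a b" using P P_Suc by blast
    define v1 where "v1 x = u n x - a * h x" for x
    define v2 where "v2 x = b * h x - u n x" for x
    have v_meas[measurable]: "v1 \<in> borel_measurable borel" "v2 \<in> borel_measurable borel"
      unfolding v1_def[abs_def] v2_def[abs_def] by measurable
    have v1: "0 \<le> v1 x" "v1 x \<le> 1 / lam ^ n + \<bar>a\<bar> * K" and v2: "0 \<le> v2 x" "v2 x \<le> 1 / lam ^ n + \<bar>b\<bar> * K" for x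
      using P u_abs[of n x] ah_abs[of a x] ah_abs[of b x] unfolding P_def v1_def v2_def abs_le_iff
      by (auto simp: algebra_simps)
    have "?L v1 + ?L v2 = (b - a) * ?L h"
    proof -
      have "upper_int v1 0 = upper_int (u n) 0 - a * upper_int h 0"
        unfolding v1_def L_c[symmetric] by (rule L_ub[OF _ _ u_abs ah_abs]) measurable
      moreover have "upper_int v2 0 = b * upper_int h 0 - upper_int (u n) 0"
        unfolding v2_def L_c[symmetric] by (rule L_ub[OF _ _ ah_abs u_abs]) measurable
      ultimately have "upper_int v1 0 + upper_int v2 0 = (b - a) * upper_int h 0" by (simp add: left_diff_distrib)
      thus ?thesis by (simp add: distrib_left[symmetric])
    qed
    hence cases: "(b - a) * ?L h / 2 \<le> ?L v1 \<or> (b - a) * ?L h / 2 \<le> ?L v2" by linarith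
    have gain: "\<epsilon> * (b - a) * h x \<le> V" if V: "lam ^ 2 * V = ?T (?T v) x" and v: "v \<in> borel_measurable borel" "\<And>x. 0 \<le> v x" "\<And>x. v x \<le> K1"
      and big: "(b - a) * ?L h / 2 \<le> ?L v" for v V x K1
    proof -
      have "\<epsilon> * (b - a) * h x \<le> ((1 - \<xi>) / \<beta> * ?L h / (2 * lam ^ 2)) * (b - a) * h x"
        using ab h_nonneg unfolding \<epsilon>_def by (intro mult_right_mono) auto
      also have "\<dots> = (1 - \<xi>) / \<beta> * h x * ((b - a) * ?L h / 2) / lam ^ 2" by (simp add: mult_ac)
      also have "\<dots> \<le> (1 - \<xi>) / \<beta> * h x * ?L v / lam ^ 2"
        using big \<xi> \<beta> h_nonneg lam by (intro divide_right_mono mult_left_mono) auto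
      also have "\<dots> \<le> ?T (?T v) x / lam ^ 2"
        using T2[OF v] by (intro divide_right_mono) auto
      also have "\<dots> = V" using V lam by (simp add: field_simps)
      finally show ?thesis .
    qed
    have TT1: "lam ^ 2 * (u (Suc (Suc n)) x - a * h x) = ?T (?T v1) x" for x
    proof -
      have 1: "?T v1 = (\<lambda>x. lam * u (Suc n) x - a * lam * h x)"
        unfolding v1_def[abs_def] by (rule ext) (simp add: step_op_diff[OF _ _ u_abs ah_abs] Tu Th)
      have "?T (?T v1) x = ?T (\<lambda>x. lam * u (Suc n) x) x - ?T (\<lambda>x. (a * lam) * h x) x"
        unfolding 1
      proof (rule step_op_diff[OF _ _ _ ah_abs])
        show "\<bar>lam * u (Suc n) x\<bar> \<le> lam * (1 / lam ^ Suc n)" for x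
          using lam u_abs[of "Suc n" x] by (simp only: abs_mult abs_of_pos mult_left_mono less_imp_le)
      qed measurable
      hence "?T (?T v1) x = lam * (lam * u (Suc (Suc n)) x) - a * lam * lam * h x"
        by (simp only: step_op_cmult[of _ _ lam "u (Suc n)"] Tu Th)
      thus ?thesis by (simp add: power2_eq_square algebra_simps)
    qed
    have TT2: "lam ^ 2 * (b * h x - u (Suc (Suc n)) x) = ?T (?T v2) x" for x
    proof -
      have 1: "?T v2 = (\<lambda>x. b * lam * h x - lam * u (Suc n) x)"
        unfolding v2_def[abs_def] by (rule ext) (simp add: step_op_diff[OF _ _ ah_abs u_abs] Tu Th)
      have "?T (?T v2) x = ?T (\<lambda>x. (b * lam) * h x) x - ?T (\<lambda>x. lam * u (Suc n) x) x"
        unfolding 1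
      proof (rule step_op_diff[OF _ _ ah_abs])
        show "\<bar>lam * u (Suc n) x\<bar> \<le> lam * (1 / lam ^ Suc n)" for x
          using lam u_abs[of "Suc n" x] by (simp only: abs_mult abs_of_pos mult_left_mono less_imp_le)
      qed measurable
      hence "?T (?T v2) x = b * lam * lam * h x - lam * (lam * u (Suc (Suc n)) x)"
        by (simp only: step_op_cmult[of _ _ lam "u (Suc n)"] Tu Th)
      thus ?thesis by (simp add: power2_eq_square algebra_simps)
    qed
    from cases show ?thesis
    proof
      assume big: "(b - a) * ?L h / 2 \<le> ?L v1"
      have "\<epsilon> * (b - a) * h x \<le> u (Suc (Suc n)) x - a * h x" for x
        by (rule gain[OF TT1 v_meas(1) v1 big])
      hence "P (Suc (Suc n)) (a + \<epsilon> * (b - a)) b"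
        using P2 by (auto simp: P_def algebra_simps)
      thus ?thesis using \<epsilon> ab by (intro exI[of _ "a + \<epsilon> * (b - a)"] exI[of _ b]) (auto simp: algebra_simps mult_left_mono)
    next
      assume big: "(b - a) * ?L h / 2 \<le> ?L v2"
      have "\<epsilon> * (b - a) * h x \<le> b * h x - u (Suc (Suc n)) x" for x
        by (rule gain[OF TT2 v_meas(2) v2 big])
      hence "P (Suc (Suc n)) a (b - \<epsilon> * (b - a))"
        using P2 by (auto simp: P_def algebra_simps)
      thus ?thesis by (intro exI[of _ a] exI[of _ "b - \<epsilon> * (b - a)"]) (auto simp: algebra_simps)
    qed
  qed
  \<comment> \<open>The comparison with h starts at n = 1: the constant function 1 lies below no
    multiple of h, which decays at - infinity, whereas T 1 has the order of w.\<close>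
  define a1 where "a1 = (1 - \<xi>) / (lam * \<beta>)"
  define b1 where "b1 = 1 / (lam * \<alpha>)"
  have a1: "a1 > 0" using \<xi> lam \<beta> by (simp add: a1_def)
  have b1: "b1 > 0" using lam \<alpha> by (simp add: b1_def)
  have P1: "P 1 a1 b1"
    unfolding P_def
  proof
    fix x
    have T1: "(1 - \<xi>) * w x \<le> ?T (\<lambda>_. 1) x \<and> ?T (\<lambda>_. 1) x \<le> w x"
    proof (cases "x \<ge> 0")
      case True
      hence le: "- q * x \<le> 0" using q by (simp add: mult_nonneg_nonneg)
      have "?T (\<lambda>_. 1) x = \<xi> * lower_int (\<lambda>_. 1) (- q * x) + (1 - \<xi>)"
        by (subst step_op_lower[where K = 1, OF _ _ le]) (auto simp: upper_int_const_exp)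
      moreover have "lower_int (\<lambda>_. 1) (- q * x) \<ge> 0"
        unfolding lower_int_def set_lebesgue_integral_def by (intro integral_nonneg_AE) auto
      moreover have "?T (\<lambda>_. 1) x \<le> 1" by (rule step_op_bounds[OF \<xi>']) auto
      ultimately show ?thesis using True \<xi> by (simp add: w_def)
    next
      case False
      hence ge: "- q * x \<ge> 0" using q by (simp add: mult_nonneg_nonpos)
      have "upper_int (\<lambda>_. 1) (- q * x) = exp (q * x)" using upper_int_const_exp[OF ge, of "\<lambda>_. 1" 1] by simp
      thus ?thesis unfolding step_op_upper[OF ge] using \<xi> False by (simp add: w_def mult_left_le_one_le)
    qed
    have u1: "u 1 x = ?T (\<lambda>_. 1) x / lam" by (simp add: u_def)
    have "h x / \<beta> \<le> w x" using hw[of x] \<beta> by (simp add: pos_divide_le_eq mult.commute)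
    hence "(1 - \<xi>) * (h x / \<beta>) \<le> (1 - \<xi>) * w x" using \<xi> by (intro mult_left_mono) auto
    hence "(1 - \<xi>) * (h x / \<beta>) / lam \<le> u 1 x" unfolding u1 using T1 lam by (intro divide_right_mono) auto
    moreover have "w x \<le> h x / \<alpha>" using hw[of x] \<alpha> by (simp add: pos_le_divide_eq mult.commute)
    hence "u 1 x \<le> h x / \<alpha> / lam" unfolding u1 using T1 lam by (intro divide_right_mono) auto
    ultimately show "a1 * h x \<le> u 1 x \<and> u 1 x \<le> b1 * h x"
      by (simp add: a1_def b1_def mult_ac)
  qed
  have seq: "\<exists>N a b. N \<ge> 1 \<and> b - a = (1 - \<epsilon>) ^ k * (b1 - a1) \<and> P N a b" for k
  proof (induction k)
    case 0
    show ?case using P1 by (intro exI[of _ 1] exI[of _ a1] exI[of _ b1]) auto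
  next
    case (Suc k)
    then obtain N a b where "b - a = (1 - \<epsilon>) ^ k * (b1 - a1)" "P N a b" by blast
    moreover from contr[OF this(2)] obtain a' b' where "b' - a' = (1 - \<epsilon>) * (b - a)" "P (Suc (Suc N)) a' b'" by blast
    ultimately show ?case by (intro exI[of _ "Suc (Suc N)"] exI[of _ a'] exI[of _ b']) auto
  qed
  define g where "g n x = u n x / h x" for n x
  have gP: "a \<le> g n x" "g n x \<le> b" if "P n a b" for n a b x
    using that h_gt[of x] by (auto simp: P_def g_def pos_le_divide_eq pos_divide_le_eq)
  \<comment> \<open>The bounds a and b do not depend on the point, so the quotients are Cauchy in n
    and close to each other in x at once; this makes the limit a constant c.\<close>
  have close: "\<exists>N. \<forall>n\<ge>N. \<forall>m\<ge>N. \<forall>x y. \<bar>g n x - g m y\<bar> < e" if e: "e > 0" for e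
  proof -
    have "(\<lambda>k. (1 - \<epsilon>) ^ k * (b1 - a1)) \<longlonglongrightarrow> 0 * (b1 - a1)"
      using \<epsilon> by (intro tendsto_intros LIMSEQ_realpow_zero) auto
    hence "\<forall>\<^sub>F k in sequentially. (1 - \<epsilon>) ^ k * (b1 - a1) < e"
      using e by (intro order_tendstoD) auto
    then obtain k where k: "(1 - \<epsilon>) ^ k * (b1 - a1) < e" by (auto simp: eventually_sequentially)
    obtain N a b where N: "b - a = (1 - \<epsilon>) ^ k * (b1 - a1)" "P N a b" using seq by blast
    have bnd: "a \<le> g n x \<and> g n x \<le> b" if n: "n \<ge> N" for n x
      using gP[OF P_add[OF N(2), of "n - N"]] n by simp
    have "\<bar>g n x - g m y\<bar> < e" if "n \<ge> N" "m \<ge> N" for n m x y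
      using bnd[OF that(1), of x] bnd[OF that(2), of y] k N(1) by linarith
    thus ?thesis by blast
  qed
  have "Cauchy (\<lambda>n. g n 0)"
  proof (rule metric_CauchyI)
    fix e :: real assume "e > 0"
    from close[OF this] show "\<exists>M. \<forall>m\<ge>M. \<forall>n\<ge>M. dist (g m 0) (g n 0) < e" unfolding dist_real_def by blast
  qed
  then obtain c where c_lim: "(\<lambda>n. g n 0) \<longlonglongrightarrow> c" using Cauchy_convergent convergent_def by blast
  have g_lim: "(\<lambda>n. g n x) \<longlonglongrightarrow> c" for x
  proof -
    have "(\<lambda>n. g n x - g n 0) \<longlonglongrightarrow> 0"
    proof (rule LIMSEQ_I)
      fix e :: real assume "e > 0"
      from close[OF this] show "\<exists>no. \<forall>n\<ge>no. norm (g n x - g n 0 - 0) < e" unfolding real_norm_def diff_0_right by blast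
    qed
    from tendsto_add[OF this c_lim] show ?thesis by simp
  qed
  have c: "c > 0"
  proof -
    have "a1 \<le> c"
    proof (rule LIMSEQ_le_const[OF c_lim], intro exI allI impI)
      fix n :: nat assume "n \<ge> 1"
      thus "a1 \<le> g n 0" using gP(1)[OF P_add[OF P1, of "n - 1"], of 0] by simp
    qed
    thus ?thesis using a1 by simp
  qed
  have u_lim: "(\<lambda>n. u n x) \<longlonglongrightarrow> c * h x" for x
  proof -
    have "(\<lambda>n. g n x * h x) \<longlonglongrightarrow> c * h x" by (intro tendsto_intros g_lim)
    thus ?thesis using h_gt[of x] by (simp add: g_def)
  qed
  have K: "K > 0" using h_gt[of 0] h_le[of 0] by linarith
  have u_le: "u n x \<le> 1 + b1 * K" for n x
  proof (cases n)
    case 0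
    thus ?thesis using b1 K by (simp add: u_def)
  next
    case (Suc m)
    have "u n x \<le> b1 * h x" using P_add[OF P1, of m] Suc by (simp add: P_def)
    also have "\<dots> \<le> b1 * K" using b1 h_le by (intro mult_left_mono) auto
    finally show ?thesis by simp
  qed
  have "ground_state (- q) \<xi> lam c K (1 + b1 * K) UNIV h"
  proof unfold_locales
    show "survival (- q) \<xi> n x \<le> (1 + b1 * K) * lam ^ n" for n x
      using u_le[of n x] lam by (simp add: u_def pos_divide_le_eq)
    show "(\<lambda>n. survival (- q) \<xi> n x / lam ^ n) \<longlonglongrightarrow> c * h x" for x
      using u_lim[of x] by (simp add: u_def)
  qed (use \<xi>' lam h_nonneg h_le eigen c h_gt in auto)
  thus ?thesis by blast
qed

section \<open>Regime (iii): the \<open>q\<close>-trigonometric functions\<close>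

text \<open>\<open>rot q x = cos_q x + i sin_q x\<close>.\<close>

definition rot :: "real \<Rightarrow> real \<Rightarrow> complex" where
  "rot q x = e_q q (\<i> * of_real x)"

lemma qfact_series_summable:
  fixes x :: real
  assumes "q \<ge> 1"
  shows "summable (\<lambda>n. x ^ n / qfact q n)"
proof (cases "q = 1")
  case True
  thus ?thesis using sums_summable[OF exp_series_real[of x]] by (simp add: qfact_def)
qed (use assms qexp_summable[of q x] in simp)

lemma e_q_sums:
  fixes z :: complex
  assumes "q \<ge> 1"
  shows "(\<lambda>n. z ^ n / of_real (qfact q n)) sums e_q q z"
proof -
  have "summable (\<lambda>n. z ^ n / of_real (qfact q n))"
    using qfact_series_summable[OF assms, of "norm z"] qfact_pos[of q] assms
    by (intro summable_norm_cancel[of "\<lambda>n. z ^ n / of_real (qfact q n)"]) (simp add: norm_divide norm_power abs_of_pos)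
  thus ?thesis using assms by (simp add: e_q_def summable_sums)
qed

text \<open>Coefficientwise this is (q^(n+1) - 1) / [n + 1]! = (q - 1) / [n]!, which makes e_q(q w)
  - e_q(w) a multiple of w e_q(w).\<close>

lemma e_q_mult:
  fixes w :: complex
  assumes q: "q > 1"
  shows "e_q q (of_real q * w) = (1 + of_real (q - 1) * w) * e_q q w"
proof -
  define c where "c n = 1 / (of_real (qfact q n) :: complex)" for n
  have c_Suc: "of_real (q ^ Suc n - 1) * c (Suc n) = of_real (q - 1) * c n" for n
  proof -
    have "q ^ Suc n - 1 = (q - 1) * qnumber q (Suc n)" using q by (simp add: qnumber_def field_simps)
    moreover have "qnumber q (Suc n) > 0" "qfact q n > 0" using q by (auto intro: qnumber_pos qfact_pos)
    ultimately show ?thesis using q by (simp add: c_def qfact_Suc del: power_Suc of_real_diff of_real_power)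
  qed
  have s: "(\<lambda>n. c n * z ^ n) sums e_q q z" for z
    using e_q_sums[of q z] q by (simp add: c_def)
  have "(\<lambda>n. c n * (of_real q * w) ^ n - c n * w ^ n) sums (e_q q (of_real q * w) - e_q q w)"
    by (intro sums_diff s)
  hence "(\<lambda>n. c (Suc n) * (of_real q * w) ^ Suc n - c (Suc n) * w ^ Suc n) sums (e_q q (of_real q * w) - e_q q w)"
    by (subst sums_Suc_iff) simp
  moreover have "c (Suc n) * (of_real q * w) ^ Suc n - c (Suc n) * w ^ Suc n = of_real (q - 1) * w * (c n * w ^ n)" for n
  proof -
    have "c (Suc n) * (of_real q * w) ^ Suc n - c (Suc n) * w ^ Suc n = (of_real (q ^ Suc n - 1) * c (Suc n)) * w ^ Suc n"
      by (simp add: power_mult_distrib algebra_simps)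
    thus ?thesis by (subst (asm) c_Suc) (simp add: mult_ac)
  qed
  ultimately have "(\<lambda>n. of_real (q - 1) * w * (c n * w ^ n)) sums (e_q q (of_real q * w) - e_q q w)" by simp
  from sums_unique2[OF this sums_mult[OF s]] have "e_q q (of_real q * w) - e_q q w = of_real (q - 1) * w * e_q q w" .
  thus ?thesis by (simp add: algebra_simps)
qed

lemma norm_one_minus_imag_ge: "norm (1 - \<i> * of_real t) \<ge> 1"
  by (simp add: cmod_def)

text \<open>On the imaginary axis the denominators have modulus at least 1, so the factors differ
  from 1 by at most |t| with t geometric in n; this works for every real x, also outside the disc of
  the power series.\<close>

lemma rot_convergent_prod:
  assumes q: "0 < q" "q < 1"
  shows "convergent_prod (\<lambda>n. 1 / (1 - \<i> * of_real x * of_real (1 - q) * of_real q ^ n))"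
proof (intro abs_convergent_prod_imp_convergent_prod, unfold abs_convergent_prod_conv_summable)
  have e: "1 - \<i> * of_real x * of_real (1 - q) * of_real q ^ n = 1 - \<i> * of_real (x * (1 - q) * q ^ n)" for n by simp
  show "summable (\<lambda>n. norm (1 / (1 - \<i> * of_real x * of_real (1 - q) * of_real q ^ n) - 1))"
  proof (rule summable_comparison_test')
    show "summable (\<lambda>n. \<bar>x * (1 - q)\<bar> * q ^ n)"
      using q by (intro summable_mult summable_geometric) auto
    fix n :: nat
    define t where "t = x * (1 - q) * q ^ n"
    have n: "norm (1 - \<i> * of_real t) \<ge> 1" by (rule norm_one_minus_imag_ge)
    hence "1 - \<i> * of_real t \<noteq> 0" by auto
    hence "1 / (1 - \<i> * of_real t) - 1 = \<i> * of_real t / (1 - \<i> * of_real t)" by (simp add: field_simps)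
    hence "norm (1 / (1 - \<i> * of_real t) - 1) = \<bar>t\<bar> / norm (1 - \<i> * of_real t)"
      by (simp add: norm_divide norm_mult)
    also have "\<dots> \<le> \<bar>t\<bar>" using n by (simp add: divide_le_eq mult_le_cancel_left1)
    finally show "norm (norm (1 / (1 - \<i> * of_real x * of_real (1 - q) * of_real q ^ n) - 1)) \<le> \<bar>x * (1 - q)\<bar> * q ^ n"
      unfolding e using q by (simp add: t_def abs_mult del: of_real_mult of_real_power)
  qed
qed

lemma rot_less_1:
  assumes "0 < q" "q < 1"
  shows "rot q x = (\<Prod>n. 1 / (1 - \<i> * of_real x * of_real (1 - q) * of_real q ^ n))"
  using assms by (simp add: rot_def e_q_def)

lemma rot_cnj_less_1:
  assumes q: "0 < q" "q < 1"
  shows "rot q (- x) = cnj (rot q x)"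
proof -
  note L = convergent_prod_LIMSEQ[OF rot_convergent_prod[OF q]]
  have "(\<lambda>n. cnj (\<Prod>i\<le>n. 1 / (1 - \<i> * of_real x * of_real (1 - q) * of_real q ^ i))) \<longlonglongrightarrow> cnj (rot q x)"
    unfolding rot_less_1[OF q] by (intro tendsto_cnj L)
  moreover have "cnj (\<Prod>i\<le>n. 1 / (1 - \<i> * of_real x * of_real (1 - q) * of_real q ^ i))
     = (\<Prod>i\<le>n. 1 / (1 - \<i> * of_real (- x) * of_real (1 - q) * of_real q ^ i))" for n
    by simp
  ultimately have "(\<lambda>n. \<Prod>i\<le>n. 1 / (1 - \<i> * of_real (- x) * of_real (1 - q) * of_real q ^ i)) \<longlonglongrightarrow> cnj (rot q x)"
    by (simp only:)
  from LIMSEQ_unique[OF L[of "- x"] this] show ?thesis unfolding rot_less_1[OF q, of "- x"] .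
qed

lemma rot_step_less_1:
  assumes q: "0 < q" "q < 1"
  shows "rot q x * (1 - \<i> * of_real ((1 - q) * x)) = rot q (q * x)"
proof -
  let ?f = "\<lambda>n. 1 / (1 - \<i> * of_real x * of_real (1 - q) * of_real q ^ n)"
  have nz: "1 - \<i> * of_real ((1 - q) * x) \<noteq> 0"
    using norm_one_minus_imag_ge[of "(1 - q) * x"] by (auto simp del: of_real_mult)
  have f0: "?f 0 = 1 / (1 - \<i> * of_real ((1 - q) * x))" by (simp add: mult_ac)
  have "prodinf ?f = ?f 0 * prodinf (\<lambda>n. ?f (Suc n))"
    using prodinf_split_head[OF rot_convergent_prod[OF q], of x] nz by (simp add: f0 field_simps)
  moreover have "prodinf (\<lambda>n. ?f (Suc n)) = rot q (q * x)"
    unfolding rot_less_1[OF q] by (simp add: mult_ac)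
  ultimately show ?thesis using nz unfolding rot_less_1[OF q, of x, symmetric] f0 by simp
qed

lemma rot_step_gt_1:
  assumes "q > 1"
  shows "rot q x = (1 + \<i> * of_real ((1 - 1 / q) * x)) * rot q (x / q)"
proof -
  have "rot q x = e_q q (of_real q * (\<i> * of_real (x / q)))" using assms by (simp add: rot_def)
  also have "\<dots> = (1 + of_real (q - 1) * (\<i> * of_real (x / q))) * rot q (x / q)"
    by (subst e_q_mult[OF assms]) (simp add: rot_def)
  also have "of_real (q - 1) * (\<i> * of_real (x / q)) = \<i> * of_real ((1 - 1 / q) * x)"
    using assms by (simp add: field_simps)
  finally show ?thesis .
qed

lemma rot_1: "rot 1 x = cis x"
proof -
  have "(\<lambda>n. (\<i> * of_real x) ^ n /\<^sub>R fact n) sums exp (\<i> * of_real x)" by (rule exp_converges)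
  moreover have "(\<lambda>n. (\<i> * of_real x) ^ n / of_real (qfact 1 n)) sums rot 1 x"
    unfolding rot_def by (rule e_q_sums) simp
  ultimately show ?thesis
    by (simp add: qfact_def scaleR_conv_of_real divide_inverse mult.commute sums_unique2 cis_conv_exp)
qed

lemma rot_0: "q > 0 \<Longrightarrow> rot q 0 = 1"
proof (cases "q \<ge> 1")
  case True
  have "(\<Sum>n. (0 :: complex) ^ n / of_real (qfact q n)) = 1"
    by (subst suminf_finite[of "{0}"]) (auto simp: power_0_left)
  thus ?thesis using True by (simp add: rot_def e_q_def)
qed (simp add: rot_def e_q_def)

text \<open>Close to 0 the power series is available for every q > 0; K lies inside its disc of
  convergence, at half the radius if q < 1.\<close>

lemma rot_tendsto_1:
  assumes q: "q > 0" and X: "X \<longlonglongrightarrow> 0"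
  shows "(\<lambda>n. rot q (X n)) \<longlonglongrightarrow> 1"
proof -
  define K where "K = (if q < 1 then 1 / (2 * (1 - q)) else 1)"
  have K: "K > 0" using q by (simp add: K_def)
  define c where "c n = 1 / (of_real (qfact q n) :: complex)" for n
  have s: "(\<lambda>n. c n * z ^ n) sums e_q q z" if "norm z \<le> K" for z
  proof (cases "q < 1")
    case True
    have "K < 1 / (1 - q)" using True by (simp add: K_def field_simps)
    thus ?thesis using e_q_eq_series[of q z] q True that by (simp add: c_def)
  qed (use e_q_sums[of q z] in \<open>simp add: c_def\<close>)
  have "isCont (\<lambda>z. \<Sum>n. c n * z ^ n) 0"
    by (rule isCont_powser[OF sums_summable[OF s[of "of_real K"]]]) (use K in auto)
  moreover have X': "(\<lambda>n. \<i> * of_real (X n)) \<longlonglongrightarrow> 0"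
    using tendsto_mult[OF tendsto_const tendsto_of_real[OF X], of \<i>] by simp
  ultimately have L: "(\<lambda>n. \<Sum>k. c k * (\<i> * of_real (X n)) ^ k) \<longlonglongrightarrow> (\<Sum>k. c k * 0 ^ k)"
    by (rule isCont_tendsto_compose)
  have one: "(\<Sum>k. c k * 0 ^ k) = 1" using rot_0[OF q] sums_unique[OF s[of 0]] K by (simp add: rot_def)
  have ev: "\<forall>\<^sub>F n in sequentially. (\<Sum>k. c k * (\<i> * of_real (X n)) ^ k) = rot q (X n)"
  proof -
    have "\<forall>\<^sub>F n in sequentially. \<bar>X n\<bar> < K"
      using tendsto_rabs_zero[OF X] K by (intro order_tendstoD) auto
    thus ?thesis by eventually_elim (simp add: rot_def sums_unique[OF s, symmetric] norm_mult)
  qed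
  show ?thesis using Lim_transform_eventually[OF L ev] unfolding one .
qed

lemma one_plus_imag_polar: "1 + \<i> * of_real t = of_real (sqrt (1 + t\<^sup>2)) * cis (arctan t)"
proof -
  have "1 + t\<^sup>2 > 0" by (simp add: add_pos_nonneg)
  hence "sqrt (1 + t\<^sup>2) \<noteq> 0" by simp
  thus ?thesis by (intro complex_eqI) (simp_all add: cos_arctan sin_arctan del: real_sqrt_eq_0_iff)
qed

text \<open>The choice of p unites both cases: the factor is 1 / (1 - i t) for q < 1 and 1 + i t for
  q > 1, with t = (1 - p) x. The moduli differ, but both have the argument arctan t.\<close>

lemma rot_step_polar:
  assumes "q > 0" "q \<noteq> 1"
  defines "p \<equiv> min q (1 / q)"
  shows "\<exists>\<rho>>0. rot q x = of_real \<rho> * cis (arctan ((1 - p) * x)) * rot q (p * x)"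
proof (cases "q < 1")
  case True
  have "q * q \<le> 1" using True assms(1) by (intro mult_le_one) auto
  hence p: "p = q" using assms(1) by (simp add: p_def min_def field_simps)
  define t where "t = (1 - q) * x"
  have "sqrt (1 + t\<^sup>2) > 0" by (simp add: add_pos_nonneg)
  have "(1 - \<i> * of_real t) * (of_real (1 / sqrt (1 + t\<^sup>2)) * cis (arctan t)) = 1"
  proof -
    have "1 - \<i> * of_real t = of_real (sqrt (1 + t\<^sup>2)) * cis (- arctan t)"
      using one_plus_imag_polar[of "- t"] by (simp add: arctan_minus)
    thus ?thesis using \<open>sqrt (1 + t\<^sup>2) > 0\<close> by (simp add: cis_mult mult_ac)
  qed
  hence "rot q x = rot q (q * x) * (of_real (1 / sqrt (1 + t\<^sup>2)) * cis (arctan t))"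
    unfolding rot_step_less_1[OF assms(1) True, symmetric] t_def[symmetric] by (simp only: mult.assoc mult_1_right)
  hence "rot q x = of_real (1 / sqrt (1 + t\<^sup>2)) * cis (arctan t) * rot q (q * x)"
    by (simp only: mult.commute)
  moreover have "1 / sqrt (1 + t\<^sup>2) > 0" using \<open>sqrt (1 + t\<^sup>2) > 0\<close> by (rule divide_pos_pos[OF zero_less_one])
  ultimately show ?thesis unfolding p t_def by (intro exI[of _ "1 / sqrt (1 + ((1 - q) * x)\<^sup>2)"] conjI)
next
  case False
  hence q: "q > 1" using assms by simp
  have "1 / q \<le> q" by (rule order.trans[of _ 1]) (use q in auto)
  hence p: "p = 1 / q" unfolding p_def by (rule min.absorb2)
  define t where "t = (1 - p) * x"
  have "sqrt (1 + t\<^sup>2) > 0" by (simp add: add_pos_nonneg)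
  moreover have "rot q x = of_real (sqrt (1 + t\<^sup>2)) * cis (arctan t) * rot q (p * x)"
    using rot_step_gt_1[OF q, of x] unfolding one_plus_imag_polar[symmetric] by (simp add: p t_def)
  ultimately show ?thesis unfolding t_def by blast
qed

text \<open>The functional equation \<open>rot q x = \<rho> cis (arctan ((1 - p) x)) rot q (p x)\<close> makes
  \<open>\<Theta> x = \<Sum> arctan ((1 - p) p^n x)\<close> the argument of \<open>rot q x\<close>; it is \<open>1\<close>-Lipschitz because the
  factors \<open>(1 - p) p^n\<close> sum to \<open>1\<close>.\<close>

lemma rot_polar:
  assumes q: "q > 0"
  obtains \<Theta> R :: "real \<Rightarrow> real"
  where "strict_mono \<Theta>" "continuous_on UNIV \<Theta>" "\<Theta> 0 = 0" "\<exists>x>0. \<Theta> x = pi / 2" "\<And>x. x \<ge> 0 \<Longrightarrow> \<Theta> x \<le> x"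
    "\<And>x. R x > 0" "\<And>x. rot q x = of_real (R x) * cis (\<Theta> x)"
proof (cases "q = 1")
  case True
  show ?thesis
    by (rule that[of "\<lambda>x. x" "\<lambda>_. 1"]) (auto simp: True rot_1 strict_mono_def intro!: exI[of _ "pi / 2"])
next
  case False
  define p where "p = min q (1 / q)"
  have p: "0 < p" "p < 1"
  proof -
    show "0 < p" using q by (simp add: p_def)
    have "q < 1 \<or> 1 / q < 1" using q False by (auto simp: divide_less_eq_1)
    thus "p < 1" by (auto simp: p_def min_less_iff_disj)
  qed
  define \<kappa> where "\<kappa> = 1 - p"
  have \<kappa>: "\<kappa> > 0" using p by (simp add: \<kappa>_def)
  define a where "a x n = arctan (\<kappa> * p ^ n * x)" for x n
  have geo: "(\<lambda>n. \<kappa> * p ^ n * x) sums x" for x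
    using sums_mult2[OF sums_mult[OF geometric_sums[of p], of \<kappa>], of x] p by (simp add: \<kappa>_def)
  have lip: "\<bar>arctan s - arctan t\<bar> \<le> \<bar>s - t\<bar>" for s t :: real
  proof -
    have "norm (arctan s - arctan t) \<le> 1 * norm (s - t)"
    proof (rule field_differentiable_bound[of UNIV])
      show "(arctan has_field_derivative inverse (1 + x\<^sup>2)) (at x within UNIV)" for x by (rule DERIV_arctan)
      show "norm (inverse (1 + x\<^sup>2)) \<le> 1" for x :: real
        by (simp add: inverse_le_1_iff)
    qed auto
    thus ?thesis by simp
  qed
  have a_abs: "\<bar>a x n - a y n\<bar> \<le> \<kappa> * p ^ n * \<bar>x - y\<bar>" for x y n
    using lip[of "\<kappa> * p ^ n * x" "\<kappa> * p ^ n * y"] \<kappa> p by (simp add: a_def right_diff_distrib[symmetric] abs_mult)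
  have diff_summ: "summable (\<lambda>n. \<bar>a x n - a y n\<bar>)" for x y
    by (rule summable_comparison_test'[OF sums_summable[OF geo[of "\<bar>x - y\<bar>"]]]) (use a_abs in auto)
  have a0: "a 0 n = 0" for n by (simp add: a_def)
  have a_summ: "summable (a x)" for x
    using diff_summ[of x 0] by (simp add: a0 summable_rabs_cancel)
  define \<Theta> where "\<Theta> x = (\<Sum>n. a x n)" for x
  have \<Theta>_lip: "\<bar>\<Theta> x - \<Theta> y\<bar> \<le> \<bar>x - y\<bar>" for x y
  proof -
    have "\<bar>\<Theta> x - \<Theta> y\<bar> = \<bar>\<Sum>n. a x n - a y n\<bar>" unfolding \<Theta>_def by (simp add: suminf_diff a_summ)
    also have "\<dots> \<le> (\<Sum>n. \<bar>a x n - a y n\<bar>)" by (rule summable_rabs[OF diff_summ])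
    also have "\<dots> \<le> (\<Sum>n. \<kappa> * p ^ n * \<bar>x - y\<bar>)"
      by (intro suminf_le a_abs diff_summ sums_summable[OF geo])
    also have "\<dots> = \<bar>x - y\<bar>" using geo sums_unique by metis
    finally show ?thesis .
  qed
  have a_mono: "a x n < a y n" if "x < y" for x y n
    using that \<kappa> p unfolding a_def arctan_less_iff by (intro mult_strict_left_mono) auto
  have mono: "strict_mono \<Theta>"
  proof (rule strict_monoI)
    fix x y :: real assume "x < y"
    have "0 < (\<Sum>n. a y n - a x n)"
      by (rule suminf_pos) (use a_mono[OF \<open>x < y\<close>] in \<open>auto intro: summable_diff a_summ\<close>)
    thus "\<Theta> x < \<Theta> y" unfolding \<Theta>_def by (simp add: suminf_diff[symmetric] a_summ)
  qed
  have cont: "continuous_on UNIV \<Theta>"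
    unfolding continuous_on_iff dist_real_def using \<Theta>_lip by (meson le_less_trans)
  have \<Theta>0: "\<Theta> 0 = 0" by (simp add: \<Theta>_def a0)
  have \<Theta>_step: "\<Theta> x = arctan (\<kappa> * x) + \<Theta> (p * x)" for x
  proof -
    have "\<Theta> x = a x 0 + (\<Sum>n. a x (Suc n))" unfolding \<Theta>_def by (simp add: suminf_split_head[OF a_summ])
    moreover have "a x (Suc n) = a (p * x) n" for n by (simp add: a_def mult_ac)
    ultimately show ?thesis by (simp add: \<Theta>_def a_def)
  qed
  have reach: "\<exists>x>0. \<Theta> x = pi / 2"
  proof -
    \<comment> \<open>With this X the second term of the series is arctan 1 and the first at least
      that, which already adds up to pi / 2.\<close>
    define X where "X = 1 / (\<kappa> * p)"
    have X: "X > 0" using \<kappa> p by (simp add: X_def)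
    have "\<Theta> (p * (p * X)) \<ge> 0"
      using strict_mono_less[OF mono, of 0 "p * (p * X)"] \<Theta>0 X p by simp
    moreover have "arctan (\<kappa> * (p * X)) = pi / 4" using \<kappa> p by (simp add: X_def)
    moreover have "arctan (\<kappa> * X) \<ge> arctan 1"
      unfolding arctan_le_iff using \<kappa> p by (simp add: X_def)
    ultimately have "\<Theta> X \<ge> pi / 2"
      using \<Theta>_step[of X] \<Theta>_step[of "p * X"] by (simp add: arctan_one)
    then obtain x where x: "0 \<le> x" "x \<le> X" "\<Theta> x = pi / 2"
      using IVT'[of \<Theta> 0 "pi / 2" X] \<Theta>0 X continuous_on_subset[OF cont] by auto
    moreover have "x \<noteq> 0" using x \<Theta>0 by auto
    ultimately show ?thesis by (intro exI[of _ x]) auto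
  qed
  have le: "\<Theta> x \<le> x" if "x \<ge> 0" for x
    using \<Theta>_lip[of x 0] \<Theta>0 that by auto
  \<comment> \<open>\<open>rot\<close> with the candidate argument removed. B x is a positive
    multiple of B(p^n x), which tends to 1; as the ratio of imaginary and real part is unaffected by
    such multiples, B x is real and positive.\<close>
  define B where "B x = rot q x * cis (- \<Theta> x)" for x
  have B_step: "\<exists>\<rho>>0. B x = of_real \<rho> * B (p * x)" for x
  proof -
    obtain \<rho> where \<rho>: "\<rho> > 0" "rot q x = of_real \<rho> * cis (arctan (\<kappa> * x)) * rot q (p * x)"
      using rot_step_polar[OF q False, of x] unfolding p_def \<kappa>_def by blast
    have "cis (arctan (\<kappa> * x)) * cis (- \<Theta> x) = cis (- \<Theta> (p * x))"
      using \<Theta>_step[of x] by (simp add: cis_mult)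
    hence "B x = of_real \<rho> * B (p * x)" unfolding B_def \<rho>(2) by (simp add: mult_ac)
    thus ?thesis using \<rho> by blast
  qed
  have B_iter: "\<exists>\<rho>>0. B x = of_real \<rho> * B (p ^ n * x)" for x n
  proof (induction n)
    case (Suc n)
    then obtain \<rho> where \<rho>: "\<rho> > 0" "B x = of_real \<rho> * B (p ^ n * x)" by blast
    obtain \<rho>' where \<rho>': "\<rho>' > 0" "B (p ^ n * x) = of_real \<rho>' * B (p * (p ^ n * x))" using B_step by blast
    show ?case by (rule exI[of _ "\<rho> * \<rho>'"]) (use \<rho> \<rho>' in \<open>simp add: mult_ac\<close>)
  qed (auto intro!: exI[of _ 1])
  have B_lim: "(\<lambda>n. B (p ^ n * x)) \<longlonglongrightarrow> 1" for x
  proof -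
    have X: "(\<lambda>n. p ^ n * x) \<longlonglongrightarrow> 0"
      using p by (intro tendsto_mult_left_zero LIMSEQ_realpow_zero) auto
    have "isCont \<Theta> 0" using cont by (simp add: continuous_on_eq_continuous_at)
    hence "(\<lambda>n. \<Theta> (p ^ n * x)) \<longlonglongrightarrow> 0"
      using isCont_tendsto_compose[OF _ X, of \<Theta>] \<Theta>0 by simp
    hence "(\<lambda>n. rot q (p ^ n * x) * cis (- \<Theta> (p ^ n * x))) \<longlonglongrightarrow> 1 * cis (- 0)"
      unfolding cis_conv_exp by (intro tendsto_intros rot_tendsto_1[OF q X]) simp
    thus ?thesis by (simp add: B_def)
  qed
  have B: "Re (B x) > 0 \<and> Im (B x) = 0" for x
  proof -
    have ReL: "(\<lambda>n. Re (B (p ^ n * x))) \<longlonglongrightarrow> 1" and ImL: "(\<lambda>n. Im (B (p ^ n * x))) \<longlonglongrightarrow> 0"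
      using tendsto_Re[OF B_lim[of x]] tendsto_Im[OF B_lim[of x]] by auto
    have "\<forall>\<^sub>F n in sequentially. Re (B (p ^ n * x)) > 0"
      using ReL by (rule order_tendstoD) simp
    then obtain n where n: "Re (B (p ^ n * x)) > 0" by (auto simp: eventually_sequentially)
    obtain \<rho> where "\<rho> > 0" "B x = of_real \<rho> * B (p ^ n * x)" using B_iter by blast
    hence pos: "Re (B x) > 0" using n by simp
    have "Im (B x) / Re (B x) = Im (B (p ^ n * x)) / Re (B (p ^ n * x))" for n
    proof -
      obtain \<rho> where "\<rho> > 0" "B x = of_real \<rho> * B (p ^ n * x)" using B_iter by blast
      thus ?thesis by simp
    qed
    moreover have "(\<lambda>n. Im (B (p ^ n * x)) / Re (B (p ^ n * x))) \<longlonglongrightarrow> 0 / 1"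
      by (intro tendsto_divide ReL ImL) simp
    ultimately have "(\<lambda>n. Im (B x) / Re (B x)) \<longlonglongrightarrow> 0" by simp
    hence "Im (B x) / Re (B x) = 0" by (simp add: LIMSEQ_const_iff)
    thus ?thesis using pos by simp
  qed
  show ?thesis
  proof (rule that[OF mono cont \<Theta>0 reach le])
    show "Re (B x) > 0" for x using B by simp
    fix x
    have "rot q x = B x * cis (\<Theta> x)" by (simp add: B_def mult.assoc cis_mult)
    moreover have "B x = of_real (Re (B x))" using B[of x] by (simp add: complex_eq_iff)
    ultimately show "rot q x = of_real (Re (B x)) * cis (\<Theta> x)" by simp
  qed
qed

section \<open>Real and imaginary parts of the q-exponential, and the inverse q-tangent\<close>

lemma imag_power: "(\<i> * of_real x) ^ n = (if even n then of_real ((-1) ^ (n div 2) * x ^ n) else \<i> * of_real ((-1) ^ (n div 2) * x ^ n))"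
proof (cases "even n")
  case True
  then obtain k where k: "n = 2 * k" by (elim evenE)
  show ?thesis by (simp add: k power_mult power_mult_distrib power_minus[of "_\<^sup>2"])
next
  case False
  then obtain k where k: "n = 2 * k + 1" by (elim oddE)
  show ?thesis by (simp add: k power_mult power_mult_distrib power_minus[of "_\<^sup>2"])
qed

text \<open>The weights w are 1 for the one-variable functions and the damping factors exp (b_n y)
  for the two-variable ones with q > 1.\<close>

lemma even_odd_series:
  fixes w :: "nat \<Rightarrow> real"
  assumes "(\<lambda>n. ((\<i> * of_real x) ^ n / of_real (d n)) * of_real (w n)) sums s"
  shows "(\<lambda>j. (-1) ^ j * of_real x ^ (2 * j) / of_real (d (2 * j)) * of_real (w (2 * j))) sums (of_real (Re s) :: complex)"
    and "(\<lambda>j. (-1) ^ j * of_real x ^ (2 * j + 1) / of_real (d (2 * j + 1)) * of_real (w (2 * j + 1))) sums (of_real (Im s) :: complex)"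
proof -
  let ?t = "\<lambda>n. ((\<i> * of_real x) ^ n / of_real (d n)) * of_real (w n)"
  have "(\<lambda>j. Re (?t (2 * j))) sums Re s"
  proof (subst sums_mono_reindex)
    show "strict_mono (\<lambda>j :: nat. 2 * j)" by (simp add: strict_mono_def)
    show "(\<lambda>n. Re (?t n)) sums Re s" using assms by (rule sums_Re)
    fix n assume "n \<notin> range (\<lambda>j :: nat. 2 * j)"
    hence "odd n" by (metis evenE rangeI)
    thus "Re (?t n) = 0" unfolding imag_power by simp
  qed
  from sums_of_real[OF this]
  have "(\<lambda>j. of_real (Re (?t (2 * j)))) sums (of_real (Re s) :: complex)" .
  moreover have "of_real (Re (?t (2 * j))) = (-1) ^ j * of_real x ^ (2 * j) / of_real (d (2 * j)) * (of_real (w (2 * j)) :: complex)" for j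
    unfolding imag_power by simp
  ultimately show "(\<lambda>j. (-1) ^ j * of_real x ^ (2 * j) / of_real (d (2 * j)) * of_real (w (2 * j))) sums (of_real (Re s) :: complex)"
    by (simp only:)
  have "(\<lambda>j. Im (?t (2 * j + 1))) sums Im s"
  proof (subst sums_mono_reindex)
    show "strict_mono (\<lambda>j :: nat. 2 * j + 1)" by (simp add: strict_mono_def)
    show "(\<lambda>n. Im (?t n)) sums Im s" using assms by (rule sums_Im)
    fix n assume "n \<notin> range (\<lambda>j :: nat. 2 * j + 1)"
    hence "even n" by (metis oddE rangeI)
    thus "Im (?t n) = 0" unfolding imag_power by simp
  qed
  from sums_of_real[OF this]
  have "(\<lambda>j. of_real (Im (?t (2 * j + 1)))) sums (of_real (Im s) :: complex)" .
  moreover have "of_real (Im (?t (2 * j + 1))) = (-1) ^ j * of_real x ^ (2 * j + 1) / of_real (d (2 * j + 1)) * (of_real (w (2 * j + 1)) :: complex)" for j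
    unfolding imag_power by simp
  ultimately show "(\<lambda>j. (-1) ^ j * of_real x ^ (2 * j + 1) / of_real (d (2 * j + 1)) * of_real (w (2 * j + 1))) sums (of_real (Im s) :: complex)"
    by (simp only:)
qed

lemma cos_q_sin_q_rot:
  assumes "q > 0"
  shows "cos_q q (of_real x) = of_real (Re (rot q x))" "sin_q q (of_real x) = of_real (Im (rot q x))"
proof -
  have "cos_q q (of_real x) = of_real (Re (rot q x)) \<and> sin_q q (of_real x) = of_real (Im (rot q x))"
  proof (cases "q \<ge> 1")
    case True
    have "(\<lambda>n. ((\<i> * of_real x) ^ n / of_real (qfact q n)) * of_real 1) sums rot q x"
      unfolding rot_def using e_q_sums[OF True] by simp
    from even_odd_series[OF this] show ?thesis using True by (simp add: cos_q_def sin_q_def sums_iff)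
  next
    case False
    have "e_q q (- (\<i> * of_real x)) = cnj (rot q x)"
      using rot_cnj_less_1[of q x] assms False by (simp add: rot_def)
    thus ?thesis using False unfolding cos_q_def sin_q_def rot_def[symmetric]
      by (auto simp: complex_eq_iff)
  qed
  thus "cos_q q (of_real x) = of_real (Re (rot q x))" "sin_q q (of_real x) = of_real (Im (rot q x))" by auto
qed

text \<open>In polar form tan_q x = tan (\<Theta> x), and z_c is the point where \<Theta> reaches pi
  / 2. Hence arctan_q r is the point with \<Theta> z = arctan r, and all angles on [0, z] lie in the
  first quadrant.\<close>

lemma arctan_q_props:
  assumes q: "q > 0" and r: "r > 0"
  defines "z \<equiv> arctan_q q r"
  shows "z > 0" "\<And>x. 0 \<le> x \<Longrightarrow> x \<le> z \<Longrightarrow> Re (rot q x) > 0" "\<And>x. 0 \<le> x \<Longrightarrow> x \<le> z \<Longrightarrow> Im (rot q x) \<ge> 0"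
    "Im (rot q z) = r * Re (rot q z)"
proof -
  obtain \<Theta> R where \<Theta>: "strict_mono \<Theta>" "continuous_on UNIV \<Theta>" "\<Theta> 0 = 0" "\<exists>x>0. \<Theta> x = pi / 2"
    and R: "\<And>x. R x > 0" "\<And>x. rot q x = of_real (R x) * cis (\<Theta> x)"
    using rot_polar[OF q] by metis
  obtain X where X: "X > 0" "\<Theta> X = pi / 2" using \<Theta> by blast
  have rot: "Re (rot q x) = R x * cos (\<Theta> x)" "Im (rot q x) = R x * sin (\<Theta> x)" for x
    by (simp_all add: R(2))
  have range: "0 \<le> \<Theta> x \<and> \<Theta> x < pi / 2" if "0 \<le> x" "x < X" for x
    using that strict_mono_less_eq[OF \<Theta>(1), of 0 x] strict_mono_less[OF \<Theta>(1), of x X] \<Theta>(3) X by simp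
  have cos0: "cos_q q (of_real x) = 0 \<longleftrightarrow> cos (\<Theta> x) = 0" for x
    using R(1)[of x] by (simp add: cos_q_sin_q_rot[OF q] rot)
  have zc: "z_c q = X"
    unfolding z_c_def cos0
  proof (rule Least_equality)
    show "0 < X \<and> cos (\<Theta> X) = 0" using X(1) unfolding X(2) by simp
    fix x assume x: "0 < x \<and> cos (\<Theta> x) = 0"
    show "X \<le> x"
    proof (rule ccontr)
      assume "\<not> X \<le> x"
      hence "0 \<le> \<Theta> x \<and> \<Theta> x < pi / 2" using x by (intro range) auto
      hence "cos (\<Theta> x) > 0" by (intro cos_gt_zero_pi) auto
      thus False using x by simp
    qed
  qed
  have tan: "tan_q q x = tan (\<Theta> x)" for x
    using R(1)[of x] by (simp add: tan_q_def cos_q_sin_q_rot[OF q] rot tan_def Re_divide_of_real)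
  obtain t where t: "0 \<le> t" "t \<le> X" "\<Theta> t = arctan r"
    using IVT'[of \<Theta> 0 "arctan r" X] \<Theta>(3) X r continuous_on_subset[OF \<Theta>(2)] arctan_ubound[of r] by (auto simp: less_imp_le)
  have tX: "t < X" using t X arctan_ubound[of r] by (cases "t = X") auto
  have "inj_on (tan_q q) {0..<X}"
  proof (rule inj_onI)
    fix x y assume xy: "x \<in> {0..<X}" "y \<in> {0..<X}" "tan_q q x = tan_q q y"
    hence "\<Theta> x = \<Theta> y" using range[of x] range[of y] unfolding tan
      by (metis arctan_tan atLeastLessThan_iff less_le_trans minus_pi_half_less_zero)
    thus "x = y" using strict_mono_eq[OF \<Theta>(1)] by simp
  qed
  hence "arctan_q q (tan_q q t) = t"
    unfolding arctan_q_def zc by (rule the_inv_into_f_f) (use t tX in auto)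
  moreover have "tan_q q t = r" by (simp add: tan t(3) tan_arctan)
  ultimately have zt: "z = t" by (simp add: z_def)
  show "z > 0" using t r \<Theta>(3) by (cases "t = 0") (auto simp: zt)
  show "Re (rot q x) > 0" if "0 \<le> x" "x \<le> z" for x
    unfolding rot using range[of x] that tX R(1)[of x] by (intro mult_pos_pos cos_gt_zero_pi) (auto simp: zt)
  show "Im (rot q x) \<ge> 0" if "0 \<le> x" "x \<le> z" for x
    unfolding rot using range[of x] that tX R(1)[of x] by (intro mult_nonneg_nonneg sin_ge_zero) (auto simp: zt)
  have "cos (arctan r) \<noteq> 0" by simp
  thus "Im (rot q z) = r * Re (rot q z)"
    unfolding rot zt t(3) using tan_arctan[of r] by (simp add: tan_def field_simps)
qed

text \<open>With \<open>E = C + i S\<close> the two derivatives say \<open>E' y = i q z e^(q y) E (q y)\<close>, the equation into which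
  the eigenvalue equation of the step operator turns on the two half lines.\<close>

definition wave_pair :: "real \<Rightarrow> real \<Rightarrow> (real \<Rightarrow> real) \<Rightarrow> (real \<Rightarrow> real) \<Rightarrow> bool" where
  "wave_pair q z C S \<longleftrightarrow>
     (\<forall>y\<le>0. (C has_real_derivative - (q * z * exp (q * y) * S (q * y))) (at y within {..0})) \<and>
     (\<forall>y\<le>0. (S has_real_derivative q * z * exp (q * y) * C (q * y)) (at y within {..0})) \<and>
     (S \<longlongrightarrow> 0) at_bot \<and> (\<exists>B. \<forall>y\<le>0. C y \<le> B) \<and> (\<forall>y\<le>0. C y > 0) \<and>
     C 0 = Re (rot q z) \<and> S 0 = Im (rot q z) \<and>
     (\<forall>y\<le>0. cos_q2 q (of_real z) y = of_real (C y)) \<and> (\<forall>y\<le>0. sin_q2 q (of_real z) y = of_real (S y))"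

section \<open>Solutions of the delay equation for q = 1, q < 1 and q > 1\<close>

lemma wave_pair_1:
  assumes z: "z > 0" and pos: "\<And>x. 0 \<le> x \<Longrightarrow> x \<le> z \<Longrightarrow> Re (rot 1 x) > 0"
  shows "wave_pair 1 z (\<lambda>y. cos (z * exp y)) (\<lambda>y. sin (z * exp y))"
  unfolding wave_pair_def
proof (intro conjI allI impI)
  show "((\<lambda>y. cos (z * exp y)) has_real_derivative - (1 * z * exp (1 * y) * sin (z * exp (1 * y)))) (at y within {..0})" for y
    by (auto intro!: derivative_eq_intros)
  show "((\<lambda>y. sin (z * exp y)) has_real_derivative 1 * z * exp (1 * y) * cos (z * exp (1 * y))) (at y within {..0})" for y
    by (auto intro!: derivative_eq_intros)
  have "((\<lambda>y :: real. z * exp y) \<longlongrightarrow> z * 0) at_bot" by (intro tendsto_intros exp_at_bot)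
  hence "((\<lambda>y :: real. sin (z * exp y)) \<longlongrightarrow> sin (z * 0)) at_bot" by (rule tendsto_sin)
  thus "((\<lambda>y. sin (z * exp y)) \<longlongrightarrow> 0) at_bot" by simp
  show "\<exists>B. \<forall>y\<le>0. cos (z * exp y) \<le> B" by (intro exI[of _ 1]) auto
  show "cos (z * exp y) > 0" if "y \<le> 0" for y
    using pos[of "z * exp y"] that z by (simp add: rot_1)
  have t: "of_real z * of_real (exp y) = (of_real (z * exp y) :: complex)" for y by simp
  show "cos_q2 1 (of_real z) y = of_real (cos (z * exp y))" for y
    unfolding cos_q2_def t by (simp add: cos_of_real del: of_real_mult)
  show "sin_q2 1 (of_real z) y = of_real (sin (z * exp y))" for y
    unfolding sin_q2_def t by (simp add: sin_of_real del: of_real_mult)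
qed (simp_all add: rot_1)

text \<open>Matches the shape of \<open>cos_q2\<close> and \<open>sin_q2\<close> for q < 1, where
  real data appear as complex terms.\<close>

lemma of_real_poisson:
  fixes a :: "nat \<Rightarrow> real"
  assumes "\<And>m. \<bar>a m\<bar> \<le> B"
  shows "of_real (exp (- s)) * (\<Sum>m. of_real (s ^ m / fact m) * of_real (a m)) = (of_real (poisson a s) :: complex)"
proof -
  have s: "summable (\<lambda>m. (s ^ m / fact m) *\<^sub>R a m)"
    by (rule poisson_summable'[of a B]) (use assms in simp)
  have "(\<Sum>m. of_real ((s ^ m / fact m) *\<^sub>R a m)) = (of_real (\<Sum>m. (s ^ m / fact m) *\<^sub>R a m) :: complex)"
    by (rule suminf_of_real[OF s, symmetric])
  thus ?thesis by (simp add: poisson_def)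
qed

text \<open>C and S are Poisson averages of the real and imaginary part of \<open>rot\<close> at the
  points q^m z. The functional equation of \<open>rot\<close> is a difference equation in m, which
  averaging turns into the delay equation. The real parts increase with m, so the first one bounds C
  away from 0.\<close>

lemma wave_pair_less_1:
  assumes q: "0 < q" "q < 1" and z: "z > 0"
    and pos: "\<And>x. 0 \<le> x \<Longrightarrow> x \<le> z \<Longrightarrow> Re (rot q x) > 0" "\<And>x. 0 \<le> x \<Longrightarrow> x \<le> z \<Longrightarrow> Im (rot q x) \<ge> 0"
  shows "\<exists>C S. wave_pair q z C S"
proof -
  define a where "a m = Re (rot q (q ^ m * z))" for m
  define b where "b m = Im (rot q (q ^ m * z))" for m
  define s where "s y = - (q * y / (1 - q))" for y
  have X: "(\<lambda>m. q ^ m * z) \<longlonglongrightarrow> 0"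
    using q by (intro tendsto_mult_left_zero LIMSEQ_realpow_zero) auto
  have lim: "(\<lambda>m. rot q (q ^ m * z)) \<longlonglongrightarrow> 1" by (rule rot_tendsto_1[OF q(1) X])
  have a_lim: "a \<longlonglongrightarrow> 1" and b_lim: "b \<longlonglongrightarrow> 0"
    using tendsto_Re[OF lim] tendsto_Im[OF lim] by (simp_all add: a_def[abs_def] b_def[abs_def])
  obtain A where A: "A > 0" "\<And>m. \<bar>a m\<bar> \<le> A"
    using convergent_imp_Bseq[OF convergentI[OF a_lim]] unfolding Bseq_def real_norm_def by blast
  obtain D where D: "D > 0" "\<And>m. \<bar>b m\<bar> \<le> D"
    using convergent_imp_Bseq[OF convergentI[OF b_lim]] unfolding Bseq_def real_norm_def by blast
  have na: "norm (a m) \<le> A" "norm (b m) \<le> D" for m using A D by simp_all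
  have range: "0 \<le> q ^ m * z" "q ^ m * z \<le> z" for m
    using q z by (auto simp: mult_left_le_one_le power_le_one)
  have a_pos: "a m > 0" and b_nonneg: "b m \<ge> 0" for m
    using pos[OF range] by (simp_all add: a_def b_def)
  have step: "rot q (q ^ m * z) - \<i> * of_real ((1 - q) * (q ^ m * z)) * rot q (q ^ m * z) = rot q (q ^ Suc m * z)" for m
    using rot_step_less_1[OF q, of "q ^ m * z"] by (simp add: algebra_simps)
  have a_Suc: "a (Suc m) - a m = (z * (1 - q)) * (q ^ m *\<^sub>R b m)" for m
    using arg_cong[OF step[of m], of Re] by (simp add: a_def b_def algebra_simps)
  have b_Suc: "b (Suc m) - b m = - (z * (1 - q)) * (q ^ m *\<^sub>R a m)" for m
    using arg_cong[OF step[of m], of Im] by (simp add: a_def b_def algebra_simps)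
  define C where "C y = poisson a (s y)" for y
  define S where "S y = poisson b (s y)" for y
  have s': "(s has_real_derivative - (q / (1 - q))) (at y within T)" for y T
    unfolding s_def using q by (auto intro!: derivative_eq_intros)
  have sq: "q * s y = s (q * y)" "(1 - q) * s y = - (q * y)" for y
    using q by (simp_all add: s_def)
  have s_nonneg: "s y \<ge> 0" if "y \<le> 0" for y
    using q that by (simp add: s_def divide_nonpos_pos mult_nonneg_nonpos)
  have pq: "norm (q ^ m *\<^sub>R c m) \<le> K" if "\<And>m. norm (c m) \<le> K" for c :: "nat \<Rightarrow> real" and K m
  proof -
    have "q ^ m * \<bar>c m\<bar> \<le> 1 * K" using q that[of m] by (intro mult_mono) (auto simp: power_le_one)
    thus ?thesis using q by (simp add: abs_mult)
  qed
  have deriv: "((\<lambda>y. poisson f (s y)) has_real_derivative - (q / (1 - q)) * (k * (exp (q * y) * poisson g (s (q * y))))) (at y within T)"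
    if f: "\<And>m. norm (f m) \<le> K" and g: "\<And>m. norm (g m) \<le> K'" and fg: "\<And>m. f (Suc m) - f m = k * (q ^ m *\<^sub>R g m)"
    for f g :: "nat \<Rightarrow> real" and k K K' y T
  proof -
    have "(poisson f has_real_derivative poisson (\<lambda>m. f (Suc m) - f m) (s y)) (at (s y))"
      using poisson_has_vector_derivative[of f K "s y" UNIV, OF f] by (simp add: has_real_derivative_iff_has_vector_derivative)
    also have "poisson (\<lambda>m. f (Suc m) - f m) (s y) = k * poisson (\<lambda>m. q ^ m *\<^sub>R g m) (s y)"
      unfolding fg by (rule poisson_mult[of _ K']) (rule pq[OF g])
    also have "poisson (\<lambda>m. q ^ m *\<^sub>R g m) (s y) = exp (q * y) * poisson g (s (q * y))"
      unfolding poisson_scale sq by simp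
    finally have "(poisson f has_real_derivative k * (exp (q * y) * poisson g (s (q * y)))) (at (s y))" .
    from DERIV_chain2[OF this s'] show ?thesis by (simp add: mult.commute)
  qed
  have C': "(C has_real_derivative - (q * z * exp (q * y) * S (q * y))) (at y within {..0})" for y
    using deriv[OF na(1) na(2) a_Suc, of y "{..0}"] q unfolding C_def[abs_def] S_def by (simp add: mult_ac)
  have S': "(S has_real_derivative q * z * exp (q * y) * C (q * y)) (at y within {..0})" for y
    using deriv[OF na(2) na(1) b_Suc, of y "{..0}"] q unfolding S_def[abs_def] C_def by (simp add: mult_ac)
  \<comment> \<open>b - z A q^m increases by the difference equation, as a \<le> A, and tends to 0;
    hence it is never positive.\<close>
  have b_le: "b m \<le> z * A * q ^ m" for m
  proof -
    define c where "c m = b m - z * A * q ^ m" for m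
    have "incseq c"
    proof (rule incseq_SucI)
      fix m
      have "c (Suc m) - c m = (b (Suc m) - b m) + z * (1 - q) * A * q ^ m" by (simp add: c_def algebra_simps)
      also have "\<dots> = z * (1 - q) * q ^ m * (A - a m)" unfolding b_Suc by (simp add: algebra_simps)
      also have "\<dots> \<ge> 0" using z q abs_le_D1[OF A(2)[of m]] by (intro mult_nonneg_nonneg) auto
      finally show "c m \<le> c (Suc m)" by simp
    qed
    moreover have "c \<longlonglongrightarrow> 0 - z * A * 0"
      unfolding c_def[abs_def] using q by (intro tendsto_intros b_lim LIMSEQ_realpow_zero) auto
    ultimately have "c m \<le> 0" using incseq_le by fastforce
    thus ?thesis by (simp add: c_def)
  qed
  \<comment> \<open>Taking the weight q^m out of b by thinning leaves a bounded sequence and the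
    decaying factor exp (q y).\<close>
  have S_bound: "norm (S y) \<le> exp (q * y) * (z * A)" if "y \<le> 0" for y
  proof -
    have "q ^ m *\<^sub>R (b m / q ^ m) = b m" for m using q by simp
    hence "S y = poisson (\<lambda>m. q ^ m *\<^sub>R (b m / q ^ m)) (s y)" by (simp add: S_def)
    also have "\<dots> = exp (q * y) *\<^sub>R poisson (\<lambda>m. b m / q ^ m) (s (q * y))"
      unfolding poisson_scale sq by simp
    finally have "norm (S y) = exp (q * y) * norm (poisson (\<lambda>m. b m / q ^ m) (s (q * y)))" by (simp add: abs_mult)
    moreover have "norm (poisson (\<lambda>m. b m / q ^ m) (s (q * y))) \<le> z * A"
    proof (rule norm_poisson_le)
      show "norm (b m / q ^ m) \<le> z * A" for m
        using b_le[of m] b_nonneg[of m] q by (simp add: pos_divide_le_eq)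
      show "0 \<le> s (q * y)" using q that by (intro s_nonneg) (simp add: mult_nonneg_nonpos)
    qed
    ultimately show ?thesis by simp
  qed
  have S_lim: "(S \<longlongrightarrow> 0) at_bot"
  proof (rule Lim_null_comparison)
    show "\<forall>\<^sub>F y in at_bot. norm (S y) \<le> exp (q * y) * (z * A)"
      using eventually_le_at_bot[of 0] by eventually_elim (rule S_bound)
    have "((\<lambda>y. exp (q * y)) \<longlongrightarrow> 0) at_bot"
      using q by (intro filterlim_compose[OF exp_at_bot] filterlim_tendsto_pos_mult_at_bot[OF tendsto_const] filterlim_ident) auto
    from tendsto_mult_right[OF this, of "z * A"] show "((\<lambda>y. exp (q * y) * (z * A)) \<longlongrightarrow> 0) at_bot" by simp
  qed
  have C_le: "C y \<le> A" if "y \<le> 0" for y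
    using norm_poisson_le[of a A, OF na(1) s_nonneg[OF that]] by (simp add: C_def)
  have a_ge: "a m \<ge> a 0" for m
  proof (induction m)
    case (Suc m)
    have "a (Suc m) - a m \<ge> 0" unfolding a_Suc using z q b_nonneg[of m] by simp
    thus ?case using Suc by simp
  qed simp
  have C_pos: "C y > 0" if "y \<le> 0" for y
    using poisson_ge[of a A "a 0", OF A(2) a_ge s_nonneg[OF that]] a_pos[of 0] by (simp add: C_def)
  have e: "exp (q * y / (1 - q)) = exp (- s y)" "- (q * y / (1 - q)) = s y" for y by (simp_all add: s_def)
  have "cos_q q (of_real (q ^ m) * of_real z) = of_real (a m)" "sin_q q (of_real (q ^ m) * of_real z) = of_real (b m)" for m
    unfolding of_real_mult[symmetric] cos_q_sin_q_rot[OF q(1)] a_def b_def by (rule refl)+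
  hence "cos_q2 q (of_real z) y = of_real (C y)" "sin_q2 q (of_real z) y = of_real (S y)" for y
    using q of_real_poisson[of a A "s y", OF A(2)] of_real_poisson[of b D "s y", OF D(2)]
    unfolding cos_q2_def sin_q2_def e C_def S_def by simp_all
  moreover have "C 0 = Re (rot q z)" "S 0 = Im (rot q z)"
    by (simp_all add: C_def S_def s_def a_def b_def)
  ultimately have "wave_pair q z C S"
    unfolding wave_pair_def using C' S' S_lim C_le C_pos by blast
  thus ?thesis by blast
qed

text \<open>For y \<le> 0 each exponential is at most 1, so summability of the coefficients gives
  uniform convergence on {..0}; the derivative at 0 is accordingly one-sided.\<close>

lemma exp_series_deriv:
  fixes d :: "nat \<Rightarrow> real"
  assumes q: "q > 0" "q \<noteq> 1" and d: "summable (\<lambda>n. \<bar>d n\<bar>)" "summable (\<lambda>n. \<bar>d n * qexponent q n\<bar>)" and y: "y \<le> 0"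
  shows "((\<lambda>y. \<Sum>n. d n * exp (qexponent q n * y)) has_real_derivative (\<Sum>n. d n * qexponent q n * exp (qexponent q n * y))) (at y within {..0})"
proof -
  have le1: "exp (qexponent q n * y) \<le> 1" if "y \<le> 0" for n y
    using qexponent_nonneg[OF q, of n] that by (simp add: mult_nonneg_nonpos)
  have "\<exists>g. \<forall>y\<in>{..0}. (\<lambda>n. d n * exp (qexponent q n * y)) sums g y \<and>
      (g has_field_derivative (\<Sum>n. d n * qexponent q n * exp (qexponent q n * y))) (at y within {..0})"
  proof (rule has_field_derivative_series)
    show "uniform_limit {..0} (\<lambda>n y. \<Sum>i<n. d i * qexponent q i * exp (qexponent q i * y)) (\<lambda>y. \<Sum>n. d n * qexponent q n * exp (qexponent q n * y)) sequentially"
    proof (rule Weierstrass_m_test)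
      fix n and y :: real assume "y \<in> {..0}"
      thus "norm (d n * qexponent q n * exp (qexponent q n * y)) \<le> \<bar>d n * qexponent q n\<bar>"
        using le1[of y n] by (simp add: abs_mult mult_left_le)
    qed (rule d)
    show "((\<lambda>y. d n * exp (qexponent q n * y)) has_field_derivative d n * qexponent q n * exp (qexponent q n * y)) (at y within {..0})" for n y
      by (auto intro!: derivative_eq_intros)
    show "summable (\<lambda>n. d n * exp (qexponent q n * 0))" using summable_rabs_cancel[OF d(1)] by simp
  qed auto
  then obtain g where "\<forall>y\<in>{..0}. (\<lambda>n. d n * exp (qexponent q n * y)) sums g y \<and>
      (g has_field_derivative (\<Sum>n. d n * qexponent q n * exp (qexponent q n * y))) (at y within {..0})" ..
  hence g: "(\<lambda>n. d n * exp (qexponent q n * y)) sums g y"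
      "(g has_field_derivative (\<Sum>n. d n * qexponent q n * exp (qexponent q n * y))) (at y within {..0})" if "y \<le> 0" for y
    using that by simp_all
  show ?thesis
  proof (rule has_field_derivative_transform_within[OF g(2)[OF y] zero_less_one])
    show "g x = (\<Sum>n. d n * exp (qexponent q n * x))" if "x \<in> {..0}" for x
      using that by (intro sums_unique g(1)) simp
  qed (use y in simp)
qed

text \<open>Positivity of \<open>C = F z\<close> follows by continuity in \<open>x \<le> z\<close>: as soon as \<open>F x\<close> is nonnegative on the
  negative half line, \<open>G x\<close> increases from \<open>0\<close>, hence \<open>F x\<close> decreases to \<open>F x 0 > 0\<close>, so that its infimum
  cannot vanish.\<close>

lemma wave_pair_gt_1:
  assumes q: "q > 1" and z: "z > 0"
    and pos: "\<And>x. 0 \<le> x \<Longrightarrow> x \<le> z \<Longrightarrow> Re (rot q x) > 0"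
  shows "\<exists>C S. wave_pair q z C S"
proof -
  have q': "q > 0" "q \<noteq> 1" using q by auto
  let ?b = "qexponent q"
  \<comment> \<open>The real and imaginary parts of i^n let C and S be treated by common estimates
    with an arbitrary coefficient sequence u bounded by 1.\<close>
  define \<sigma> where "\<sigma> n = Re (\<i> ^ n)" for n
  define \<tau> where "\<tau> n = Im (\<i> ^ n)" for n
  have st: "\<bar>\<sigma> n\<bar> \<le> 1" "\<bar>\<tau> n\<bar> \<le> 1" for n
    using abs_Re_le_cmod[of "\<i> ^ n"] abs_Im_le_cmod[of "\<i> ^ n"] by (simp_all add: \<sigma>_def \<tau>_def norm_power)
  have st_Suc: "\<sigma> (Suc n) = - \<tau> n" "\<tau> (Suc n) = \<sigma> n" for n by (simp_all add: \<sigma>_def \<tau>_def)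
  define t where "t x n = x ^ n / qfact q n" for x n
  have t_nonneg: "t x n \<ge> 0" if "x \<ge> 0" for x n
    using that qfact_pos[OF q'(1), of n] by (simp add: t_def)
  have t_summ: "summable (t x)" for x
    unfolding t_def[abs_def] by (rule qexp_summable[OF q])
  have t_Suc: "t x (Suc n) * ?b (Suc n) = q * x * t x n" for x n
    using qfact_pos[OF q'(1), of n] qnumber_pos[OF q', of n]
    by (simp add: t_def qfact_Suc[OF q'(2)] qexponent_Suc[OF q'(2)] one_plus_qexponent[OF q'(2)])
  have summ: "summable (\<lambda>n. \<bar>u n * t x n\<bar>)" if "\<And>n. \<bar>u n\<bar> \<le> 1" "x \<ge> 0" for u x
  proof (rule summable_comparison_test'[OF t_summ[of x]])
    fix n :: nat
    have "\<bar>u n\<bar> * t x n \<le> 1 * t x n" using that(1) t_nonneg[OF that(2)] by (rule mult_right_mono)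
    thus "norm \<bar>u n * t x n\<bar> \<le> t x n" using t_nonneg[OF that(2), of n] by (simp add: abs_mult)
  qed
  have summ': "summable (\<lambda>n. \<bar>u n * t x n * ?b n\<bar>)" if "\<And>n. \<bar>u n\<bar> \<le> 1" "x \<ge> 0" for u x
  proof (rule summable_Suc_iff[THEN iffD1])
    have "\<bar>u (Suc n) * t x (Suc n) * ?b (Suc n)\<bar> = q * x * \<bar>u (Suc n) * t x n\<bar>" for n
      using t_Suc[of x n] q that by (simp add: mult.assoc abs_mult)
    thus "summable (\<lambda>n. \<bar>u (Suc n) * t x (Suc n) * ?b (Suc n)\<bar>)"
      using summable_mult[OF summ[of "\<lambda>n. u (Suc n)" x], of "q * x"] that by simp
  qed
  define F where "F x y = (\<Sum>n. \<sigma> n * t x n * exp (?b n * y))" for x y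
  define G where "G x y = (\<Sum>n. \<tau> n * t x n * exp (?b n * y))" for x y
  have le1: "exp (?b n * y) \<le> 1" if "y \<le> 0" for n y
    using qexponent_nonneg[OF q', of n] that by (simp add: mult_nonneg_nonpos)
  have damp: "norm (v * exp (?b n * y)) \<le> \<bar>v\<bar>" if "y \<le> 0" for v y n
    using mult_left_mono[OF le1[OF that, of n], of "\<bar>v\<bar>"] by (simp add: abs_mult)
  have esumm: "summable (\<lambda>n. u n * t x n * exp (?b n * y))" if "\<And>n. \<bar>u n\<bar> \<le> 1" "x \<ge> 0" "y \<le> 0" for u x y
    by (rule summable_comparison_test'[OF summ[where u = u, OF that(1,2)]]) (rule damp[OF that(3)])
  \<comment> \<open>b_(n+1) cancels against the factorial and exp (b_(n+1) y) = exp (q y) exp (b_n q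
    y), so the derivative is the series at q y with u shifted by one. For the powers of i the shift
    is multiplication by i, which exchanges F and G up to sign.\<close>
  have shift: "(\<Sum>n. u n * t x n * ?b n * exp (?b n * y)) = q * x * exp (q * y) * (\<Sum>n. u (Suc n) * t x n * exp (?b n * (q * y)))"
    if u: "\<And>n. \<bar>u n\<bar> \<le> 1" and x: "x \<ge> 0" and y: "y \<le> 0" for u x y
  proof -
    have s: "summable (\<lambda>n. u n * t x n * ?b n * exp (?b n * y))"
      by (rule summable_comparison_test'[OF summ'[where u = u, OF u x]]) (rule damp[OF y])
    have qy: "q * y \<le> 0" using q y by (simp add: mult_nonneg_nonpos)
    have eq: "u (Suc n) * t x (Suc n) * ?b (Suc n) * exp (?b (Suc n) * y) = q * x * exp (q * y) * (u (Suc n) * t x n * exp (?b n * (q * y)))" for n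
    proof -
      have "exp (?b (Suc n) * y) = exp (q * y) * exp (?b n * (q * y))"
        using q by (simp add: qexponent_Suc exp_add[symmetric] algebra_simps)
      moreover have "u (Suc n) * t x (Suc n) * ?b (Suc n) = u (Suc n) * (q * x * t x n)"
        by (simp add: mult.assoc t_Suc)
      ultimately show ?thesis by (simp add: mult_ac)
    qed
    have "(\<Sum>n. u n * t x n * ?b n * exp (?b n * y)) = (\<Sum>n. u (Suc n) * t x (Suc n) * ?b (Suc n) * exp (?b (Suc n) * y))"
      using suminf_split_head[OF s] by simp
    also have "\<dots> = q * x * exp (q * y) * (\<Sum>n. u (Suc n) * t x n * exp (?b n * (q * y)))"
      unfolding eq by (rule suminf_mult[OF esumm[where u = "\<lambda>n. u (Suc n)", OF u x qy]])
    finally show ?thesis .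
  qed
  have F': "(F x has_real_derivative - (q * x * exp (q * y) * G x (q * y))) (at y within {..0})" if "x \<ge> 0" "y \<le> 0" for x y
  proof -
    have "(\<Sum>n. \<sigma> (Suc n) * t x n * exp (?b n * (q * y))) = - G x (q * y)"
      unfolding st_Suc G_def using q that by (subst suminf_minus[symmetric]) (auto intro!: esumm st simp: mult_nonneg_nonpos)
    thus ?thesis
      using exp_series_deriv[OF q' summ[where u = \<sigma>, OF st(1) that(1)] summ'[where u = \<sigma>, OF st(1) that(1)] that(2)] shift[where u = \<sigma>, OF st(1) that]
      by (simp add: F_def[abs_def])
  qed
  have G': "(G x has_real_derivative q * x * exp (q * y) * F x (q * y)) (at y within {..0})" if "x \<ge> 0" "y \<le> 0" for x y
    using exp_series_deriv[OF q' summ[where u = \<tau>, OF st(2) that(1)] summ'[where u = \<tau>, OF st(2) that(1)] that(2)] shift[where u = \<tau>, OF st(2) that]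
    by (simp add: G_def[abs_def] F_def st_Suc)
  have G_lim: "(G x \<longlongrightarrow> 0) at_bot" if "x \<ge> 0" for x
    using exp_series_at_bot[OF q' summ[where u = \<tau>, OF st(2) that]] by (simp add: G_def[abs_def] \<tau>_def)
  define e where "e x = (\<Sum>n. t x n)" for x
  have e_cont: "continuous_on A e" for A
  proof -
    have "isCont (\<lambda>x. \<Sum>n. 1 / qfact q n * x ^ n) x" for x
      by (rule isCont_powser_converges_everywhere) (use qexp_summable[OF q] in simp)
    moreover have "(\<lambda>x. \<Sum>n. 1 / qfact q n * x ^ n) = e"
      by (auto simp: e_def t_def)
    ultimately show ?thesis by (simp add: continuous_at_imp_continuous_on)
  qed
  have F_abs: "\<bar>F x y\<bar> \<le> e x" if "x \<ge> 0" "y \<le> 0" for x y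
  proof -
    have b: "\<bar>\<sigma> n * t x n * exp (?b n * y)\<bar> \<le> t x n" for n
    proof -
      have "\<bar>\<sigma> n\<bar> * t x n * exp (?b n * y) \<le> 1 * t x n * 1"
        using st(1)[of n] t_nonneg[OF that(1)] le1[OF that(2)] by (intro mult_mono) auto
      thus ?thesis using t_nonneg[OF that(1)] by (simp add: abs_mult)
    qed
    have s: "summable (\<lambda>n. \<bar>\<sigma> n * t x n * exp (?b n * y)\<bar>)"
      by (rule summable_comparison_test'[OF t_summ[of x]]) (use b in simp)
    have "\<bar>F x y\<bar> \<le> (\<Sum>n. \<bar>\<sigma> n * t x n * exp (?b n * y)\<bar>)" unfolding F_def by (rule summable_rabs[OF s])
    also have "\<dots> \<le> e x" unfolding e_def by (intro suminf_le b s t_summ)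
    finally show ?thesis .
  qed
  \<comment> \<open>The monotone majorant e controls increments in x uniformly in y; this makes the
    infimum over y continuous in x.\<close>
  have F_diff: "\<bar>F x y - F x' y\<bar> \<le> e x - e x'" if "0 \<le> x'" "x' \<le> x" "y \<le> 0" for x x' y
  proof -
    have x: "0 \<le> x" using that by simp
    have tm: "t x' n \<le> t x n" for n
      using that qfact_pos[OF q'(1), of n] by (simp add: t_def divide_right_mono power_mono)
    have b: "\<bar>\<sigma> n * t x n * exp (?b n * y) - \<sigma> n * t x' n * exp (?b n * y)\<bar> \<le> t x n - t x' n" for n
    proof -
      have "\<bar>\<sigma> n\<bar> * (t x n - t x' n) * exp (?b n * y) \<le> 1 * (t x n - t x' n) * 1"
        using st(1)[of n] tm[of n] le1[OF that(3)] by (intro mult_mono) auto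
      moreover have "\<sigma> n * t x n * exp (?b n * y) - \<sigma> n * t x' n * exp (?b n * y) = \<sigma> n * (t x n - t x' n) * exp (?b n * y)"
        by (simp add: algebra_simps)
      ultimately show ?thesis using tm[of n] by (simp add: abs_mult)
    qed
    have sd: "summable (\<lambda>n. t x n - t x' n)" by (intro summable_diff t_summ)
    have s: "summable (\<lambda>n. \<bar>\<sigma> n * t x n * exp (?b n * y) - \<sigma> n * t x' n * exp (?b n * y)\<bar>)"
      by (rule summable_comparison_test'[OF sd]) (use b in simp)
    have "F x y - F x' y = (\<Sum>n. \<sigma> n * t x n * exp (?b n * y) - \<sigma> n * t x' n * exp (?b n * y))"
      unfolding F_def by (intro suminf_diff esumm st x that)
    hence "\<bar>F x y - F x' y\<bar> \<le> (\<Sum>n. \<bar>\<sigma> n * t x n * exp (?b n * y) - \<sigma> n * t x' n * exp (?b n * y)\<bar>)"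
      using summable_rabs[OF s] by simp
    also have "\<dots> \<le> (\<Sum>n. t x n - t x' n)" by (intro suminf_le b s sd)
    also have "\<dots> = e x - e x'" unfolding e_def by (intro suminf_diff[symmetric] t_summ)
    finally show ?thesis .
  qed
  have sums: "(\<lambda>n. ((\<i> * of_real x) ^ n / of_real (qfact q n)) * of_real (exp (?b n * y))) sums Complex (F x y) (G x y)"
    if "x \<ge> 0" "y \<le> 0" for x y
  proof (rule sums_complex_iff[THEN iffD2], intro conjI)
    have "Re (((\<i> * of_real x) ^ n / of_real (qfact q n)) * of_real (exp (?b n * y))) = \<sigma> n * t x n * exp (?b n * y)"
         "Im (((\<i> * of_real x) ^ n / of_real (qfact q n)) * of_real (exp (?b n * y))) = \<tau> n * t x n * exp (?b n * y)" for n
    proof -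
      have "((\<i> * of_real x) ^ n / of_real (qfact q n)) * of_real (exp (?b n * y)) = \<i> ^ n * of_real (t x n * exp (?b n * y))"
        by (simp add: t_def power_mult_distrib)
      thus "Re (((\<i> * of_real x) ^ n / of_real (qfact q n)) * of_real (exp (?b n * y))) = \<sigma> n * t x n * exp (?b n * y)"
         "Im (((\<i> * of_real x) ^ n / of_real (qfact q n)) * of_real (exp (?b n * y))) = \<tau> n * t x n * exp (?b n * y)"
        by (simp_all add: \<sigma>_def \<tau>_def del: of_real_mult)
    qed
    thus "(\<lambda>n. Re (((\<i> * of_real x) ^ n / of_real (qfact q n)) * of_real (exp (?b n * y)))) sums Re (Complex (F x y) (G x y))"
      "(\<lambda>n. Im (((\<i> * of_real x) ^ n / of_real (qfact q n)) * of_real (exp (?b n * y)))) sums Im (Complex (F x y) (G x y))"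
      using summable_sums[OF esumm[where u = \<sigma>, OF st(1) that]] summable_sums[OF esumm[where u = \<tau>, OF st(2) that]] by (simp_all add: F_def G_def)
  qed
  have rotF: "rot q x = Complex (F x 0) (G x 0)" if "x \<ge> 0" for x
    using sums_unique2[OF e_q_sums[of q "\<i> * of_real x"]] sums[OF that, of 0] q by (simp add: rot_def)

  \<comment> \<open>Pointwise positivity could get lost at y = - infinity; the infimum over the
    whole half line is continuous in x and can only change sign through a zero.\<close>
  define m where "m x = (INF y\<in>{..0}. F x y)" for x
  have bdd: "bdd_below (F x ` {..0})" if "x \<ge> 0" for x
    using F_abs[OF that] by (intro bdd_belowI2[of _ "- e x"]) (force simp: abs_le_iff)
  have m_le: "m x \<le> F x y" if "x \<ge> 0" "y \<le> 0" for x y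
    unfolding m_def using that by (intro cINF_lower bdd) auto
  have m_ge: "m x \<ge> c" if "\<And>y. y \<le> 0 \<Longrightarrow> F x y \<ge> c" for x c
    unfolding m_def using that by (intro cINF_greatest) auto
  have F_diff': "\<bar>F x y - F x' y\<bar> \<le> \<bar>e x - e x'\<bar>" if "x \<ge> 0" "x' \<ge> 0" "y \<le> 0" for x x' y
  proof (cases "x' \<le> x")
    case True
    thus ?thesis using F_diff[of x' x y] that by linarith
  next
    case False
    thus ?thesis using F_diff[of x x' y] that by linarith
  qed
  have m_diff: "m x \<le> m x' + \<bar>e x - e x'\<bar>" if "x \<ge> 0" "x' \<ge> 0" for x x'
  proof -
    have "F x' y \<ge> m x - \<bar>e x - e x'\<bar>" if "y \<le> 0" for y
      using m_le[OF \<open>x \<ge> 0\<close> that] F_diff'[OF \<open>x \<ge> 0\<close> \<open>x' \<ge> 0\<close> that] by linarith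
    from m_ge[OF this] show ?thesis by linarith
  qed
  have m_dist: "dist (m x) (m x') \<le> dist (e x) (e x')" if "x \<ge> 0" "x' \<ge> 0" for x x'
    using m_diff[OF that] m_diff[OF that(2,1)] unfolding dist_real_def by linarith
  have m_cont: "continuous_on {0..z} m"
    unfolding continuous_on_iff
  proof (intro ballI allI impI)
    fix x \<epsilon> :: real assume x: "x \<in> {0..z}" and \<epsilon>: "\<epsilon> > 0"
    then obtain d where d: "d > 0" "\<And>x'. x' \<in> {0..z} \<Longrightarrow> dist x' x < d \<Longrightarrow> dist (e x') (e x) < \<epsilon>"
      using e_cont[of "{0..z}"] unfolding continuous_on_iff by blast
    show "\<exists>d>0. \<forall>x'\<in>{0..z}. dist x' x < d \<longrightarrow> dist (m x') (m x) < \<epsilon>"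
    proof (intro exI[of _ d] conjI ballI impI d(1))
      fix x' assume x': "x' \<in> {0..z}" "dist x' x < d"
      have "dist (m x') (m x) \<le> dist (e x') (e x)" using x x' by (intro m_dist) auto
      also have "\<dots> < \<epsilon>" using d(2)[OF x'] .
      finally show "dist (m x') (m x) < \<epsilon>" .
    qed
  qed
  have m_nz: "m x \<noteq> 0" if x: "0 \<le> x" "x \<le> z" for x
  proof
    assume m0: "m x = 0"
    have Fn: "F x y \<ge> 0" if "y \<le> 0" for y using m_le[OF x(1) that] m0 by simp
    have Gm: "G x a \<le> G x b" if "a \<le> b" "b \<le> 0" for a b
    proof (rule nondecreasing_of_deriv_nonneg[OF _ _ that])
      show "(G x has_real_derivative q * x * exp (q * y) * F x (q * y)) (at y within {..0})" if "y \<le> 0" for y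
        by (rule G'[OF x(1) that])
      show "q * x * exp (q * y) * F x (q * y) \<ge> 0" if "y \<le> 0" for y
        using q x that Fn[of "q * y"] by (simp add: mult_nonneg_nonpos)
    qed
    have Gn: "G x y \<ge> 0" if "y \<le> 0" for y
    proof (rule tendsto_upperbound[OF G_lim[OF x(1)]])
      show "\<forall>\<^sub>F a in at_bot. G x a \<le> G x y"
        using eventually_le_at_bot[of y] by eventually_elim (rule Gm[OF _ that])
    qed simp
    have "F x y \<ge> F x 0" if "y \<le> 0" for y
    proof -
      have "- F x y \<le> - F x 0"
      proof (rule nondecreasing_of_deriv_nonneg[OF _ _ that order.refl])
        show "((\<lambda>y. - F x y) has_real_derivative q * x * exp (q * y) * G x (q * y)) (at y within {..0})" if "y \<le> 0" for y
          using DERIV_minus[OF F'[OF x(1) that]] by simp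
        show "q * x * exp (q * y) * G x (q * y) \<ge> 0" if "y \<le> 0" for y
          using q x that Gn[of "q * y"] by (simp add: mult_nonneg_nonpos)
      qed
      thus ?thesis by simp
    qed
    hence "m x \<ge> F x 0" by (rule m_ge)
    moreover have "F x 0 > 0" using pos[OF x] rotF[OF x(1)] by simp
    ultimately show False using m0 by simp
  qed
  have m0: "m 0 \<ge> 1"
  proof (rule m_ge)
    fix y :: real
    have "F 0 y = 1" unfolding F_def t_def by (subst suminf_finite[of "{0}"]) (auto simp: \<sigma>_def power_0_left)
    thus "F 0 y \<ge> 1" by simp
  qed
  have mz: "m z > 0"
  proof (rule ccontr)
    assume "\<not> m z > 0"
    then obtain x where "0 \<le> x" "x \<le> z" "m x = 0"
      using IVT2'[of m z 0 0] m0 z m_cont by auto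
    thus False using m_nz by blast
  qed
  have z0: "z \<ge> 0" using z by simp
  have C_pos: "F z y > 0" if "y \<le> 0" for y using m_le[OF z0 that] mz by simp
  have C_le: "F z y \<le> e z" if "y \<le> 0" for y using F_abs[OF z0 that] by simp
  have trig: "cos_q2 q (of_real z) y = of_real (F z y)" "sin_q2 q (of_real z) y = of_real (G z y)" if "y \<le> 0" for y
    using even_odd_series[OF sums[OF z0 that]] q
    unfolding cos_q2_def sin_q2_def by (auto simp: qexponent_def sums_iff)
  have "wave_pair q z (F z) (G z)"
    unfolding wave_pair_def
    using F'[OF z0] G'[OF z0] G_lim[OF z0] C_pos C_le trig rotF[OF z0] by (auto intro!: exI[of _ "e z"])
  thus ?thesis by blast
qed

lemma ground_state_iii:
  assumes \<theta>: "\<theta> < 0" and \<xi>: "\<xi> \<in> {0<..<1}"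
    and lam: "lam = sqrt (\<xi> * (1 - \<xi>)) / arctan_q (- \<theta>) (sqrt (\<xi> / (1 - \<xi>)))"
  shows "\<exists>c K K'. ground_state \<theta> \<xi> lam c K K' UNIV (h_iii \<theta> \<xi>)"
proof -
  define q where "q = - \<theta>"
  define r where "r = sqrt (\<xi> / (1 - \<xi>))"
  define z where "z = arctan_q q r"
  have q: "q > 0" using \<theta> by (simp add: q_def)
  have r: "r > 0" using \<xi> by (simp add: r_def)
  note props = arctan_q_props[OF q r, folded z_def]
  have "\<exists>C S. wave_pair q z C S"
    using wave_pair_1[OF props(1)] wave_pair_less_1[OF q _ props(1)] wave_pair_gt_1[OF _ props(1)] props(2,3)
    by (cases q "1 :: real" rule: linorder_cases) blast+
  then obtain C S where CS: "wave_pair q z C S" by blast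
  then obtain B where B: "\<And>y. y \<le> 0 \<Longrightarrow> C y \<le> B" unfolding wave_pair_def by blast
  have "\<exists>c K K'. ground_state (- q) \<xi> lam c K K' UNIV (h_iii \<theta> \<xi>)"
  proof (rule ground_state_of_delay_equations[OF q \<xi> props(1)])
    show "(C has_real_derivative - (q * z * exp (q * y) * S (q * y))) (at y within {..0})" if "y \<le> 0" for y
      using CS that unfolding wave_pair_def by blast
    show "(S has_real_derivative q * z * exp (q * y) * C (q * y)) (at y within {..0})" if "y \<le> 0" for y
      using CS that unfolding wave_pair_def by blast
    show "(S \<longlongrightarrow> 0) at_bot" using CS unfolding wave_pair_def by blast
    show "C y > 0" if "y \<le> 0" for y using CS that unfolding wave_pair_def by blast
    show "S 0 = sqrt (\<xi> / (1 - \<xi>)) * C 0"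
      using CS props(4) unfolding wave_pair_def r_def by simp
    show "lam = sqrt (\<xi> * (1 - \<xi>)) / z" by (simp add: lam z_def q_def r_def)
    have "cos_q2 q (of_real z) y = of_real (C y)" "sin_q2 q (of_real z) y = of_real (S y)" if "y \<le> 0" for y
      using CS that unfolding wave_pair_def by blast+
    thus "h_iii \<theta> \<xi> = (\<lambda>x. if x > 0 then C (- x) else sqrt (1 - \<xi>) / sqrt \<xi> * S x)"
      unfolding h_iii_def q_def[symmetric] r_def[symmetric] z_def[symmetric] by (auto simp: fun_eq_iff)
  qed (rule B)
  thus ?thesis by (simp add: q_def)
qed

theorem theorem1p1:
  fixes \<theta> \<xi> lam :: real and \<Omega> :: "real set" and h :: "real \<Rightarrow> real"
  assumes "\<theta> \<noteq> 1" and "\<xi> \<in> {0..1}" and "\<Omega> \<in> {UNIV, {..<0}}"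
    and "regime \<theta> \<xi> \<Omega> lam h"
  shows "lam > 0 \<and>
    (\<forall>x. set_integrable lborel {\<theta> * x<..} (\<lambda>t. h t * phi \<xi> t) \<and>
         lam * h x = (LINT t:{\<theta> * x<..}|lborel. h t * phi \<xi> t)) \<and>
    (\<forall>y\<in>\<Omega>. \<exists>(N :: (nat \<Rightarrow> real) measure) Y.
       markov_chain N (restrict_space borel \<Omega>) (kernel' \<theta> \<xi> \<Omega> lam h) y Y \<and>
       (\<forall>m\<ge>1. \<forall>B\<in>sets (\<Pi>\<^sub>M k\<in>{1..m}. (borel :: (real \<times> real) measure)).
          (\<lambda>n. \<P>(\<omega> in P_y \<xi> y. (\<lambda>k\<in>{1..m}. M_chain k \<omega>) \<in> B \<bar> survives \<theta> n \<omega>))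
            \<longlonglongrightarrow> \<P>(\<omega> in N. (\<lambda>k\<in>{1..m}. (Y k \<omega>, Y (k - 1) \<omega>)) \<in> B)))"
proof -
  have "\<exists>c K K'. ground_state \<theta> \<xi> lam c K K' \<Omega> h"
    using assms(4) unfolding regime_def
    by (elim disjE conjE)
       (use ground_state_i ground_state_ii ground_state_iii ground_state_iv ground_state_v in blast)+
  then obtain c K K' where "ground_state \<theta> \<xi> lam c K K' \<Omega> h" by blast
  then interpret ground_state \<theta> \<xi> lam c K K' \<Omega> h .
  show ?thesis by (rule markov_chain_and_conditional_limit)
qed

end
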